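(* Let $1<p<\infty$, let $B_R\subset\mathbb{R}^n$ be the open ball of radius $R$ centered at the origin, and let $K\subset B_R$ be a compact set (not necessarily convex or connected) whose convex hull $\mathrm{cov}(K)$ has non-empty interior. Let $$I(v)=\int_{B_R}|\nabla v|^p\,dx+\mathrm{Per}(\{v>0\}).$$ If $u$ is a minimizer of $I$ over $\{v\in H^1_0(B_R)\mid v\equiv 1\text{ on }K\}$ and $\tilde u$ is the minimizer of $I$ over $\{v\in H^1_0(B_R)\mid v\equiv 1\text{ on }\mathrm{cov}(K)\}$, then $$\{u>0\}\subset\{\tilde u>0\}.$$
   Context: $\mathrm{Per}(E)$ denotes the perimeter of $E$ in $\mathbb{R}^n$; one sets $\mathrm{Per}(\{v>0\})=+\infty$ if $\chi_{\{v>0\}}\notin BV(\mathbb{R}^n)$. Functions in $H^1_0(B_R)$ are extended by zero to $\mathbb{R}^n$. Minimizers are understood through their continuous representatives. $\mathrm{cov}(K)$ denotes the convex hull of $K$. *)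

theory Defs
  imports "HOL-Analysis.Analysis"
begin

text \<open>
  The class of compactly supported C^1 maps is used as the class of test functions throughout,
  for weak derivatives, for the space of Sobolev functions vanishing on the boundary, and for the
  perimeter; as is well known this gives the same notions as smooth test functions.
\<close>

definition C1c :: "'a::euclidean_space set \<Rightarrow> ('a \<Rightarrow> 'b::real_normed_vector) \<Rightarrow> bool" where
  "C1c U f \<longleftrightarrow>
     (\<exists>f'. (\<forall>x. (f has_derivative blinfun_apply (f' x)) (at x)) \<and> continuous_on UNIV f') \<and>
     compact (closure {x. f x \<noteq> 0}) \<and> closure {x. f x \<noteq> 0} \<subseteq> U"

definition grad :: "('a::euclidean_space \<Rightarrow> real) \<Rightarrow> 'a \<Rightarrow> 'a" where
  "grad f x = (\<Sum>b\<in>Basis. frechet_derivative f (at x) b *\<^sub>R b)"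

definition divergence :: "('a::euclidean_space \<Rightarrow> 'a) \<Rightarrow> 'a \<Rightarrow> real" where
  "divergence T x = (\<Sum>b\<in>Basis. frechet_derivative T (at x) b \<bullet> b)"


section \<open>Sobolev functions\<close>

definition Lp_on :: "real \<Rightarrow> 'a::euclidean_space set \<Rightarrow> ('a \<Rightarrow> 'b::euclidean_space) \<Rightarrow> bool" where
  "Lp_on p U f \<longleftrightarrow>
     set_borel_measurable lebesgue U f \<and> set_integrable lebesgue U (\<lambda>x. norm (f x) powr p)"

definition locally_integrable_on :: "('a::euclidean_space \<Rightarrow> 'b::euclidean_space) \<Rightarrow> 'a set \<Rightarrow> bool" where
  "locally_integrable_on f U \<longleftrightarrow> (\<forall>C. compact C \<and> C \<subseteq> U \<longrightarrow> set_integrable lebesgue C f)"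

definition weak_gradient ::
  "'a::euclidean_space set \<Rightarrow> ('a \<Rightarrow> real) \<Rightarrow> ('a \<Rightarrow> 'a) \<Rightarrow> bool" where
  "weak_gradient U v G \<longleftrightarrow>
     locally_integrable_on v U \<and> locally_integrable_on G U \<and>
     (\<forall>\<phi>. C1c U \<phi> \<longrightarrow> (\<forall>b\<in>Basis.
        (LINT x:U|lebesgue. v x * frechet_derivative \<phi> (at x) b) =
        - (LINT x:U|lebesgue. \<phi> x * (G x \<bullet> b))))"

text \<open>A weak gradient on an open set is unique up to a null set, so any choice will do.\<close>

definition wgrad :: "'a::euclidean_space set \<Rightarrow> ('a \<Rightarrow> real) \<Rightarrow> 'a \<Rightarrow> 'a" where
  "wgrad U v = (SOME G. weak_gradient U v G)"

definition sobolev_W1 :: "real \<Rightarrow> 'a::euclidean_space set \<Rightarrow> ('a \<Rightarrow> real) set" where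
  "sobolev_W1 p U =
     {v. Lp_on p U v \<and> (\<exists>G. weak_gradient U v G) \<and> Lp_on p U (wgrad U v)}"

text \<open>
  The closure of the test functions on \<open>U\<close> in \<open>sobolev_W1 2 U\<close>. Its elements are functions
  (not classes of functions) on the whole space, extended by zero outside \<open>U\<close>.
\<close>

definition H10 :: "'a::euclidean_space set \<Rightarrow> ('a \<Rightarrow> real) set" where
  "H10 U = {v \<in> sobolev_W1 2 U. (\<forall>x. x \<notin> U \<longrightarrow> v x = 0) \<and>
     (\<forall>e>0. \<exists>\<phi>. C1c U \<phi> \<and>
        (LINT x:U|lebesgue. (v x - \<phi> x)\<^sup>2) +
        (LINT x:U|lebesgue. (norm (wgrad U v x - grad \<phi> x))\<^sup>2) < e)}"


section \<open>Perimeter and the functional\<close>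

text \<open>
  The indicator function of \<open>E\<close> is in BV iff \<open>E\<close> is measurable with finite measure and the
  supremum below is finite; in all other cases the value is infinite.
\<close>

definition perimeter :: "'a::euclidean_space set \<Rightarrow> ennreal" where
  "perimeter E =
     (if E \<in> lmeasurable
      then (SUP T\<in>{T :: 'a \<Rightarrow> 'a. C1c UNIV T \<and> (\<forall>x. norm (T x) \<le> 1)}.
              ennreal (LINT x:E|lebesgue. divergence T x))
      else \<infinity>)"

definition energy :: "real \<Rightarrow> real \<Rightarrow> ('a::euclidean_space \<Rightarrow> real) \<Rightarrow> ennreal" where
  "energy p R v =
     (\<integral>\<^sup>+x\<in>ball 0 R. ennreal (norm (wgrad (ball 0 R) v x) powr p) \<partial>lebesgue)
     + perimeter {x. v x > 0}"


section \<open>The constraint\<close>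

text \<open>
  Since \<open>K\<close> may be a null set, the condition \<open>v \<equiv> 1\<close> on \<open>K\<close> for a Sobolev function \<open>v\<close> has to be
  stated for its precise representative, i.e. through its values at Lebesgue points; these exist
  outside a set of p-capacity zero, and that is the exceptional set allowed for the condition.
  If p exceeds the dimension, only the empty set has p-capacity zero. For \<open>v\<close> continuous near \<open>x\<close>,
  \<open>lebesgue_value v x a\<close> just means \<open>v x = a\<close>.
\<close>

definition sobolev_capacity :: "real \<Rightarrow> 'a::euclidean_space set \<Rightarrow> ennreal" where
  "sobolev_capacity p E =
     (INF \<phi>\<in>{\<phi> \<in> sobolev_W1 p UNIV.
                \<exists>V. open V \<and> E \<subseteq> V \<and> (AE x in lebesgue. x \<in> V \<longrightarrow> \<phi> x \<ge> 1)}.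
        \<integral>\<^sup>+x. ennreal (\<bar>\<phi> x\<bar> powr p + norm (wgrad UNIV \<phi> x) powr p) \<partial>lebesgue)"

definition lebesgue_value :: "('a::euclidean_space \<Rightarrow> real) \<Rightarrow> 'a \<Rightarrow> real \<Rightarrow> bool" where
  "lebesgue_value v x a \<longleftrightarrow>
     ((\<lambda>r. (LINT y:ball x r|lebesgue. \<bar>v y - a\<bar>) / measure lebesgue (ball x r)) \<longlongrightarrow> 0)
       (at_right 0)"

definition admissible :: "real \<Rightarrow> real \<Rightarrow> 'a::euclidean_space set \<Rightarrow> ('a \<Rightarrow> real) set" where
  "admissible p R K =
     {v \<in> H10 (ball 0 R). sobolev_capacity p {x \<in> K. \<not> lebesgue_value v x 1} = 0}"

end

theory Submission
  imports Defs
begin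

text \<open>
  Truncation makes \<open>0 \<le> u \<le> 1\<close> and \<open>0 \<le> w\<close>; moreover \<open>w = 1\<close> on all of \<open>K' = convex hull K\<close>, because
  \<open>w\<close> is continuous, sets of capacity zero are null sets and \<open>K'\<close> is the closure of its interior.
  Let \<open>S\<close> be the homothety with factor \<open>t < 1\<close> and centre in \<open>K'\<close>. The maximum of \<open>u \<circ> S\<^sup>-\<^sup>1\<close> and
  \<open>w\<close> competes with \<open>w\<close>, so by submodularity of the perimeter their minimum has at most the energy
  of \<open>u \<circ> S\<^sup>-\<^sup>1\<close>. Scaling back, \<open>q = min u (w \<circ> S)\<close> competes with \<open>u\<close>, and since the Dirichlet
  energy and the perimeter scale differently, the Dirichlet energy of \<open>q\<close> is at most that of \<open>u\<close>.
  As \<open>(u + q) / 2\<close> is positive exactly where \<open>u\<close> is, strict convexity gives \<open>q = u\<close>, that is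
  \<open>u \<le> w \<circ> S\<close>. Now let \<open>t\<close> tend to \<open>1\<close>. No regularity of the free boundary enters.
\<close>

section \<open>Calculus of continuously differentiable maps\<close>

text \<open>Comparing \<open>u\<close> with \<open>w\<close> itself bounds only the sum of Dirichlet
  energy and perimeter of their minimum. This is too weak: the perimeter is not strictly convex, and
  the minimum could have a larger Dirichlet energy and a smaller perimeter than \<open>u\<close>.
  The homothety separates the two terms. In dimension n, passing to
  \<open>u \<circ> S\<^sup>-\<^sup>1\<close> multiplies the Dirichlet energy by t^(n-p) and the
  perimeter by t^(n-1), and the first factor is larger because p > 1. Subtracting t^(n-1) times the
  minimality of \<open>u\<close> leaves a positive multiple of the difference of the Dirichlet
  energies alone. The centre lies in \<open>K'\<close> so that \<open>S\<close> maps
  \<open>K'\<close> into itself and \<open>w \<circ> S\<close> is 1 on \<open>K\<close>; the bound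
  \<open>u \<le> 1\<close> makes the maximum equal to 1 on \<open>K'\<close>. A second obstacle is
  that the function space has exponent 2 and the energy exponent p. Functions are therefore carried
  together with a square integrable gradient (\<open>sob\<close>), while the p-energy is a separate,
  possibly infinite quantity. The cancellations require finite energy, which an explicit competitor
  provides.\<close>

definition C1 :: "('a::euclidean_space \<Rightarrow> 'b::real_normed_vector) \<Rightarrow> bool" where
  "C1 f \<longleftrightarrow> (\<exists>f'. (\<forall>x. (f has_derivative blinfun_apply (f' x)) (at x)) \<and> continuous_on UNIV f')"

definition supp :: "('a::euclidean_space \<Rightarrow> 'b::real_normed_vector) \<Rightarrow> 'a set" where
  "supp f = closure {x. f x \<noteq> 0}"

lemma C1c_iff: "C1c U f \<longleftrightarrow> C1 f \<and> compact (supp f) \<and> supp f \<subseteq> U"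
  unfolding C1c_def C1_def supp_def by auto

lemma C1c_C1: "C1c U f \<Longrightarrow> C1 f"
  by (simp add: C1c_iff)

text \<open>In finite dimension an operator-valued map is continuous as soon as its values on the
  basis vectors are; this reduces the \<open>blinfun\<close> formulation to directional
  derivatives.\<close>

lemma C1I:
  assumes "\<And>x. (f has_derivative D x) (at x)" "\<And>b. b \<in> Basis \<Longrightarrow> continuous_on UNIV (\<lambda>x. D x b)"
  shows "C1 f"
  unfolding C1_def
proof (intro exI conjI allI)
  have eq: "blinfun_apply (Blinfun (D x)) = D x" for x
    using assms(1)[of x] has_derivative_bounded_linear bounded_linear_Blinfun_apply by blast
  show "(f has_derivative blinfun_apply (Blinfun (D x))) (at x)" for x
    using assms(1) eq by simp
  show "continuous_on UNIV (\<lambda>x. Blinfun (D x))"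
    by (rule continuous_on_blinfun_componentwise) (simp add: eq assms(2))
qed

lemma C1_blinfun:
  assumes "C1 f"
  obtains f' where "\<And>x. (f has_derivative blinfun_apply (f' x)) (at x)" "continuous_on UNIV f'"
    "\<And>x. frechet_derivative f (at x) = blinfun_apply (f' x)"
  using assms unfolding C1_def by (metis frechet_derivative_at)

lemma C1_has_derivative:
  assumes "C1 f" shows "(f has_derivative frechet_derivative f (at x)) (at x)"
  using C1_blinfun[OF assms] by metis

lemma C1_continuous: "C1 f \<Longrightarrow> continuous_on S f"
  by (meson C1_has_derivative continuous_at_imp_continuous_on has_derivative_continuous)

lemma C1_continuous_partial:
  assumes "C1 f" shows "continuous_on UNIV (\<lambda>x. frechet_derivative f (at x) b)"
proof -
  obtain f' where "continuous_on UNIV f'" and eq: "\<And>x. frechet_derivative f (at x) = blinfun_apply (f' x)"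
    using C1_blinfun[OF assms] by metis
  then show ?thesis
    by (auto intro!: continuous_intros)
qed

lemma C1_const: "C1 (\<lambda>x. c)"
  by (rule C1I[where D = "\<lambda>x h. 0"]) auto

lemma C1_bounded_linear: "bounded_linear L \<Longrightarrow> C1 L"
  by (rule C1I[where D = "\<lambda>x. L"]) (auto intro: bounded_linear_imp_has_derivative)

lemma C1_bilinear:
  assumes "bounded_bilinear p" "C1 f" "C1 g"
  shows "C1 (\<lambda>x. p (f x) (g x))"
  by (rule C1I[OF bounded_bilinear.FDERIV[OF assms(1) C1_has_derivative[OF assms(2)] C1_has_derivative[OF assms(3)]]])
     (intro continuous_intros bounded_bilinear.continuous_on[OF assms(1)]
        C1_continuous C1_continuous_partial assms)

lemmas C1_scaleR = C1_bilinear[OF bounded_bilinear_scaleR]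
lemmas C1_mult = C1_bilinear[OF bounded_bilinear_mult]
lemmas C1_inner = C1_bilinear[OF bounded_bilinear_inner]

lemma C1_add: "C1 f \<Longrightarrow> C1 g \<Longrightarrow> C1 (\<lambda>x. f x + g x)"
  by (rule C1I[OF has_derivative_add[OF C1_has_derivative C1_has_derivative]])
     (auto intro!: continuous_intros C1_continuous_partial)

lemma C1_diff: "C1 f \<Longrightarrow> C1 g \<Longrightarrow> C1 (\<lambda>x. f x - g x)"
  by (rule C1I[OF has_derivative_diff[OF C1_has_derivative C1_has_derivative]])
     (auto intro!: continuous_intros C1_continuous_partial)

lemma C1_compose:
  assumes "C1 g" "C1 f" shows "C1 (\<lambda>x. g (f x))"
proof -
  obtain g' where g': "\<And>x. (g has_derivative blinfun_apply (g' x)) (at x)" "continuous_on UNIV g'"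
    using C1_blinfun[OF assms(1)] by metis
  have "((\<lambda>x. g (f x)) has_derivative (\<lambda>h. g' (f x) (frechet_derivative f (at x) h))) (at x)" for x
    using diff_chain_at[OF C1_has_derivative[OF assms(2), of x] g'(1)[of "f x"]] by (simp add: o_def)
  then show ?thesis
    by (rule C1I) (intro continuous_intros C1_continuous_partial assms
       continuous_on_compose2[OF g'(2) C1_continuous[OF assms(2)]], auto)
qed

lemma grad_inner_Basis: "b \<in> Basis \<Longrightarrow> grad f x \<bullet> b = frechet_derivative f (at x) b"
  unfolding grad_def by simp

lemma C1_has_grad:
  assumes "C1 f" shows "(f has_derivative (\<lambda>h. grad f x \<bullet> h)) (at x)"
proof -
  let ?D = "frechet_derivative f (at x)"
  have bl: "bounded_linear ?D"
    using C1_has_derivative[OF assms] has_derivative_bounded_linear by blast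
  have "?D = (\<lambda>h. grad f x \<bullet> h)"
    by (rule linear_eq_stdbasis) (auto simp: bl bounded_linear.linear bounded_linear_inner_right grad_inner_Basis)
  then show ?thesis
    using C1_has_derivative[OF assms, of x] by simp
qed

lemma grad_eqI:
  assumes "(f has_derivative (\<lambda>h. g \<bullet> h)) (at x)" shows "grad f x = g"
proof (rule euclidean_eqI)
  fix b :: 'a assume "b \<in> Basis"
  then show "grad f x \<bullet> b = g \<bullet> b"
    using frechet_derivative_at[OF assms] by (simp add: grad_inner_Basis fun_eq_iff)
qed

lemma C1_grad_continuous:
  assumes "C1 f" shows "continuous_on S (grad f)"
  unfolding grad_def
  by (intro continuous_intros continuous_on_subset[OF C1_continuous_partial] assms) auto

lemma C1_gradI:
  fixes f :: "'a::euclidean_space \<Rightarrow> real"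
  assumes "\<And>x. (f has_derivative (\<lambda>h. g x \<bullet> h)) (at x)" "continuous_on UNIV g"
  shows "C1 f"
  by (rule C1I[OF assms(1)]) (intro continuous_intros assms)

lemma divergence_continuous:
  assumes "C1 f" shows "continuous_on S (divergence f)"
  unfolding divergence_def
  by (intro continuous_intros continuous_on_subset[OF C1_continuous_partial] assms) auto

lemma closed_supp [simp]: "closed (supp f)"
  by (simp add: supp_def)

lemma open_Compl_supp [simp]: "open (- supp f)"
  by (simp add: open_Compl)

lemma zero_outside_supp: "x \<notin> supp f \<Longrightarrow> f x = 0"
  using closure_subset[of "{x. f x \<noteq> 0}"] by (auto simp: supp_def)

lemma supp_subset: "closed S \<Longrightarrow> (\<And>x. x \<notin> S \<Longrightarrow> f x = 0) \<Longrightarrow> supp f \<subseteq> S"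
  unfolding supp_def by (rule closure_minimal) auto

text \<open>A compact set outside which \<open>f\<close> vanishes is easier to exhibit than the
  support, which is a closed subset of it.\<close>

lemma C1cI:
  assumes "C1 f" "compact S" "S \<subseteq> U" "\<And>x. x \<notin> S \<Longrightarrow> f x = 0"
  shows "C1c U f"
proof -
  have "supp f \<subseteq> S"
    using assms by (simp add: supp_subset compact_imp_closed)
  moreover have "compact (S \<inter> supp f)"
    using assms by (auto simp: supp_def intro!: compact_Int_closed)
  ultimately show ?thesis
    using assms by (auto simp: C1c_iff Int_absorb1)
qed

lemma derivative_zero_outside_supp:
  assumes "x \<notin> supp f" shows "frechet_derivative f (at x) = (\<lambda>h. 0)"
proof -
  have "(f has_derivative (\<lambda>h. 0)) (at x)"
    by (rule has_derivative_transform_within_open[where s = "- supp f" and f = "\<lambda>x. 0"])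
       (use assms in \<open>auto simp: zero_outside_supp[of _ f]\<close>)
  then show ?thesis
    by (rule frechet_derivative_at[symmetric])
qed

lemma grad_zero_outside_supp: "x \<notin> supp f \<Longrightarrow> grad f x = 0"
  by (simp add: grad_def derivative_zero_outside_supp)

lemma divergence_zero_outside_supp: "x \<notin> supp f \<Longrightarrow> divergence f x = 0"
  by (simp add: divergence_def derivative_zero_outside_supp)

lemma integrable_compact_support:
  fixes g :: "'a::euclidean_space \<Rightarrow> 'b::euclidean_space"
  assumes "continuous_on UNIV g" "compact S" "\<And>x. x \<notin> S \<Longrightarrow> g x = 0"
  shows "integrable lborel g" "integrable lebesgue g"
proof -
  have "(\<lambda>x. indicator S x *\<^sub>R g x) = g"
    using assms(3) by (auto simp: indicator_def)
  then show "integrable lborel g"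
    using borel_integrable_compact[OF assms(2) continuous_on_subset[OF assms(1)]] by auto
  then show "integrable lebesgue g"
    by (simp add: integrable_completion)
qed

lemma bounded_compact_support:
  fixes g :: "'a::euclidean_space \<Rightarrow> 'b::real_normed_vector"
  assumes "continuous_on UNIV g" "compact S" "\<And>x. x \<notin> S \<Longrightarrow> g x = 0"
  shows "\<exists>B>0. \<forall>x. norm (g x) \<le> B"
proof -
  have "compact (g ` S)"
    using assms by (intro compact_continuous_image continuous_on_subset[OF assms(1)]) auto
  then have "bounded (g ` S)"
    by (rule compact_imp_bounded)
  then obtain B where B: "B > 0" "\<And>x. x \<in> S \<Longrightarrow> norm (g x) \<le> B"
    unfolding bounded_pos by auto
  have "norm (g x) \<le> B" for x
    using B assms(3)[of x] by (cases "x \<in> S") auto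
  with B show ?thesis by auto
qed

lemma borel_measurable_continuous_lebesgue:
  fixes g :: "'a::euclidean_space \<Rightarrow> 'b::euclidean_space"
  shows "continuous_on UNIV g \<Longrightarrow> g \<in> borel_measurable lebesgue"
  by (simp add: borel_measurable_continuous_onI measurable_completion)

lemma C1c_bounded:
  assumes "C1c U f" shows "\<exists>B>0. \<forall>x. norm (f x) \<le> B"
proof (rule bounded_compact_support)
  show "continuous_on UNIV f" "compact (supp f)"
    using assms C1_continuous by (auto simp: C1c_iff)
qed (rule zero_outside_supp)

text \<open>The derivative is continuous with compact support, hence bounded, and the mean value
  inequality applies on the whole space. The constant later dominates difference quotients.\<close>

lemma C1c_lipschitz:
  assumes "C1c U f" shows "\<exists>B>0. \<forall>x y. norm (f x - f y) \<le> B * norm (x - y)"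
proof -
  obtain f' where f': "\<And>x. (f has_derivative blinfun_apply (f' x)) (at x)" "continuous_on UNIV f'"
    "\<And>x. frechet_derivative f (at x) = blinfun_apply (f' x)"
    using C1_blinfun[OF C1c_C1[OF assms]] by metis
  have "f' x = 0" if "x \<notin> supp f" for x
    using derivative_zero_outside_supp[OF that] f'(3) by (simp add: blinfun_eqI)
  then obtain B where B: "B > 0" "\<And>x. norm (f' x) \<le> B"
    using bounded_compact_support[OF f'(2), of "supp f"] assms unfolding C1c_iff by auto
  have "norm (f x - f y) \<le> B * norm (x - y)" for x y
    by (rule differentiable_bound[where S = UNIV and f' = "\<lambda>x. blinfun_apply (f' x)"])
       (use f' B in \<open>auto simp: norm_blinfun.rep_eq[symmetric]\<close>)
  with B show ?thesis by auto
qed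

section \<open>Affine changes of variables\<close>

text \<open>A homothety is a coordinatewise affine map with equal factors, so the product of the
  factors becomes a power. The factor may be negative: \<open>m = -1\<close> gives the reflections
  used for convolutions.\<close>

lemma
  fixes m :: real and a :: "'a::euclidean_space"
  assumes "m \<noteq> 0"
  shows lebesgue_homothety: "lebesgue = density (distr lebesgue lebesgue (\<lambda>x. a + m *\<^sub>R x)) (\<lambda>_. ennreal (\<bar>m\<bar> ^ DIM('a)))"
    and measurable_homothety: "(\<lambda>x. a + m *\<^sub>R x) \<in> lebesgue \<rightarrow>\<^sub>M lebesgue"
proof -
  have "(\<lambda>x. a + (\<Sum>j\<in>Basis. (m * (x \<bullet> j)) *\<^sub>R j)) = (\<lambda>x. a + m *\<^sub>R x)"
    unfolding scaleR_scaleR[symmetric] scaleR_sum_right[symmetric] euclidean_representation ..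
  then show "lebesgue = density (distr lebesgue lebesgue (\<lambda>x. a + m *\<^sub>R x)) (\<lambda>_. ennreal (\<bar>m\<bar> ^ DIM('a)))"
    "(\<lambda>x. a + m *\<^sub>R x) \<in> lebesgue \<rightarrow>\<^sub>M lebesgue"
    using lebesgue_affine_euclidean[of "\<lambda>_. m" a] lebesgue_affine_measurable[of "\<lambda>_. m" a] assms by simp_all
qed

lemma nn_integral_homothety:
  fixes f :: "'a::euclidean_space \<Rightarrow> ennreal"
  assumes "m \<noteq> 0" and [measurable]: "f \<in> borel_measurable lebesgue"
  shows "(\<integral>\<^sup>+x. f x \<partial>lebesgue) = ennreal (\<bar>m\<bar> ^ DIM('a)) * (\<integral>\<^sup>+x. f (a + m *\<^sub>R x) \<partial>lebesgue)"
proof -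
  note [measurable] = measurable_homothety[OF assms(1), of a]
  show ?thesis
    by (subst lebesgue_homothety[OF assms(1), of a], subst nn_integral_density)
       (simp_all add: nn_integral_distr nn_integral_cmult)
qed

lemma integral_homothety:
  fixes f :: "'a::euclidean_space \<Rightarrow> 'b::euclidean_space"
  assumes "m \<noteq> 0" and [measurable]: "f \<in> borel_measurable lebesgue"
  shows "(\<integral>x. f x \<partial>lebesgue) = (\<bar>m\<bar> ^ DIM('a)) *\<^sub>R (\<integral>x. f (a + m *\<^sub>R x) \<partial>lebesgue)"
proof -
  note [measurable] = measurable_homothety[OF assms(1), of a]
  show ?thesis
    by (subst lebesgue_homothety[OF assms(1), of a], subst integral_density)
       (simp_all add: integral_distr)
qed

lemma integrable_homothety:
  fixes f :: "'a::euclidean_space \<Rightarrow> 'b::euclidean_space"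
  assumes "m \<noteq> 0" and "integrable lebesgue f"
  shows "integrable lebesgue (\<lambda>x. f (a + m *\<^sub>R x))"
proof -
  note [measurable] = measurable_homothety[OF assms(1), of a] borel_measurable_integrable[OF assms(2)]
  have "integrable (density (distr lebesgue lebesgue (\<lambda>x. a + m *\<^sub>R x)) (\<lambda>_. ennreal (\<bar>m\<bar> ^ DIM('a)))) f"
    using assms lebesgue_homothety[OF assms(1), of a] by simp
  then have "integrable lebesgue (\<lambda>x. (\<bar>m\<bar> ^ DIM('a)) *\<^sub>R f (a + m *\<^sub>R x))"
    by (subst (asm) integrable_density) (auto simp: integrable_distr_eq)
  from integrable_scaleR_right[OF this, of "1 / \<bar>m\<bar> ^ DIM('a)"] show ?thesis
    using assms(1) by simp
qed

lemma integral_translation: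
  fixes f :: "'a::euclidean_space \<Rightarrow> 'b::euclidean_space"
  assumes "f \<in> borel_measurable lebesgue"
  shows "(\<integral>x. f (x + a) \<partial>lebesgue) = (\<integral>x. f x \<partial>lebesgue)"
  using integral_homothety[of 1 f a] assms by (simp add: add.commute)

section \<open>Integration by parts\<close>

text \<open>Difference quotients of \<open>f\<close> integrate to zero by translation invariance and
  converge to the partial derivative; dominated convergence transfers the zero. All integrations by
  parts below rest on this.\<close>

lemma integral_partial_derivative:
  fixes f :: "'a::euclidean_space \<Rightarrow> real"
  assumes "C1c UNIV f"
  shows "(\<integral>x. frechet_derivative f (at x) b \<partial>lebesgue) = 0"
proof -
  have C: "C1 f" "compact (supp f)"
    using assms by (auto simp: C1c_iff)
  have cf: "continuous_on UNIV f"
    using C C1_continuous by blast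
  obtain B where B: "B > 0" "\<forall>x y. norm (f x - f y) \<le> B * norm (x - y)"
    using C1c_lipschitz[OF assms] by blast
  obtain r where r: "supp f \<subseteq> ball 0 r"
    using bounded_subset_ballD[OF compact_imp_bounded[OF C(2)], of 0] by auto
  define h :: "nat \<Rightarrow> real" where "h n = 1 / real (Suc n)" for n
  have h: "h n > 0" "h n \<le> 1" for n
    by (auto simp: h_def)
  define g where "g n x = (f (x + h n *\<^sub>R b) - f x) / h n" for n x
  have int: "integrable lebesgue f"
    using integrable_compact_support[OF cf C(2)] zero_outside_supp by blast
  have int': "integrable lebesgue (\<lambda>x. f (x + h n *\<^sub>R b))" for n
    using integrable_homothety[OF _ int, of 1 "h n *\<^sub>R b"] by (simp add: add.commute)
  have 0: "(\<integral>x. g n x \<partial>lebesgue) = 0" for n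
    unfolding g_def using int int' by (simp add: integral_translation)
  have "(\<lambda>n. \<integral>x. g n x \<partial>lebesgue) \<longlonglongrightarrow> (\<integral>x. frechet_derivative f (at x) b \<partial>lebesgue)"
  proof (rule integral_dominated_convergence)
    show "(\<lambda>x. frechet_derivative f (at x) b) \<in> borel_measurable lebesgue"
      by (intro borel_measurable_continuous_lebesgue C1_continuous_partial C)
    show "g n \<in> borel_measurable lebesgue" for n
      unfolding g_def using int int' by measurable
    \<comment> \<open>The step sizes are at most 1, so a quotient can be nonzero only within
      distance \<open>norm b\<close> of \<open>ball 0 r\<close>; there the Lipschitz bound gives a
      constant majorant.\<close>
    show "integrable lebesgue (\<lambda>x. indicator (cball 0 (r + norm b)) x * (B * norm b))"
      by (intro integrable_mult_left) (simp flip: lmeasurable_iff_integrable)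
    show "AE x in lebesgue. (\<lambda>n. g n x) \<longlonglongrightarrow> frechet_derivative f (at x) b"
    proof (intro AE_I2)
      fix x
      have d: "((\<lambda>s. f (x + s *\<^sub>R b)) has_derivative (\<lambda>s. frechet_derivative f (at x) (s *\<^sub>R b))) (at 0)"
        by (rule has_derivative_compose[where g = f, OF _ , of "\<lambda>s. x + s *\<^sub>R b" "\<lambda>s. s *\<^sub>R b"])
           (use C1_has_derivative[OF C(1), of x] in \<open>auto intro!: derivative_eq_intros\<close>)
      have lin: "linear (frechet_derivative f (at x))"
        using C1_has_derivative[OF C(1)] has_derivative_linear by blast
      have "((\<lambda>s. f (x + s *\<^sub>R b)) has_field_derivative frechet_derivative f (at x) b) (at 0)"
        using d by (simp add: has_field_derivative_def linear_cmul[OF lin] mult.commute[of _ "frechet_derivative f (at x) b"])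
      then have "((\<lambda>s. (f (x + s *\<^sub>R b) - f x) / s) \<longlongrightarrow> frechet_derivative f (at x) b) (at 0)"
        by (simp add: DERIV_def)
      moreover have "filterlim h (at 0) sequentially"
        unfolding filterlim_at using LIMSEQ_Suc[OF lim_1_over_n] h
        by (auto simp: h_def[abs_def] less_imp_neq[symmetric])
      ultimately show "(\<lambda>n. g n x) \<longlonglongrightarrow> frechet_derivative f (at x) b"
        unfolding g_def by (rule filterlim_compose)
    qed
    show "AE x in lebesgue. norm (g n x) \<le> indicator (cball 0 (r + norm b)) x * (B * norm b)" for n
    proof (intro AE_I2)
      fix x
      show "norm (g n x) \<le> indicator (cball 0 (r + norm b)) x * (B * norm b)"
      proof (cases "x \<in> cball 0 (r + norm b)")
        case True
        have "norm (f (x + h n *\<^sub>R b) - f x) \<le> B * (h n * norm b)"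
          using B(2)[rule_format, of "x + h n *\<^sub>R b" x] h[of n] by simp
        then show ?thesis
          using True h[of n] by (simp add: g_def field_simps)
      next
        case False
        have "norm (h n *\<^sub>R b) \<le> norm b"
          using h[of n] by (simp add: mult_left_le_one_le)
        moreover have "norm x \<le> norm (x + h n *\<^sub>R b) + norm (h n *\<^sub>R b)"
          by (metis add_diff_cancel_right' norm_triangle_ineq4)
        moreover have "r + norm b < norm x"
          using False by simp
        ultimately have "r \<le> norm x" "r \<le> norm (x + h n *\<^sub>R b)"
          using norm_ge_zero[of b] by linarith+
        then have "x \<notin> supp f" "x + h n *\<^sub>R b \<notin> supp f"
          using r by (auto simp: subset_iff not_less[symmetric])
        then show ?thesis
          using B by (simp add: g_def zero_outside_supp[of _ f])
      qed
    qed
  qed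
  then show ?thesis
    by (simp add: 0 LIMSEQ_const_iff)
qed

lemma frechet_derivative_componentwise:
  assumes "C1 T" shows "frechet_derivative (\<lambda>x. T x \<bullet> c) (at x) h = frechet_derivative T (at x) h \<bullet> c"
proof -
  have "((\<lambda>x. T x \<bullet> c) has_derivative (\<lambda>h. frechet_derivative T (at x) h \<bullet> c)) (at x)"
    by (intro derivative_intros C1_has_derivative assms)
  from frechet_derivative_at[OF this] show ?thesis
    by (simp add: fun_eq_iff)
qed

lemma integral_divergence:
  fixes T :: "'a::euclidean_space \<Rightarrow> 'a"
  assumes "C1c UNIV T" shows "(\<integral>x. divergence T x \<partial>lebesgue) = 0"
proof -
  have C: "C1 T" "compact (supp T)"
    using assms by (auto simp: C1c_iff)
  have 1: "C1c UNIV (\<lambda>x. T x \<bullet> c)" for c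
    by (rule C1cI[where S = "supp T"]) (use C in \<open>auto intro!: C1_inner C1_const simp: zero_outside_supp[of _ T]\<close>)
  have int: "integrable lebesgue (\<lambda>x. frechet_derivative (\<lambda>x. T x \<bullet> b) (at x) b)" for b
    by (rule integrable_compact_support[where S = "supp (\<lambda>x. T x \<bullet> b)"])
       (use 1[of b] in \<open>auto intro!: C1_continuous_partial simp: C1c_iff derivative_zero_outside_supp\<close>)
  have "(\<integral>x. divergence T x \<partial>lebesgue) = (\<integral>x. (\<Sum>b\<in>Basis. frechet_derivative (\<lambda>x. T x \<bullet> b) (at x) b) \<partial>lebesgue)"
    by (simp add: divergence_def frechet_derivative_componentwise C)
  also have "\<dots> = 0"
    using int integral_partial_derivative[OF 1] by simp
  finally show ?thesis .
qed

lemma divergence_scaleR: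
  assumes "C1 f" "C1 T"
  shows "divergence (\<lambda>x. f x *\<^sub>R T x) x = f x * divergence T x + grad f x \<bullet> T x"
proof -
  have "frechet_derivative (\<lambda>x. f x *\<^sub>R T x) (at x) =
      (\<lambda>h. f x *\<^sub>R frechet_derivative T (at x) h + (grad f x \<bullet> h) *\<^sub>R T x)"
    by (rule frechet_derivative_at[symmetric])
       (intro has_derivative_scaleR C1_has_grad C1_has_derivative assms)
  moreover have "(\<Sum>b\<in>Basis. (grad f x \<bullet> b) * (T x \<bullet> b)) = grad f x \<bullet> T x"
    by (simp add: euclidean_inner[symmetric])
  ultimately show ?thesis
    by (simp add: divergence_def inner_add_left sum.distrib sum_distrib_left)
qed

text \<open>The product of \<open>f\<close> and \<open>T\<close> inherits the compact support of
  \<open>T\<close>, so its divergence integrates to zero; the product rule splits it.\<close>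

lemma integral_by_parts:
  fixes T :: "'a::euclidean_space \<Rightarrow> 'a"
  assumes "C1 f" "C1c UNIV T"
  shows "(\<integral>x. f x * divergence T x \<partial>lebesgue) = - (\<integral>x. grad f x \<bullet> T x \<partial>lebesgue)"
    and "integrable lebesgue (\<lambda>x. f x * divergence T x)"
    and "integrable lebesgue (\<lambda>x. grad f x \<bullet> T x)"
proof -
  have C: "C1 T" "compact (supp T)"
    using assms by (auto simp: C1c_iff)
  have "continuous_on UNIV f" "continuous_on UNIV (grad f)" "continuous_on UNIV T" "continuous_on UNIV (divergence T)"
    using C assms(1) C1_continuous C1_grad_continuous divergence_continuous by blast+
  then have "continuous_on UNIV (\<lambda>x. f x * divergence T x)" "continuous_on UNIV (\<lambda>x. grad f x \<bullet> T x)"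
    by (auto intro!: continuous_intros)
  then show 1: "integrable lebesgue (\<lambda>x. f x * divergence T x)" "integrable lebesgue (\<lambda>x. grad f x \<bullet> T x)"
    by (auto intro!: integrable_compact_support(2)[OF _ C(2)]
         simp: zero_outside_supp[of _ T] divergence_zero_outside_supp)
  have "C1c UNIV (\<lambda>x. f x *\<^sub>R T x)"
    by (rule C1cI[where S = "supp T"]) (use C assms in \<open>auto intro!: C1_scaleR simp: zero_outside_supp[of _ T]\<close>)
  from integral_divergence[OF this]
  have "(\<integral>x. f x * divergence T x + grad f x \<bullet> T x \<partial>lebesgue) = 0"
    by (simp add: divergence_scaleR C assms)
  then show "(\<integral>x. f x * divergence T x \<partial>lebesgue) = - (\<integral>x. grad f x \<bullet> T x \<partial>lebesgue)"
    using 1 by simp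
qed

section \<open>Mollification\<close>

lemma nn_integral_lborel_homothety:
  fixes f :: "'a::euclidean_space \<Rightarrow> ennreal"
  assumes "m \<noteq> 0" "f \<in> borel_measurable borel"
  shows "(\<integral>\<^sup>+x. f x \<partial>lborel) = ennreal (\<bar>m\<bar> ^ DIM('a)) * (\<integral>\<^sup>+x. f (a + m *\<^sub>R x) \<partial>lborel)"
  using nn_integral_homothety[of m f a] assms by (simp add: nn_integral_completion measurable_completion)

lemma nn_integral_lborel_translation:
  fixes f :: "'a::euclidean_space \<Rightarrow> ennreal"
  assumes "f \<in> borel_measurable borel"
  shows "(\<integral>\<^sup>+x. f (x - z) \<partial>lborel) = (\<integral>\<^sup>+x. f x \<partial>lborel)"
  using nn_integral_lborel_homothety[of 1 f "- z"] assms by simp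

lemma integral_lborel_reflection:
  fixes f :: "'a::euclidean_space \<Rightarrow> real"
  assumes [measurable]: "f \<in> borel_measurable borel"
  shows "(\<integral>y. f (x - y) \<partial>lborel) = (\<integral>y. f y \<partial>lborel)"
  using integral_homothety[of "-1" f x] by (simp add: integral_completion measurable_completion)

lemma integrable_lborel_reflection:
  fixes f :: "'a::euclidean_space \<Rightarrow> real"
  assumes "integrable lborel f"
  shows "integrable lborel (\<lambda>y. f (x - y))"
proof -
  have [measurable]: "f \<in> borel_measurable borel"
    using assms by auto
  have "integrable lebesgue f"
    using assms by (simp add: integrable_completion)
  from integrable_homothety[OF _ this, of "-1" x] show ?thesis
    by (simp add: integrable_completion)
qed

text \<open>Squeeze \<open>A\<close> between a compact \<open>C'\<close> and an open
  \<open>U\<close>. A shift shorter than the gap between \<open>C'\<close> and the complement of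
  \<open>U\<close> keeps \<open>C'\<close> inside \<open>U\<close>, so a point gained by the shift
  comes from \<open>A - C'\<close> or lies in \<open>U - A\<close>, both of small measure.\<close>

lemma emeasure_translate_diff:
  fixes A :: "'a::euclidean_space set"
  assumes [measurable]: "A \<in> sets borel" and fin: "emeasure lborel A < \<infinity>" and "e > (0::real)"
  obtains d where "d > 0" "\<And>z. norm z < d \<Longrightarrow> emeasure lborel ({x. x - z \<in> A} - A) \<le> ennreal e"
proof -
  have Al: "A \<in> sets lebesgue" by simp
  have e2: "e / 2 > 0" using assms by simp
  obtain U where U: "open U" "A \<subseteq> U" "emeasure lebesgue (U - A) < ennreal (e/2)"
    using sets_lebesgue_outer_open[OF Al e2] by metis
  obtain C where C: "closed C" "C \<subseteq> A" "emeasure lebesgue (A - C) < ennreal (e/2)"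
    using sets_lebesgue_inner_closed[OF Al e2] by metis
  have [measurable]: "U \<in> sets borel" "C \<in> sets borel"
    using U C by auto
  \<comment> \<open>Cutting \<open>C\<close> down to closed balls makes it compact; the loss tends
    to that of \<open>C\<close> by continuity from above, which uses the finite measure of
    \<open>A\<close>.\<close>
  have lim: "(\<lambda>n. emeasure lborel (A - C \<inter> cball 0 (real n))) \<longlonglongrightarrow> emeasure lborel (\<Inter>n. A - C \<inter> cball 0 (real n))"
  proof (rule Lim_emeasure_decseq)
    show "decseq (\<lambda>n. A - C \<inter> cball 0 (real n))"
      by (auto simp: decseq_def)
    have "emeasure lborel (A - C \<inter> cball 0 (real n)) \<le> emeasure lborel A" for n
      by (intro emeasure_mono) auto
    then show "emeasure lborel (A - C \<inter> cball 0 (real n)) \<noteq> \<infinity>" for n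
      using fin by (metis infinity_ennreal_def leD top.not_eq_extremum)
  qed auto
  have "(\<Inter>n. A - C \<inter> cball 0 (real n)) = A - C"
    by (auto intro: real_arch_simple)
  then have "eventually (\<lambda>n. emeasure lborel (A - C \<inter> cball 0 (real n)) < ennreal (e/2)) sequentially"
    using order_tendstoD(2)[OF lim, of "ennreal (e/2)"] C by simp
  then obtain n where n: "emeasure lborel (A - C \<inter> cball 0 (real n)) < ennreal (e/2)"
    by (auto simp: eventually_sequentially)
  define C' where "C' = C \<inter> cball 0 (real n)"
  have [measurable]: "C' \<in> sets borel"
    by (simp add: C'_def)
  have "compact C'" "C' \<inter> - U = {}" "closed (- U)"
    using C U by (auto simp: C'_def closed_Int_compact)
  then obtain d where d: "d > 0" "\<And>x y. x \<in> C' \<Longrightarrow> y \<in> - U \<Longrightarrow> d \<le> dist x y"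
    using separate_compact_closed[of C' "- U"] by auto
  show thesis
  proof (rule that[OF d(1)])
    fix z :: 'a assume z: "norm z < d"
    have "{x. x - z \<in> A} - A \<subseteq> {x. x - z \<in> A - C'} \<union> (U - A)"
      using d(2)[of "x - z" x for x] z by (force simp: dist_norm)
    then have "emeasure lborel ({x. x - z \<in> A} - A) \<le> emeasure lborel ({x. x - z \<in> A - C'} \<union> (U - A))"
      by (intro emeasure_mono) auto
    also have "\<dots> \<le> emeasure lborel {x. x - z \<in> A - C'} + emeasure lborel (U - A)"
      by (intro emeasure_subadditive) auto
    also have "emeasure lborel {x. x - z \<in> A - C'} = emeasure lborel (A - C')"
    proof -
      have "emeasure lborel {x. x - z \<in> A - C'} = (\<integral>\<^sup>+x. indicator (A - C') (x - z) \<partial>lborel)"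
      proof -
        have "(\<lambda>x. indicator (A - C') (x - z)) = (indicator {x. x - z \<in> A - C'} :: 'a \<Rightarrow> ennreal)"
          by (auto simp: indicator_def)
        then show ?thesis
          by (simp add: nn_integral_indicator)
      qed
      also have "\<dots> = emeasure lborel (A - C')"
        by (subst nn_integral_lborel_translation) auto
      finally show ?thesis .
    qed
    also have "\<dots> + emeasure lborel (U - A) \<le> ennreal (e/2) + ennreal (e/2)"
      using n U by (intro add_mono) (auto simp: C'_def)
    also have "\<dots> = ennreal e"
      using assms(3) by (simp add: ennreal_plus[symmetric] del: ennreal_plus)
    finally show "emeasure lborel ({x. x - z \<in> A} - A) \<le> ennreal e" .
  qed
qed

text \<open>Induction over integrable functions: the measure estimate above settles multiples of
  indicators, sums split the tolerance, and limits follow from a three-term estimate because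
  translations preserve the integral.\<close>

lemma translation_continuous_L1:
  fixes f :: "'a::euclidean_space \<Rightarrow> real"
  assumes "integrable lborel f"
  shows "\<forall>e>0. \<exists>d>0. \<forall>z. norm z < d \<longrightarrow> (\<integral>\<^sup>+x. ennreal (norm (f (x - z) - f x)) \<partial>lborel) \<le> ennreal e"
  using assms
proof (induction rule: integrable_induct)
  case (base A c)
  have [measurable]: "A \<in> sets borel" using base by simp
  show ?case
  proof (intro allI impI)
    fix e :: real assume "e > 0"
    then have e: "e / (2 * (\<bar>c\<bar> + 1)) > 0" by simp
    obtain d where d: "d > 0" "\<And>z. norm z < d \<Longrightarrow> emeasure lborel ({x. x - z \<in> A} - A) \<le> ennreal (e / (2 * (\<bar>c\<bar> + 1)))"
      using emeasure_translate_diff[OF _ base(2) e] base(1) by auto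
    show "\<exists>d>0. \<forall>z. norm z < d \<longrightarrow> (\<integral>\<^sup>+x. ennreal (norm (indicator A (x - z) *\<^sub>R c - indicator A x *\<^sub>R c)) \<partial>lborel) \<le> ennreal e"
    proof (intro exI[of _ d] conjI allI impI d)
      fix z :: 'a assume z: "norm z < d"
      \<comment> \<open>The symmetric difference of \<open>A\<close> and its shift by
        \<open>z\<close> has two halves; the second is the first one for \<open>- z\<close>, moved
        by \<open>z\<close>, so one measure estimate covers both. The 1 added to
        \<open>\<bar>c\<bar>\<close> in the tolerance covers \<open>c = 0\<close>.\<close>
      have "(\<integral>\<^sup>+x. ennreal (norm (indicator A (x - z) *\<^sub>R c - indicator A x *\<^sub>R c)) \<partial>lborel)
         = (\<integral>\<^sup>+x. ennreal \<bar>c\<bar> * (indicator ({x. x - z \<in> A} - A) x + indicator ({x. x - (- z) \<in> A} - A) (x - z)) \<partial>lborel)"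
        by (rule nn_integral_cong) (auto simp: indicator_def)
      also have "\<dots> = ennreal \<bar>c\<bar> * ((\<integral>\<^sup>+x. indicator ({x. x - z \<in> A} - A) x \<partial>lborel) + (\<integral>\<^sup>+x. indicator ({x. x - (- z) \<in> A} - A) (x - z) \<partial>lborel))"
        by (subst nn_integral_cmult, measurable, subst nn_integral_add) auto
      also have "(\<integral>\<^sup>+x. indicator ({x. x - (- z) \<in> A} - A) (x - z) \<partial>lborel) = (\<integral>\<^sup>+x. indicator ({x. x - (- z) \<in> A} - A) x \<partial>lborel)"
        by (rule nn_integral_lborel_translation) auto
      also have "ennreal \<bar>c\<bar> * ((\<integral>\<^sup>+x. indicator ({x. x - z \<in> A} - A) x \<partial>lborel) + (\<integral>\<^sup>+x. indicator ({x. x - (- z) \<in> A} - A) x \<partial>lborel))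
        \<le> ennreal \<bar>c\<bar> * (ennreal (e / (2 * (\<bar>c\<bar> + 1))) + ennreal (e / (2 * (\<bar>c\<bar> + 1))))"
        using d(2)[OF z] d(2)[of "- z"] z by (intro mult_left_mono add_mono) auto
      also have "\<dots> = ennreal (\<bar>c\<bar> * (e / (\<bar>c\<bar> + 1)))"
        using e \<open>e > 0\<close> by (simp add: ennreal_plus[symmetric] ennreal_mult[symmetric] del: ennreal_plus)
           (simp add: field_simps)
      also have "\<dots> \<le> ennreal e"
        using \<open>e > 0\<close> by (intro ennreal_leI) (simp add: field_simps)
      finally show "(\<integral>\<^sup>+x. ennreal (norm (indicator A (x - z) *\<^sub>R c - indicator A x *\<^sub>R c)) \<partial>lborel) \<le> ennreal e" .
    qed
  qed
next
  case (add f g)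
  have [measurable]: "f \<in> borel_measurable borel" "g \<in> borel_measurable borel"
    using add by auto
  show ?case
  proof (intro allI impI)
    fix e :: real assume "e > 0"
    then have e: "e / 2 > 0" by simp
    obtain d1 where d1: "d1 > 0" "\<forall>z. norm z < d1 \<longrightarrow> (\<integral>\<^sup>+x. ennreal (norm (f (x - z) - f x)) \<partial>lborel) \<le> ennreal (e / 2)"
      using add.IH(1)[rule_format, OF e] by (elim exE conjE)
    obtain d2 where d2: "d2 > 0" "\<forall>z. norm z < d2 \<longrightarrow> (\<integral>\<^sup>+x. ennreal (norm (g (x - z) - g x)) \<partial>lborel) \<le> ennreal (e / 2)"
      using add.IH(2)[rule_format, OF e] by (elim exE conjE)
    show "\<exists>d>0. \<forall>z. norm z < d \<longrightarrow> (\<integral>\<^sup>+x. ennreal (norm ((f (x - z) + g (x - z)) - (f x + g x))) \<partial>lborel) \<le> ennreal e"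
    proof (intro exI[of _ "min d1 d2"] conjI allI impI)
      fix z :: 'a assume z: "norm z < min d1 d2"
      have "(\<integral>\<^sup>+x. ennreal (norm ((f (x - z) + g (x - z)) - (f x + g x))) \<partial>lborel)
        \<le> (\<integral>\<^sup>+x. ennreal (norm (f (x - z) - f x)) + ennreal (norm (g (x - z) - g x)) \<partial>lborel)"
        by (rule nn_integral_mono) (simp add: ennreal_plus[symmetric] del: ennreal_plus)
      also have "\<dots> = (\<integral>\<^sup>+x. ennreal (norm (f (x - z) - f x)) \<partial>lborel) + (\<integral>\<^sup>+x. ennreal (norm (g (x - z) - g x)) \<partial>lborel)"
        by (rule nn_integral_add) auto
      also have "\<dots> \<le> ennreal (e/2) + ennreal (e/2)"
        using d1 d2 z by (intro add_mono) auto
      also have "\<dots> = ennreal e"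
        using \<open>e > 0\<close> by (simp add: ennreal_plus[symmetric] del: ennreal_plus)
      finally show "(\<integral>\<^sup>+x. ennreal (norm ((f (x - z) + g (x - z)) - (f x + g x))) \<partial>lborel) \<le> ennreal e" .
    qed (use d1 d2 in auto)
  qed
next
  case (lim f s)
  have [measurable]: "f \<in> borel_measurable borel" "\<And>i. s i \<in> borel_measurable borel"
    using lim by auto
  show ?case
  proof (intro allI impI)
    fix e :: real assume "e > 0"
    then have e: "e / 4 > 0" by simp
    have "integrable lborel (\<lambda>x. 2 * norm (f x))"
      using lim by simp
    then have "(\<integral>\<^sup>+x. ennreal (2 * norm (f x)) \<partial>lborel) < \<infinity>"
      by (simp add: integrable_iff_bounded nn_integral_cmult ennreal_mult' ennreal_mult_less_top)
    then have "(\<lambda>i. \<integral>\<^sup>+x. norm (f x - s i x) \<partial>lborel) \<longlonglongrightarrow> 0"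
      using lim by (intro nn_integral_dominated_convergence_norm[where w = "\<lambda>x. 2 * norm (f x)"]) auto
    from order_tendstoD(2)[OF this, of "ennreal (e/4)"] e
    obtain i where i: "(\<integral>\<^sup>+x. norm (f x - s i x) \<partial>lborel) < ennreal (e/4)"
      by (auto simp: eventually_sequentially)
    obtain d where d: "d > 0" "\<forall>z. norm z < d \<longrightarrow> (\<integral>\<^sup>+x. ennreal (norm (s i (x - z) - s i x)) \<partial>lborel) \<le> ennreal (e / 4)"
      using lim.IH(1)[of i, rule_format, OF e] by (elim exE conjE)
    show "\<exists>d>0. \<forall>z. norm z < d \<longrightarrow> (\<integral>\<^sup>+x. ennreal (norm (f (x - z) - f x)) \<partial>lborel) \<le> ennreal e"
    proof (intro exI[of _ d] conjI allI impI d)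
      fix z :: 'a assume z: "norm z < d"
      have "(\<integral>\<^sup>+x. ennreal (norm (f (x - z) - f x)) \<partial>lborel)
        \<le> (\<integral>\<^sup>+x. ennreal (norm (f (x - z) - s i (x - z))) + (ennreal (norm (s i (x - z) - s i x)) + ennreal (norm (f x - s i x))) \<partial>lborel)"
        by (rule nn_integral_mono) (simp add: ennreal_plus[symmetric] del: ennreal_plus)
      also have "\<dots> = (\<integral>\<^sup>+x. ennreal (norm (f (x - z) - s i (x - z))) \<partial>lborel)
         + ((\<integral>\<^sup>+x. ennreal (norm (s i (x - z) - s i x)) \<partial>lborel) + (\<integral>\<^sup>+x. ennreal (norm (f x - s i x)) \<partial>lborel))"
        by (simp add: nn_integral_add)
      also have "(\<integral>\<^sup>+x. ennreal (norm (f (x - z) - s i (x - z))) \<partial>lborel) = (\<integral>\<^sup>+x. ennreal (norm (f x - s i x)) \<partial>lborel)"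
        by (rule nn_integral_lborel_translation[where f = "\<lambda>x. ennreal (norm (f x - s i x))"]) simp
      also have "(\<integral>\<^sup>+x. ennreal (norm (f x - s i x)) \<partial>lborel)
         + ((\<integral>\<^sup>+x. ennreal (norm (s i (x - z) - s i x)) \<partial>lborel) + (\<integral>\<^sup>+x. ennreal (norm (f x - s i x)) \<partial>lborel))
         \<le> ennreal (e/4) + (ennreal (e/4) + ennreal (e/4))"
        using d z i by (intro add_mono) auto
      also have "\<dots> \<le> ennreal e"
        using \<open>e > 0\<close> by (simp add: ennreal_plus[symmetric] del: ennreal_plus)
      finally show "(\<integral>\<^sup>+x. ennreal (norm (f (x - z) - f x)) \<partial>lborel) \<le> ennreal e" .
    qed
  qed
qed

text \<open>The number \<open>e\<close> only bounds the radius of the support, so a mollifier for a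
  small radius is one for every larger radius and several tolerances can be met at once.\<close>

definition mollifier :: "real \<Rightarrow> ('a::euclidean_space \<Rightarrow> real) \<Rightarrow> bool" where
  "mollifier e \<eta> \<longleftrightarrow> C1c UNIV \<eta> \<and> (\<forall>x. 0 \<le> \<eta> x) \<and> (\<forall>x. e \<le> norm x \<longrightarrow> \<eta> x = 0) \<and> (\<integral>x. \<eta> x \<partial>lborel) = 1"

text \<open>Squaring removes the kink of the positive part. This is the \<open>C1\<close> building
  block of the mollifier, of the softened positive part and of the cut-off.\<close>

lemma has_real_derivative_sq_pos_part:
  "((\<lambda>s. (max 0 s)\<^sup>2) has_real_derivative 2 * max 0 s) (at s)"
proof (cases s "0::real" rule: linorder_cases)
  case less
  have "((\<lambda>s. 0) has_real_derivative 0) (at s)" by simp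
  then have "((\<lambda>s. (max 0 s)\<^sup>2) has_real_derivative 0) (at s)"
    by (rule has_field_derivative_transform_within_open[where S = "{..<0}"]) (use less in auto)
  then show ?thesis using less by simp
next
  case equal
  have "((\<lambda>h::real. (max 0 h)\<^sup>2 / h) \<longlongrightarrow> 0) (at 0)"
  proof (rule Lim_null_comparison)
    have "((\<lambda>h::real. \<bar>h\<bar>) \<longlongrightarrow> \<bar>0\<bar>) (at 0)" by (intro tendsto_intros)
    then show "((\<lambda>h::real. \<bar>h\<bar>) \<longlongrightarrow> 0) (at 0)" by simp
    have "norm ((max 0 h)\<^sup>2 / h) \<le> \<bar>h\<bar>" for h :: real
      by (cases "h > 0") (auto simp: power2_eq_square max_def)
    then show "\<forall>\<^sub>F h in at 0. norm ((max 0 h)\<^sup>2 / h) \<le> \<bar>h\<bar>" by simp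
  qed
  then show ?thesis using equal by (simp add: DERIV_def)
next
  case greater
  have "((\<lambda>s. s\<^sup>2) has_real_derivative 2 * s) (at s)"
    by (auto intro!: derivative_eq_intros)
  then have "((\<lambda>s. (max 0 s)\<^sup>2) has_real_derivative 2 * s) (at s)"
    by (rule has_field_derivative_transform_within_open[where S = "{0<..}"]) (use greater in auto)
  then show ?thesis using greater by simp
qed

lemma C1_realI:
  assumes "\<And>s. (h has_real_derivative h' s) (at s)" "continuous_on UNIV h'"
  shows "C1 h"
  by (rule C1I[where D = "\<lambda>s t. h' s * t"]) (use assms in \<open>auto simp: has_field_derivative_def intro!: continuous_intros\<close>)

lemma C1_sq_pos_part: "C1 (\<lambda>s::real. (max 0 s)\<^sup>2)"
  by (rule C1_realI[OF has_real_derivative_sq_pos_part]) (intro continuous_intros)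

text \<open>The square of the positive part of e^2 - |x|^2 is \<open>C1\<close> and positive exactly
  on the ball of radius \<open>e\<close>; its integral is positive because balls have positive
  measure, and dividing by it normalises.\<close>

lemma mollifier_exists:
  assumes "e > 0" shows "\<exists>\<eta>::'a::euclidean_space \<Rightarrow> real. mollifier e \<eta>"
proof -
  define k :: "'a \<Rightarrow> real" where "k x = (max 0 (e\<^sup>2 - x \<bullet> x))\<^sup>2" for x
  have "C1 (\<lambda>x::'a. e\<^sup>2 - x \<bullet> x)"
    by (intro C1_diff C1_const C1_inner C1_bounded_linear[OF bounded_linear_ident])
  then have Ck: "C1 k"
    unfolding k_def by (rule C1_compose[OF C1_sq_pos_part])
  have pos_iff: "k x > 0 \<longleftrightarrow> norm x < e" for x
    using assms by (auto simp: k_def power2_norm_eq_inner[symmetric] max_def power_strict_mono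
       not_le dest: power_less_imp_less_base intro: power2_less_imp_less)
  have k0: "k x \<ge> 0" for x by (simp add: k_def)
  have kz: "k x = 0" if "e \<le> norm x" for x
    using pos_iff[of x] k0[of x] that by auto
  have Ckc: "C1c UNIV k"
    by (rule C1cI[OF Ck compact_cball[of 0 e]]) (auto intro!: kz)
  have int: "integrable lborel k"
    by (rule integrable_compact_support[OF C1_continuous[OF Ck] compact_cball[of 0 e]]) (auto intro!: kz)
  have "(\<integral>x. k x \<partial>lborel) \<noteq> 0"
  proof
    assume "(\<integral>x. k x \<partial>lborel) = 0"
    then have "AE x in lborel. k x = 0"
      using integral_nonneg_eq_0_iff_AE[OF int] k0 by auto
    moreover have "x \<notin> ball 0 e" if "k x = 0" for x
      using pos_iff[of x] that by simp
    ultimately have "AE x in lborel. x \<notin> ball (0::'a) e"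
      by (rule eventually_mono)
    then have "emeasure lborel (ball (0::'a) e) = 0"
      by (subst (asm) AE_iff_null) (auto simp: null_sets_def ball_def)
    moreover have "emeasure lborel (ball (0::'a) e) \<noteq> 0"
      using content_ball_pos[OF assms, of "0::'a"] by (auto simp: measure_def)
    ultimately show False by simp
  qed
  moreover have "(\<integral>x. k x \<partial>lborel) \<ge> 0"
    using k0 by simp
  ultimately have c: "(\<integral>x. k x \<partial>lborel) > 0" by simp
  define \<eta> where "\<eta> x = (1 / (\<integral>x. k x \<partial>lborel)) * k x" for x
  have "C1 \<eta>"
    unfolding \<eta>_def by (intro C1_mult C1_const Ck)
  then have "C1c UNIV \<eta>"
    by (rule C1cI[OF _ compact_cball[of 0 e]]) (auto simp: \<eta>_def kz)
  moreover have "(\<integral>x. \<eta> x \<partial>lborel) = 1"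
    using c int unfolding \<eta>_def by simp
  ultimately have "mollifier e \<eta>"
    using k0 kz c by (auto simp: mollifier_def \<eta>_def)
  then show ?thesis by blast
qed

section \<open>Convolution with a mollifier\<close>

definition conv :: "('a::euclidean_space \<Rightarrow> real) \<Rightarrow> ('a \<Rightarrow> real) \<Rightarrow> 'a \<Rightarrow> real" where
  "conv \<eta> f x = (\<integral>y. \<eta> (x - y) * f y \<partial>lborel)"

text \<open>Two points at distance less than 1 either both lie in a compact ball slightly larger
  than one containing \<open>S\<close>, or both lie outside \<open>S\<close>, where \<open>g\<close>
  vanishes.\<close>

lemma uniformly_continuous_compact_support:
  fixes g :: "'a::euclidean_space \<Rightarrow> 'b::euclidean_space"
  assumes "continuous_on UNIV g" "compact S" "\<And>x. x \<notin> S \<Longrightarrow> g x = 0" "e > 0"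
  obtains d where "d > 0" "\<And>x y. norm (x - y) < d \<Longrightarrow> norm (g x - g y) < e"
proof -
  obtain r where r: "S \<subseteq> ball 0 r"
    using bounded_subset_ballD[OF compact_imp_bounded[OF assms(2)], of 0] by auto
  have "uniformly_continuous_on (cball 0 (r + 1)) g"
    by (rule compact_uniformly_continuous[OF continuous_on_subset[OF assms(1)]]) auto
  then obtain d where d: "d > 0" "\<And>x y. x \<in> cball 0 (r + 1) \<Longrightarrow> y \<in> cball 0 (r+1) \<Longrightarrow> dist y x < d \<Longrightarrow> dist (g y) (g x) < e"
    unfolding uniformly_continuous_on_def using assms(4) by metis
  have "norm (g x - g y) < e" if n: "norm (x - y) < min d 1" for x y
  proof (cases "norm x \<le> r + 1 \<and> norm y \<le> r + 1")
    case True
    then show ?thesis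
      using d(2)[of y x] n by (simp add: dist_norm)
  next
    case False
    have "norm x \<le> norm y + norm (x - y)" "norm y \<le> norm x + norm (x - y)"
      by (metis norm_triangle_sub norm_minus_commute add.commute)+
    then have "r \<le> norm x" "r \<le> norm y"
      using False n by auto
    then have "x \<notin> S" "y \<notin> S"
      using r by (auto simp: subset_iff not_less[symmetric])
    then show ?thesis
      using assms by simp
  qed
  then show thesis
    using that[of "min d 1"] d(1) by auto
qed

lemma integrable_bounded_mult:
  fixes k :: "'a \<Rightarrow> 'b::euclidean_space" and f :: "'a \<Rightarrow> real"
  assumes "integrable M f" "k \<in> borel_measurable M" "\<And>y. norm (k y) \<le> B"
  shows "integrable M (\<lambda>y. f y *\<^sub>R k y)"
proof (rule Bochner_Integration.integrable_bound)
  show "integrable M (\<lambda>y. B * f y)"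
    using assms by simp
  have "norm (f y *\<^sub>R k y) \<le> norm (B * f y)" for y
    using mult_left_mono[OF assms(3)[of y], of "\<bar>f y\<bar>"]
    by (simp add: abs_mult) (smt (verit) mult.commute mult_right_mono abs_ge_zero)
  then show "AE y in M. norm (f y *\<^sub>R k y) \<le> norm (B * f y)" by simp
qed (use assms in auto)

text \<open>Differentiation under the integral sign. Uniform continuity of the gradient of the
  kernel makes its linearisation error uniformly small, and integrating this against |f| keeps it
  small for every integrable \<open>f\<close>.\<close>

lemma C1_conv:
  fixes f :: "'a::euclidean_space \<Rightarrow> real"
  assumes "C1c UNIV \<eta>" and f: "integrable lborel f"
  shows "C1 (conv \<eta> f)"
proof -
  have C: "C1 \<eta>" "compact (supp \<eta>)"
    using assms by (auto simp: C1c_iff)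
  have c\<eta>: "continuous_on UNIV \<eta>" "continuous_on UNIV (grad \<eta>)"
    using C C1_continuous C1_grad_continuous by blast+
  then have [measurable]: "\<eta> \<in> borel_measurable borel" "grad \<eta> \<in> borel_measurable borel" "f \<in> borel_measurable borel"
    using f by (auto intro: borel_measurable_continuous_onI)
  obtain B1 where B1: "\<forall>x. norm (\<eta> x) \<le> B1"
    using bounded_compact_support[OF c\<eta>(1) C(2) zero_outside_supp[of _ \<eta>]] by blast
  obtain B2 where B2: "\<forall>x. norm (grad \<eta> x) \<le> B2"
    using bounded_compact_support[OF c\<eta>(2) C(2) grad_zero_outside_supp[of _ \<eta>]] by blast
  have int1: "integrable lborel (\<lambda>y. f y *\<^sub>R \<eta> (x - y))" for x
    by (rule integrable_bounded_mult[OF f]) (use B1 in auto)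
  have int2: "integrable lborel (\<lambda>y. f y *\<^sub>R grad \<eta> (x - y))" for x
    by (rule integrable_bounded_mult[OF f]) (use B2 in auto)
  define I where "I = (\<integral>y. \<bar>f y\<bar> \<partial>lborel)"
  have I0: "I \<ge> 0" by (simp add: I_def)
  have If: "integrable lborel (\<lambda>y. \<bar>f y\<bar>)" using f by simp
  have conv_eq: "conv \<eta> f x = (\<integral>y. f y *\<^sub>R \<eta> (x - y) \<partial>lborel)" for x
    by (simp add: conv_def mult.commute)
  define g where "g x = (\<integral>y. f y *\<^sub>R grad \<eta> (x - y) \<partial>lborel)" for x
  \<comment> \<open>The denominator \<open>I + 1\<close> stays positive when the integral
    \<open>I\<close> of |f| is zero; integrating the error against |f| then costs the factor I / (I
    + 1), at most 1.\<close>
  have uc: "\<exists>d>0. \<forall>x y. norm (x - y) < d \<longrightarrow> norm (grad \<eta> x - grad \<eta> y) \<le> e / (I + 1)" if "e > 0" for e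
    using uniformly_continuous_compact_support[OF c\<eta>(2) C(2) grad_zero_outside_supp[of _ \<eta>], of "e / (I + 1)"] that I0
    by (metis add_nonneg_pos divide_pos_pos less_eq_real_def zero_less_one)
  have bnd: "(\<integral>y. \<bar>f y\<bar> * (c * (e / (I + 1))) \<partial>lborel) \<le> e * c" if "e > 0" "c \<ge> 0" for c e
  proof -
    have "(\<integral>y. \<bar>f y\<bar> * (c * (e / (I + 1))) \<partial>lborel) = I * (c * (e / (I + 1)))"
      by (simp add: I_def)
    also have "\<dots> = (I / (I + 1)) * (e * c)" by simp
    also have "\<dots> \<le> 1 * (e * c)"
      using I0 that by (intro mult_right_mono) auto
    finally show ?thesis by simp
  qed
  show ?thesis
  proof (rule C1_gradI)
    show "(conv \<eta> f has_derivative (\<lambda>h. g x \<bullet> h)) (at x)" for x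
      unfolding has_derivative_at_alt
    proof (intro conjI allI impI bounded_linear_inner_right)
      fix e :: real assume "e > 0"
      then obtain d where d: "d > 0" "\<forall>x y. norm (x - y) < d \<longrightarrow> norm (grad \<eta> x - grad \<eta> y) \<le> e / (I + 1)"
        using uc by blast
      show "\<exists>d>0. \<forall>y. norm (y - x) < d \<longrightarrow> norm (conv \<eta> f y - conv \<eta> f x - g x \<bullet> (y - x)) \<le> e * norm (y - x)"
      proof (intro exI[of _ d] conjI allI impI d)
        fix x' assume x': "norm (x' - x) < d"
        have pt: "norm (\<eta> (x' - y) - \<eta> (x - y) - grad \<eta> (x - y) \<bullet> (x' - x)) \<le> norm (x' - x) * (e / (I + 1))" for y
        proof -
          have "norm (\<eta> (x' - y) - \<eta> (x - y) - grad \<eta> (x - y) \<bullet> ((x' - y) - (x - y))) \<le> norm ((x' - y) - (x - y)) * (e / (I + 1))"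
          proof (rule differentiable_bound_linearization[where S = "ball (x - y) d" and f' = "\<lambda>z h. grad \<eta> z \<bullet> h"])
            fix t :: real assume t: "t \<in> {0..1}"
            have "norm (t *\<^sub>R (x' - y - (x - y))) \<le> norm (x' - x)"
              using t by (simp add: mult_left_le_one_le)
            then show "x - y + t *\<^sub>R (x' - y - (x - y)) \<in> ball (x - y) d"
              using x' by (simp add: dist_norm)
          next
            fix z assume z: "z \<in> ball (x - y) d"
            show "(\<eta> has_derivative (\<lambda>h. grad \<eta> z \<bullet> h)) (at z within ball (x - y) d)"
              by (rule has_derivative_at_withinI[OF C1_has_grad[OF C(1)]])
            have "norm (grad \<eta> z - grad \<eta> (x - y)) \<le> e / (I + 1)"
              using d(2) z by (auto simp: dist_norm norm_minus_commute)
            then have "norm (grad \<eta> z - grad \<eta> (x - y)) * norm h \<le> e / (I + 1) * norm h" for h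
              by (rule mult_right_mono) simp
            then have "norm ((grad \<eta> z - grad \<eta> (x - y)) \<bullet> h) \<le> e / (I + 1) * norm h" for h
              using order_trans[OF Cauchy_Schwarz_ineq2] unfolding real_norm_def by blast
            then show "onorm ((\<lambda>h. grad \<eta> z \<bullet> h) - (\<lambda>h. grad \<eta> (x - y) \<bullet> h)) \<le> e / (I + 1)"
              by (intro onorm_le) (simp add: inner_diff_left[symmetric])
          qed (use d in auto)
          then show ?thesis by simp
        qed
        have "conv \<eta> f x' - conv \<eta> f x - g x \<bullet> (x' - x)
          = (\<integral>y. f y *\<^sub>R (\<eta> (x' - y) - \<eta> (x - y) - grad \<eta> (x - y) \<bullet> (x' - x)) \<partial>lborel)"
        proof -
          have "g x \<bullet> (x' - x) = (\<integral>y. f y *\<^sub>R (grad \<eta> (x - y) \<bullet> (x' - x)) \<partial>lborel)"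
            unfolding g_def using integral_inner_left[OF int2[of x], of "x' - x"] by simp
          moreover have "integrable lborel (\<lambda>y. f y *\<^sub>R (grad \<eta> (x - y) \<bullet> (x' - x)))"
            using integrable_inner_left[OF int2[of x], of "x' - x"] by simp
          ultimately show ?thesis
            unfolding conv_eq using int1 by (simp add: right_diff_distrib)
        qed
        also have "norm \<dots> \<le> (\<integral>y. \<bar>f y\<bar> * (norm (x' - x) * (e / (I + 1))) \<partial>lborel)"
        proof (rule Bochner_Integration.integral_norm_bound_integral)
          show "integrable lborel (\<lambda>y. f y *\<^sub>R (\<eta> (x' - y) - \<eta> (x - y) - grad \<eta> (x - y) \<bullet> (x' - x)))"
            by (rule integrable_bounded_mult[OF f]) (use pt in auto)
          show "norm (f y *\<^sub>R (\<eta> (x' - y) - \<eta> (x - y) - grad \<eta> (x - y) \<bullet> (x' - x))) \<le> \<bar>f y\<bar> * (norm (x' - x) * (e / (I + 1)))" for y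
            using mult_left_mono[OF pt[of y], of "\<bar>f y\<bar>"] by (simp add: abs_mult)
        qed (use If in auto)
        also have "\<dots> \<le> e * norm (x' - x)"
          by (rule bnd) (use \<open>e > 0\<close> in auto)
        finally show "norm (conv \<eta> f x' - conv \<eta> f x - g x \<bullet> (x' - x)) \<le> e * norm (x' - x)" .
      qed
    qed
    show "continuous_on UNIV g"
      unfolding continuous_on_iff
    proof (intro ballI allI impI)
      fix x e assume "(e::real) > 0"
      then have "e / 2 > 0" by simp
      then obtain d where d: "d > 0" "\<forall>x y. norm (x - y) < d \<longrightarrow> norm (grad \<eta> x - grad \<eta> y) \<le> (e / 2) / (I + 1)"
        using uc by blast
      show "\<exists>d>0. \<forall>x'\<in>UNIV. dist x' x < d \<longrightarrow> dist (g x') (g x) < e"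
      proof (intro exI[of _ d] conjI ballI impI d)
        fix x' assume x': "dist x' x < d"
        then have pt: "norm (grad \<eta> (x' - y) - grad \<eta> (x - y)) \<le> 1 * ((e / 2) / (I + 1))" for y
          using d(2) by (simp add: dist_norm)
        have "g x' - g x = (\<integral>y. f y *\<^sub>R (grad \<eta> (x' - y) - grad \<eta> (x - y)) \<partial>lborel)"
          unfolding g_def using int2 by (simp add: scaleR_diff_right)
        also have "norm \<dots> \<le> (\<integral>y. \<bar>f y\<bar> * (1 * ((e / 2) / (I + 1))) \<partial>lborel)"
        proof (rule Bochner_Integration.integral_norm_bound_integral)
          show "integrable lborel (\<lambda>y. f y *\<^sub>R (grad \<eta> (x' - y) - grad \<eta> (x - y)))"
            by (rule integrable_bounded_mult[OF f]) (use pt in auto)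
          show "norm (f y *\<^sub>R (grad \<eta> (x' - y) - grad \<eta> (x - y))) \<le> \<bar>f y\<bar> * (1 * ((e / 2) / (I + 1)))" for y
            using mult_left_mono[OF pt[of y], of "\<bar>f y\<bar>"] by simp
        qed (use If in auto)
        also have "\<dots> \<le> (e / 2) * 1"
          by (rule bnd) (use \<open>e > 0\<close> in auto)
        finally show "dist (g x') (g x) < e"
          using \<open>e > 0\<close> by (simp add: dist_norm)
      qed
    qed
  qed
qed

lemma conv_reflect:
  assumes [measurable]: "\<eta> \<in> borel_measurable borel" "f \<in> borel_measurable borel"
  shows "conv \<eta> f x = (\<integral>z. \<eta> z * f (x - z) \<partial>lborel)"
  unfolding conv_def using integral_lborel_reflection[of "\<lambda>z. \<eta> z * f (x - z)" x] by simp

lemma mollifierD: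
  assumes "mollifier e \<eta>"
  shows "C1c UNIV \<eta>" "\<eta> x \<ge> 0" "e \<le> norm x \<Longrightarrow> \<eta> x = 0" "integrable lborel \<eta>" "(\<integral>x. \<eta> x \<partial>lborel) = 1"
    "\<eta> \<in> borel_measurable borel" "(\<integral>\<^sup>+x. ennreal (\<eta> x) \<partial>lborel) = 1"
proof -
  show 1: "C1c UNIV \<eta>" "\<eta> x \<ge> 0" "e \<le> norm x \<Longrightarrow> \<eta> x = 0" "(\<integral>x. \<eta> x \<partial>lborel) = 1" for x
    using assms by (auto simp: mollifier_def)
  show 2: "integrable lborel \<eta>"
    using 1(1) integrable_compact_support(1)[OF C1_continuous[OF C1c_C1[OF 1(1)]] _ zero_outside_supp[of _ \<eta>]] by (auto simp: C1c_iff)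
  then show "\<eta> \<in> borel_measurable borel" by auto
  show "(\<integral>\<^sup>+x. ennreal (\<eta> x) \<partial>lborel) = 1"
    using nn_integral_eq_integral[OF 2] 1 by simp
qed

text \<open>Since the kernel has integral 1, \<open>conv \<eta> f - f\<close> is an average over
  shifts \<open>z\<close> with \<open>norm z < d\<close> of the translate of \<open>f\<close> minus
  \<open>f\<close>. Exchanging the integrals bounds its norm by the worst translation error.\<close>

lemma conv_L1:
  fixes f :: "'a::euclidean_space \<Rightarrow> real"
  assumes f: "integrable lborel f" and "e > 0"
  shows "\<exists>d>0. \<forall>\<eta>. mollifier d \<eta> \<longrightarrow> (\<integral>\<^sup>+x. ennreal \<bar>conv \<eta> f x - f x\<bar> \<partial>lborel) \<le> ennreal e"
proof -
  have [measurable]: "f \<in> borel_measurable borel" using f by auto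
  obtain d where d: "d > 0" "\<forall>z. norm z < d \<longrightarrow> (\<integral>\<^sup>+x. ennreal (norm (f (x - z) - f x)) \<partial>lborel) \<le> ennreal e"
    using translation_continuous_L1[OF f] assms(2) by blast
  show ?thesis
  proof (intro exI[of _ d] conjI allI impI d(1))
    fix \<eta> :: "'a \<Rightarrow> real" assume m: "mollifier d \<eta>"
    note \<eta> = mollifierD[OF m]
    have [measurable]: "\<eta> \<in> borel_measurable borel" by (rule \<eta>)
    obtain B where B: "\<forall>x. norm (\<eta> x) \<le> B"
      using C1c_bounded[OF \<eta>(1)] by blast
    have int: "integrable lborel (\<lambda>z. \<eta> z * f (x - z))" for x
      using integrable_bounded_mult[OF integrable_lborel_reflection[OF f], of \<eta> B x] B by (simp add: mult.commute)
    have "ennreal \<bar>conv \<eta> f x - f x\<bar> \<le> (\<integral>\<^sup>+z. ennreal (\<eta> z * norm (f (x - z) - f x)) \<partial>lborel)" for x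
    proof -
      have "conv \<eta> f x - f x = (\<integral>z. \<eta> z * f (x - z) - \<eta> z * f x \<partial>lborel)"
        using int \<eta>(4,5) by (simp add: conv_reflect)
      also have "ennreal (norm \<dots>) \<le> (\<integral>\<^sup>+z. ennreal (norm (\<eta> z * f (x - z) - \<eta> z * f x)) \<partial>lborel)"
        using int \<eta>(4) by (intro integral_norm_bound_ennreal) auto
      also have "\<dots> = (\<integral>\<^sup>+z. ennreal (\<eta> z * norm (f (x - z) - f x)) \<partial>lborel)"
        using \<eta>(2) by (intro nn_integral_cong) (simp add: right_diff_distrib[symmetric] abs_mult)
      finally show ?thesis by simp
    qed
    then have "(\<integral>\<^sup>+x. ennreal \<bar>conv \<eta> f x - f x\<bar> \<partial>lborel)
      \<le> (\<integral>\<^sup>+x. (\<integral>\<^sup>+z. ennreal (\<eta> z * norm (f (x - z) - f x)) \<partial>lborel) \<partial>lborel)"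
      by (intro nn_integral_mono)
    also have "\<dots> = (\<integral>\<^sup>+z. (\<integral>\<^sup>+x. ennreal (\<eta> z * norm (f (x - z) - f x)) \<partial>lborel) \<partial>lborel)"
      by (rule lborel_pair.Fubini') measurable
    also have "\<dots> \<le> (\<integral>\<^sup>+z. ennreal (\<eta> z) * ennreal e \<partial>lborel)"
    proof (rule nn_integral_mono)
      fix z
      have "(\<integral>\<^sup>+x. ennreal (\<eta> z * norm (f (x - z) - f x)) \<partial>lborel) = ennreal (\<eta> z) * (\<integral>\<^sup>+x. ennreal (norm (f (x - z) - f x)) \<partial>lborel)"
        using \<eta>(2) by (simp add: ennreal_mult nn_integral_cmult)
      also have "\<dots> \<le> ennreal (\<eta> z) * ennreal e"
      proof (cases "norm z < d")
        case True
        then show ?thesis using d by (intro mult_left_mono) auto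
      qed (use \<eta>(3)[of z] in auto)
      finally show "(\<integral>\<^sup>+x. ennreal (\<eta> z * norm (f (x - z) - f x)) \<partial>lborel) \<le> ennreal (\<eta> z) * ennreal e" .
    qed
    also have "\<dots> = ennreal e"
      using \<eta>(7) by (simp add: nn_integral_multc)
    finally show "(\<integral>\<^sup>+x. ennreal \<bar>conv \<eta> f x - f x\<bar> \<partial>lborel) \<le> ennreal e" .
  qed
qed

lemma mollifier_mono: "mollifier d \<eta> \<Longrightarrow> d \<le> e \<Longrightarrow> mollifier e \<eta>"
  by (auto simp: mollifier_def)

section \<open>Derivatives and test functions under homotheties\<close>

lemma frechet_derivative_homothety:
  fixes f :: "'a::euclidean_space \<Rightarrow> 'b::real_normed_vector"
  assumes "C1 f"
  shows "frechet_derivative (\<lambda>x. f (a + m *\<^sub>R x)) (at x) h = m *\<^sub>R frechet_derivative f (at (a + m *\<^sub>R x)) h"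
proof -
  have 1: "((\<lambda>x. a + m *\<^sub>R x) has_derivative (\<lambda>h. m *\<^sub>R h)) (at x)"
    by (auto intro!: derivative_eq_intros)
  have "((\<lambda>x. f (a + m *\<^sub>R x)) has_derivative (\<lambda>h. frechet_derivative f (at (a + m *\<^sub>R x)) (m *\<^sub>R h))) (at x)"
    using diff_chain_at[OF 1 C1_has_derivative[OF assms]] by (simp add: o_def)
  from frechet_derivative_at[OF this]
  have "frechet_derivative (\<lambda>x. f (a + m *\<^sub>R x)) (at x) h = frechet_derivative f (at (a + m *\<^sub>R x)) (m *\<^sub>R h)"
    by (simp add: fun_eq_iff)
  also have "\<dots> = m *\<^sub>R frechet_derivative f (at (a + m *\<^sub>R x)) h"
    using linear_cmul[OF has_derivative_linear[OF C1_has_derivative[OF assms]]] .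
  finally show ?thesis .
qed

lemma grad_homothety:
  "C1 f \<Longrightarrow> grad (\<lambda>x. f (a + m *\<^sub>R x)) x = m *\<^sub>R grad f (a + m *\<^sub>R x)"
  by (simp add: grad_def frechet_derivative_homothety scaleR_sum_right)

lemma divergence_homothety:
  "C1 T \<Longrightarrow> divergence (\<lambda>x. T (a + m *\<^sub>R x)) x = m * divergence T (a + m *\<^sub>R x)"
  by (simp add: divergence_def frechet_derivative_homothety sum_distrib_left)

lemma C1_homothety: "C1 f \<Longrightarrow> C1 (\<lambda>x. f (a + m *\<^sub>R x))"
  by (rule C1_compose[where g = f], assumption)
     (intro C1_add C1_const C1_bounded_linear bounded_linear_scaleR_right)

lemma C1c_homothety:
  fixes f :: "'a::euclidean_space \<Rightarrow> 'b::real_normed_vector"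
  assumes "C1c U f" "m \<noteq> 0" "\<And>x. a + m *\<^sub>R x \<in> U \<Longrightarrow> x \<in> V"
  shows "C1c V (\<lambda>x. f (a + m *\<^sub>R x))"
proof -
  define g where "g y = (1 / m) *\<^sub>R (y - a)" for y
  have inv: "g (a + m *\<^sub>R x) = x" "a + m *\<^sub>R g y = y" for x y
    using assms(2) by (auto simp: g_def)
  show ?thesis
  proof (rule C1cI)
    show "C1 (\<lambda>x. f (a + m *\<^sub>R x))"
      using assms(1) C1_homothety C1c_C1 by blast
    show "compact (g ` supp f)"
      using assms(1) unfolding g_def C1c_iff
      by (intro compact_continuous_image continuous_intros) auto
    show "g ` supp f \<subseteq> V"
      using assms(1,3) inv unfolding C1c_iff by (metis image_subsetI subset_iff)
    show "f (a + m *\<^sub>R x) = 0" if "x \<notin> g ` supp f" for x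
      using that inv(1)[of x] zero_outside_supp[of "a + m *\<^sub>R x" f] by (metis image_eqI)
  qed
qed

text \<open>For \<open>x\<close> in the smaller ball a reflected narrow mollifier centred at
  \<open>x\<close> is an admissible test function, so the hypothesis says that a convolution of
  \<open>g\<close> vanishes at \<open>x\<close>. Convergence of convolutions in the integral norm
  then forces \<open>g\<close> itself to vanish there.\<close>

lemma fundamental_lemma_compact:
  fixes g :: "'a::euclidean_space \<Rightarrow> real"
  assumes g: "locally_integrable_on g (ball a R)" and "r < R"
    and 0: "\<And>\<phi>. C1c (ball a R) \<phi> \<Longrightarrow> (LINT x:ball a R|lebesgue. \<phi> x * g x) = 0"
  shows "AE x in lebesgue. x \<in> cball a r \<longrightarrow> g x = 0"
proof -
  define \<delta> where "\<delta> = (R - r) / 2"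
  have \<delta>: "\<delta> > 0" "r + \<delta> < R"
    using assms by (auto simp: \<delta>_def field_simps)
  define C' where "C' = cball a (r + \<delta>)"
  have C': "C' \<subseteq> ball a R" "compact C'"
    using \<delta> by (auto simp: C'_def)
  define h where "h x = indicator C' x *\<^sub>R g x" for x
  have inth: "integrable lebesgue h"
    using g C' unfolding locally_integrable_on_def set_integrable_def h_def by blast
  \<comment> \<open>Convolutions are taken with respect to \<open>lborel\<close>, so the Lebesgue
    measurable truncation is replaced by a Borel function equal to it almost everywhere.\<close>
  obtain h' where h'm[measurable]: "h' \<in> borel_measurable lborel" and ae: "AE x in lborel. h x = h' x"
    using completion_ex_borel_measurable_real[of h lborel] inth by auto
  have ae': "AE x in lebesgue. h x = h' x"
    using AE_completion[OF ae] .
  have inth': "integrable lebesgue h'"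
    using inth by (subst integrable_cong_AE[where g = h]) (use ae' in \<open>auto simp: measurable_completion\<close>)
  then have inth'': "integrable lborel h'"
    by (simp add: integrable_completion)
  have bound: "(\<integral>\<^sup>+x. ennreal \<bar>indicator (cball a r) x * h' x\<bar> \<partial>lborel) \<le> 0 + ennreal e" if e: "e > 0" for e
  proof -
    obtain d where d: "d > 0" "\<forall>\<eta>. mollifier d \<eta> \<longrightarrow> (\<integral>\<^sup>+x. ennreal \<bar>conv \<eta> h' x - h' x\<bar> \<partial>lborel) \<le> ennreal e"
      using conv_L1[OF inth'' e] by blast
    have "min d \<delta> > 0" using d \<delta> by simp
    then obtain \<eta> :: "'a \<Rightarrow> real" where m: "mollifier (min d \<delta>) \<eta>"
      using mollifier_exists by blast
    note \<eta> = mollifierD[OF m]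
    note [measurable] = \<eta>(6)
    have zero: "conv \<eta> h' x = 0" if x: "x \<in> cball a r" for x
    proof -
      \<comment> \<open>The mollifier radius is at most \<open>\<delta>\<close>, so the kernel
        centred at \<open>x\<close> lives in \<open>C'\<close>, which is compact in the open ball
        and on which \<open>h\<close> agrees with \<open>g\<close>.\<close>
      have C': "y \<in> C'" if "\<eta> (x - y) \<noteq> 0" for y
      proof -
        have "norm (x - y) < \<delta>"
          using \<eta>(3)[of "x - y"] that by (meson min.cobounded2 not_less order_trans)
        moreover have "dist a y \<le> dist a x + dist x y"
          by (rule dist_triangle)
        ultimately show ?thesis
          using x by (auto simp: C'_def dist_norm)
      qed
      have "C1c (ball a R) (\<lambda>y. \<eta> (x + (- 1) *\<^sub>R y))"
      proof (rule C1cI)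
        show "C1 (\<lambda>y. \<eta> (x + (- 1) *\<^sub>R y))"
          by (rule C1_homothety[OF C1c_C1[OF \<eta>(1)]])
        show "compact C'" "C' \<subseteq> ball a R" by fact+
        show "\<eta> (x + (- 1) *\<^sub>R y) = 0" if "y \<notin> C'" for y
          using C'[of y] that by auto
      qed
      from 0[OF this] have "(\<integral>y. indicator (ball a R) y *\<^sub>R (\<eta> (x - y) * g y) \<partial>lebesgue) = 0"
        by (simp add: set_lebesgue_integral_def)
      also have "(\<lambda>y. indicator (ball a R) y *\<^sub>R (\<eta> (x - y) * g y)) = (\<lambda>y. \<eta> (x - y) * h y)"
      proof
        fix y show "indicator (ball a R) y *\<^sub>R (\<eta> (x - y) * g y) = \<eta> (x - y) * h y"
          using C'[of y] \<open>C' \<subseteq> ball a R\<close> by (cases "\<eta> (x - y) = 0") (auto simp: h_def indicator_def)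
      qed
      also have "(\<integral>y. \<eta> (x - y) * h y \<partial>lebesgue) = (\<integral>y. \<eta> (x - y) * h' y \<partial>lebesgue)"
      proof (rule integral_cong_AE)
        have [measurable]: "(\<lambda>y. \<eta> (x - y)) \<in> borel_measurable lebesgue"
          by (intro measurable_completion) measurable
        show "(\<lambda>y. \<eta> (x - y) * h y) \<in> borel_measurable lebesgue" "(\<lambda>y. \<eta> (x - y) * h' y) \<in> borel_measurable lebesgue"
          using borel_measurable_integrable[OF inth] borel_measurable_integrable[OF inth'] by measurable
        show "AE y in lebesgue. \<eta> (x - y) * h y = \<eta> (x - y) * h' y"
          using ae' by (rule eventually_mono) simp
      qed
      also have "\<dots> = conv \<eta> h' x"
        unfolding conv_def by (intro integral_completion) measurable
      finally show ?thesis .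
    qed
    have "(\<integral>\<^sup>+x. ennreal \<bar>indicator (cball a r) x * h' x\<bar> \<partial>lborel) \<le> (\<integral>\<^sup>+x. ennreal \<bar>conv \<eta> h' x - h' x\<bar> \<partial>lborel)"
      by (rule nn_integral_mono) (use zero in \<open>auto simp: indicator_def\<close>)
    also have "\<dots> \<le> ennreal e"
      by (rule d(2)[rule_format, OF mollifier_mono[OF m]]) simp
    finally show ?thesis by simp
  qed
  have "(\<integral>\<^sup>+x. ennreal \<bar>indicator (cball a r) x * h' x\<bar> \<partial>lborel) \<le> 0"
    by (rule ennreal_le_epsilon) (use bound in auto)
  moreover have "(\<lambda>x. indicator (cball a r) x * h' x) \<in> borel_measurable lborel"
    by (intro borel_measurable_times borel_measurable_indicator h'm) simp
  ultimately have "AE x in lborel. indicator (cball a r) x * h' x = 0"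
    by (subst (asm) le_zero_eq, subst (asm) nn_integral_0_iff_AE) auto
  then have "AE x in lebesgue. indicator (cball a r) x * h' x = 0"
    by (rule AE_completion)
  with ae' show ?thesis
  proof eventually_elim
    case (elim x)
    then show ?case
      using \<delta> by (auto simp: h_def C'_def indicator_def split: if_splits)
  qed
qed

text \<open>The closed balls of radius R - 1 / (n + 1) exhaust the open ball, and countably many
  exceptional null sets may be united.\<close>

lemma fundamental_lemma:
  fixes g :: "'a::euclidean_space \<Rightarrow> real"
  assumes "locally_integrable_on g (ball a R)"
    and "\<And>\<phi>. C1c (ball a R) \<phi> \<Longrightarrow> (LINT x:ball a R|lebesgue. \<phi> x * g x) = 0"
  shows "AE x in lebesgue. x \<in> ball a R \<longrightarrow> g x = 0"
proof -
  have "AE x in lebesgue. \<forall>n::nat. x \<in> cball a (R - 1 / real (Suc n)) \<longrightarrow> g x = 0"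
    by (subst AE_all_countable) (intro allI fundamental_lemma_compact[OF assms(1)] assms(2), auto)
  then show ?thesis
  proof (rule eventually_mono, intro impI)
    fix x assume *: "\<forall>n::nat. x \<in> cball a (R - 1 / real (Suc n)) \<longrightarrow> g x = 0" and "x \<in> ball a R"
    then have "R - dist a x > 0" by simp
    then obtain n where "1 / real (Suc n) < R - dist a x"
      using nat_approx_posE by blast
    then have "x \<in> cball a (R - 1 / real (Suc n))"
      unfolding mem_cball by linarith
    then show "g x = 0"
      using * by blast
  qed
qed

section \<open>Perimeter\<close>

definition unit_field :: "('a::euclidean_space \<Rightarrow> 'a) \<Rightarrow> bool" where
  "unit_field T \<longleftrightarrow> C1c UNIV T \<and> (\<forall>x. norm (T x) \<le> 1)"

lemma unit_field_C1c: "unit_field T \<Longrightarrow> C1c UNIV T" and unit_field_C1: "unit_field T \<Longrightarrow> C1 T"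
  by (auto simp: unit_field_def C1c_C1)

lemma integrable_divergence:
  assumes "C1c UNIV T" shows "integrable lebesgue (divergence T)" "integrable lborel (divergence T)"
  by (rule integrable_compact_support[where S = "supp T"];
      use assms in \<open>auto simp: C1c_iff intro!: divergence_continuous divergence_zero_outside_supp\<close>)+

lemma set_integrable_divergence:
  assumes "C1c UNIV T" "E \<in> sets lebesgue" shows "integrable lebesgue (\<lambda>x. indicator E x *\<^sub>R divergence T x)"
  using integrable_mult_indicator[OF assms(2) integrable_divergence(1)[OF assms(1)]] .

lemma unit_field_zero: "unit_field (\<lambda>x. 0)"
  unfolding unit_field_def by (auto intro!: C1cI[where S = "{}"] C1_const)

lemma divergence_zero: "divergence (\<lambda>x. 0) = (\<lambda>x. 0)"
  by (auto simp: divergence_def fun_eq_iff)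

text \<open>For nonnegative \<open>C\<close> the truncation of negative integrals by
  \<open>ennreal\<close> does no harm, so bounds on the perimeter can be tested one field at a time
  with real numbers.\<close>

lemma perimeter_le_iff:
  assumes "E \<in> lmeasurable" "0 \<le> C"
  shows "perimeter E \<le> ennreal C \<longleftrightarrow> (\<forall>T. unit_field T \<longrightarrow> (LINT x:E|lebesgue. divergence T x) \<le> C)"
  using assms by (auto simp: perimeter_def unit_field_def SUP_le_iff ennreal_le_iff)

lemma perimeter_finiteD:
  assumes "perimeter E < \<infinity>"
  shows "E \<in> lmeasurable" "perimeter E = ennreal (enn2real (perimeter E))"
    "\<And>T. unit_field T \<Longrightarrow> (LINT x:E|lebesgue. divergence T x) \<le> enn2real (perimeter E)"
proof -
  show E: "E \<in> lmeasurable"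
    using assms by (auto simp: perimeter_def split: if_splits)
  show eq: "perimeter E = ennreal (enn2real (perimeter E))"
    using assms by simp
  then have "perimeter E \<le> ennreal (enn2real (perimeter E))" by simp
  then show "(LINT x:E|lebesgue. divergence T x) \<le> enn2real (perimeter E)" if "unit_field T" for T
    using that by (subst (asm) perimeter_le_iff[OF E]) auto
qed

lemma unit_field_homothety:
  assumes "unit_field T" "m \<noteq> 0" shows "unit_field (\<lambda>x. T (a + m *\<^sub>R x))"
  using assms C1c_homothety[of UNIV T m a UNIV] by (auto simp: unit_field_def)

lemma conv_indicator_bounds:
  assumes m: "mollifier d \<eta>" and E[measurable]: "E \<in> sets borel" "emeasure lborel E < \<infinity>"
  shows "0 \<le> conv \<eta> (indicator E) x" "conv \<eta> (indicator E) x \<le> 1"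
proof -
  note \<eta> = mollifierD[OF m]
  have [measurable]: "\<eta> \<in> borel_measurable borel" by (rule \<eta>)
  show "0 \<le> conv \<eta> (indicator E) x"
    unfolding conv_def using \<eta>(2) by (intro integral_nonneg_AE) auto
  have int: "integrable lborel (\<lambda>y. \<eta> (x - y))"
    by (rule integrable_lborel_reflection[OF \<eta>(4)])
  have "conv \<eta> (indicator E) x \<le> (\<integral>y. \<eta> (x - y) \<partial>lborel)"
    unfolding conv_def
  proof (rule integral_mono[OF _ int])
    show "integrable lborel (\<lambda>y. \<eta> (x - y) * indicator E y)"
      using integrable_mult_indicator[OF _ int, of E] by (simp add: mult.commute)
  qed (use \<eta>(2) in \<open>auto simp: indicator_def\<close>)
  also have "\<dots> = 1"
    using integral_lborel_reflection[of \<eta> x] \<eta>(5) by simp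
  finally show "conv \<eta> (indicator E) x \<le> 1" .
qed

text \<open>Fubini turns the pairing of a mollified indicator with \<open>X\<close> into an average of the pairings of
  the indicator with translates of \<open>X\<close>.\<close>

lemma conv_indicator_divergence:
  fixes E :: "'a::euclidean_space set"
  assumes m: "mollifier d \<eta>" and E[measurable]: "E \<in> sets borel"
    and P: "\<And>T. unit_field T \<Longrightarrow> (LINT x:E|lebesgue. divergence T x) \<le> P"
    and X: "unit_field X"
  shows "(\<integral>x. conv \<eta> (indicator E) x * divergence X x \<partial>lebesgue) \<le> P"
proof -
  note \<eta> = mollifierD[OF m]
  let ?D = "divergence X"
  have c\<eta>: "continuous_on UNIV \<eta>"
    using \<eta>(1) C1_continuous C1c_C1 by blast
  have cD: "continuous_on UNIV ?D"
    by (rule divergence_continuous[OF unit_field_C1[OF X]])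
  have [measurable]: "\<eta> \<in> borel_measurable borel" "?D \<in> borel_measurable borel"
    using c\<eta> cD by (auto intro: borel_measurable_continuous_onI)
  \<comment> \<open>Joint integrability for the exchange of integrals: dropping the indicator leaves
    a product that is continuous with compact support in both variables together.\<close>
  have intprod: "integrable (lborel \<Otimes>\<^sub>M lborel) (\<lambda>(z, x). \<eta> z * indicator E (x - z) * ?D x)"
  proof (rule Bochner_Integration.integrable_bound)
    have "integrable lborel (\<lambda>p::'a \<times> 'a. \<eta> (fst p) * ?D (snd p))"
    proof (rule integrable_compact_support)
      show "continuous_on UNIV (\<lambda>p::'a \<times> 'a. \<eta> (fst p) * ?D (snd p))"
        by (intro continuous_intros continuous_on_compose2[OF c\<eta>] continuous_on_compose2[OF cD]) auto
      show "compact (supp \<eta> \<times> supp X)"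
        using \<eta>(1) unit_field_C1c[OF X] by (auto simp: C1c_iff intro: compact_Times)
      show "\<eta> (fst p) * ?D (snd p) = 0" if "p \<notin> supp \<eta> \<times> supp X" for p :: "'a \<times> 'a"
        using that zero_outside_supp[of "fst p" \<eta>] divergence_zero_outside_supp[of "snd p" X]
        by (cases p) auto
    qed
    then show "integrable (lborel \<Otimes>\<^sub>M lborel) (\<lambda>p::'a \<times> 'a. \<eta> (fst p) * ?D (snd p))"
      by (simp add: lborel_prod)
    show "(\<lambda>(z, x). \<eta> z * indicator E (x - z) * ?D x) \<in> borel_measurable (lborel \<Otimes>\<^sub>M lborel)"
      by measurable
    show "AE p in lborel \<Otimes>\<^sub>M lborel. norm (case p of (z, x) \<Rightarrow> \<eta> z * indicator E (x - z) * ?D x) \<le> norm (\<eta> (fst p) * ?D (snd p))"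
      by (intro AE_I2) (auto simp: indicator_def)
  qed
  have inner: "(\<integral>x. \<eta> z * indicator E (x - z) * ?D x \<partial>lborel) \<le> \<eta> z * P" for z
  proof -
    have "(\<integral>x. \<eta> z * indicator E (x - z) * ?D x \<partial>lborel) = \<eta> z * (\<integral>x. indicator E (x - z) * ?D x \<partial>lborel)"
      by (subst integral_mult_right_zero[symmetric]) (simp add: mult.assoc)
    also have "(\<integral>x. indicator E (x - z) * ?D x \<partial>lborel) = (\<integral>x. indicator E (x - z) * ?D x \<partial>lebesgue)"
      by (rule integral_completion[symmetric]) measurable
    also have "\<dots> = (\<integral>x. indicator E (x + z - z) * ?D (x + z) \<partial>lebesgue)"
      by (rule integral_translation[symmetric]) (intro measurable_completion, measurable)
    also have "\<dots> = (LINT x:E|lebesgue. divergence (\<lambda>x. X (z + 1 *\<^sub>R x)) x)"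
      unfolding set_lebesgue_integral_def divergence_homothety[OF unit_field_C1[OF X]] by (simp add: add.commute)
    also have "\<dots> \<le> P"
      by (intro P unit_field_homothety X) simp
    finally show ?thesis
      using \<eta>(2)[of z] by (simp add: mult_left_mono)
  qed
  have "(\<integral>x. conv \<eta> (indicator E) x * ?D x \<partial>lebesgue) = (\<integral>x. conv \<eta> (indicator E) x * ?D x \<partial>lborel)"
    by (rule integral_completion) (simp add: conv_def)
  also have "\<dots> = (\<integral>x. (\<integral>z. \<eta> z * indicator E (x - z) * ?D x \<partial>lborel) \<partial>lborel)"
    by (intro Bochner_Integration.integral_cong refl) (simp add: conv_reflect)
  also have "\<dots> = (\<integral>z. (\<integral>x. \<eta> z * indicator E (x - z) * ?D x \<partial>lborel) \<partial>lborel)"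
    by (rule lborel_pair.Fubini_integral[OF intprod])
  also have "\<dots> \<le> (\<integral>z. \<eta> z * P \<partial>lborel)"
    using lborel_pair.integrable_fst[OF intprod] \<eta>(4) inner by (intro integral_mono) auto
  also have "\<dots> = P"
    using \<eta>(4,5) by simp
  finally show ?thesis .
qed

text \<open>The derivative of \<open>sqrt (s\<^sup>2 + \<delta>\<^sup>2)\<close>, a smooth
  substitute for the absolute value.\<close>

definition smooth_sign :: "real \<Rightarrow> real \<Rightarrow> real" where
  "smooth_sign \<delta> s = s / sqrt (s\<^sup>2 + \<delta>\<^sup>2)"

lemma sqrt_sq_add_pos: "\<delta> > 0 \<Longrightarrow> sqrt (s\<^sup>2 + \<delta>\<^sup>2) > 0"
  by (simp add: add_nonneg_pos)

lemma has_derivative_smooth_abs: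
  "\<delta> > 0 \<Longrightarrow> ((\<lambda>s. sqrt (s\<^sup>2 + \<delta>\<^sup>2)) has_real_derivative smooth_sign \<delta> s) (at s)"
  using sqrt_sq_add_pos[of \<delta> s]
  by (auto intro!: derivative_eq_intros simp: smooth_sign_def add_nonneg_pos field_simps)

lemma smooth_sign_bound: "\<delta> > 0 \<Longrightarrow> \<bar>smooth_sign \<delta> s\<bar> \<le> 1"
  using sqrt_sq_add_pos[of \<delta> s] real_sqrt_le_mono[of "s\<^sup>2" "s\<^sup>2 + \<delta>\<^sup>2"]
  by (simp add: smooth_sign_def abs_divide)

lemma C1_smooth_abs:
  assumes "\<delta> > 0" shows "C1 (\<lambda>s::real. sqrt (s\<^sup>2 + \<delta>\<^sup>2))"
proof (rule C1_realI[OF has_derivative_smooth_abs[OF assms]])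
  have nz: "sqrt (s\<^sup>2 + \<delta>\<^sup>2) \<noteq> 0" for s using sqrt_sq_add_pos[OF assms, of s] by linarith
  show "continuous_on UNIV (smooth_sign \<delta>)"
    unfolding smooth_sign_def[abs_def] using nz by (intro continuous_intros) auto
qed

lemma C1_smooth_sign: "\<delta> > 0 \<Longrightarrow> C1 (smooth_sign \<delta>)"
proof (rule C1_realI)
  assume \<delta>: "\<delta> > 0"
  have nz: "sqrt (s\<^sup>2 + \<delta>\<^sup>2) \<noteq> 0" for s using sqrt_sq_add_pos[OF \<delta>, of s] by linarith
  show "(smooth_sign \<delta> has_real_derivative (1 * sqrt (s\<^sup>2 + \<delta>\<^sup>2) - s * smooth_sign \<delta> s) / (sqrt (s\<^sup>2 + \<delta>\<^sup>2) * sqrt (s\<^sup>2 + \<delta>\<^sup>2))) (at s)" for s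
    unfolding smooth_sign_def[of \<delta>, abs_def]
    by (rule DERIV_divide[where f = "\<lambda>s. s" and g = "\<lambda>s. sqrt (s\<^sup>2 + \<delta>\<^sup>2)", OF DERIV_ident _ nz]) (use has_derivative_smooth_abs[OF \<delta>, of s] in \<open>simp add: smooth_sign_def\<close>)
  show "continuous_on UNIV (\<lambda>s. (1 * sqrt (s\<^sup>2 + \<delta>\<^sup>2) - s * smooth_sign \<delta> s) / (sqrt (s\<^sup>2 + \<delta>\<^sup>2) * sqrt (s\<^sup>2 + \<delta>\<^sup>2)))"
    unfolding smooth_sign_def using nz by (intro continuous_intros) auto
qed

text \<open>Maximum and minimum are (f + g) / 2 plus or minus |f - g| / 2; here the absolute value
  is smoothed, with c = 1 for the maximum and c = -1 for the minimum.\<close>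

lemma has_grad_smooth_max:
  fixes f g :: "'a::euclidean_space \<Rightarrow> real"
  assumes "\<delta> > 0" "C1 f" "C1 g"
  shows "((\<lambda>x. (f x + g x) / 2 + c * sqrt ((f x - g x)\<^sup>2 + \<delta>\<^sup>2) / 2) has_derivative
    (\<lambda>h. (((1 + c * smooth_sign \<delta> (f x - g x)) / 2) *\<^sub>R grad f x + ((1 - c * smooth_sign \<delta> (f x - g x)) / 2) *\<^sub>R grad g x) \<bullet> h)) (at x)"
proof -
  have "((\<lambda>x. f x - g x) has_derivative (\<lambda>h. grad f x \<bullet> h - grad g x \<bullet> h)) (at x)"
    by (intro has_derivative_diff C1_has_grad assms)
  from diff_chain_at[OF this has_derivative_smooth_abs[OF assms(1), unfolded has_field_derivative_def]]
  have "((\<lambda>x. sqrt ((f x - g x)\<^sup>2 + \<delta>\<^sup>2)) has_derivative (\<lambda>h. smooth_sign \<delta> (f x - g x) * (grad f x \<bullet> h - grad g x \<bullet> h))) (at x)"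
    by (simp add: o_def)
  note d = has_derivative_add[OF has_derivative_mult_right[OF has_derivative_add[OF C1_has_grad[OF assms(2)] C1_has_grad[OF assms(3)]], where x = "1/2"]
     has_derivative_mult_right[OF this, where x = "c/2"]]
  have "(\<lambda>x. (f x + g x) / 2 + c * sqrt ((f x - g x)\<^sup>2 + \<delta>\<^sup>2) / 2)
    = (\<lambda>x. 1/2 * (f x + g x) + c/2 * sqrt ((f x - g x)\<^sup>2 + \<delta>\<^sup>2))"
    by auto
  then show ?thesis
    by (simp only:) (rule has_derivative_eq_rhs[OF d], auto simp: fun_eq_iff inner_add_left field_simps)
qed

text \<open>Submodularity before the limit. The smoothed maximum has gradient a grad f + (1 - a)
  grad g and the minimum has the complementary weights. Regrouping by grad f and grad g moves the
  weights onto the fields: X = a T + (1 - a) S and Y = (1 - a) T + a S are pointwise convex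
  combinations, hence again bounded by 1.\<close>

lemma smooth_max_min_by_parts:
  fixes f g :: "'a::euclidean_space \<Rightarrow> real"
  assumes "\<delta> > 0" "C1 f" "C1 g" "unit_field T" "unit_field S"
  shows "\<exists>X Y. unit_field X \<and> unit_field Y \<and>
    (\<integral>x. ((f x + g x) / 2 + sqrt ((f x - g x)\<^sup>2 + \<delta>\<^sup>2) / 2) * divergence T x \<partial>lebesgue)
      + (\<integral>x. ((f x + g x) / 2 - sqrt ((f x - g x)\<^sup>2 + \<delta>\<^sup>2) / 2) * divergence S x \<partial>lebesgue)
     = (\<integral>x. f x * divergence X x \<partial>lebesgue) + (\<integral>x. g x * divergence Y x \<partial>lebesgue)"
proof -
  define a where "a x = (1 + smooth_sign \<delta> (f x - g x)) / 2" for x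
  have a01: "0 \<le> a x" "a x \<le> 1" for x
    using smooth_sign_bound[OF assms(1), of "f x - g x"] by (auto simp: a_def abs_le_iff)
  have s1: "C1 (\<lambda>x. smooth_sign \<delta> (f x - g x))"
    by (rule C1_compose[OF C1_smooth_sign[OF assms(1)] C1_diff[OF assms(2,3)]])
  have a_eq: "a = (\<lambda>x. (1/2) * (1 + smooth_sign \<delta> (f x - g x)))"
    by (auto simp: a_def)
  have Ca: "C1 a"
    unfolding a_eq by (intro C1_mult C1_add C1_const s1)
  have Cb: "C1 (\<lambda>x. 1 - a x)"
    by (intro C1_diff C1_const Ca)
  have mix: "unit_field (\<lambda>x. b x *\<^sub>R T x + (1 - b x) *\<^sub>R S x)" if "C1 b" "\<And>x. 0 \<le> b x" "\<And>x. b x \<le> 1" for b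
    unfolding unit_field_def
  proof (intro conjI allI)
    have CTS: "C1 T" "C1 S" "compact (supp T \<union> supp S)"
      using assms(4,5) by (auto simp: unit_field_def C1c_iff)
    show "C1c UNIV (\<lambda>x. b x *\<^sub>R T x + (1 - b x) *\<^sub>R S x)"
    proof (rule C1cI[OF _ CTS(3)])
      show "C1 (\<lambda>x. b x *\<^sub>R T x + (1 - b x) *\<^sub>R S x)"
        by (intro C1_add C1_scaleR C1_diff C1_const that CTS)
      show "b x *\<^sub>R T x + (1 - b x) *\<^sub>R S x = 0" if "x \<notin> supp T \<union> supp S" for x
        using that zero_outside_supp[of x T] zero_outside_supp[of x S] by simp
    qed simp
    fix x
    have "norm (b x *\<^sub>R T x + (1 - b x) *\<^sub>R S x) \<le> b x * norm (T x) + (1 - b x) * norm (S x)"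
      using that(2,3)[of x] by (intro order_trans[OF norm_triangle_ineq]) simp
    also have "\<dots> \<le> b x * 1 + (1 - b x) * 1"
      using that(2,3)[of x] assms(4,5) by (intro add_mono mult_left_mono) (auto simp: unit_field_def)
    finally show "norm (b x *\<^sub>R T x + (1 - b x) *\<^sub>R S x) \<le> 1" by simp
  qed
  define X where "X x = a x *\<^sub>R T x + (1 - a x) *\<^sub>R S x" for x
  define Y where "Y x = (1 - a x) *\<^sub>R T x + (1 - (1 - a x)) *\<^sub>R S x" for x
  have XY: "unit_field X" "unit_field Y"
    unfolding X_def Y_def by (rule mix; use Ca Cb a01 in auto)+
  define M where "M x = (f x + g x) / 2 + sqrt ((f x - g x)\<^sup>2 + \<delta>\<^sup>2) / 2" for x
  define m where "m x = (f x + g x) / 2 - sqrt ((f x - g x)\<^sup>2 + \<delta>\<^sup>2) / 2" for x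
  have r: "C1 (\<lambda>x. sqrt ((f x - g x)\<^sup>2 + \<delta>\<^sup>2))"
    by (rule C1_compose[OF C1_smooth_abs[OF assms(1)] C1_diff[OF assms(2,3)]])
  have "M = (\<lambda>x. (1/2) * ((f x + g x) + sqrt ((f x - g x)\<^sup>2 + \<delta>\<^sup>2)))"
    by (auto simp: M_def)
  then have CM: "C1 M"
    by (simp only:) (intro C1_mult C1_add C1_const r assms)
  have "m = (\<lambda>x. (1/2) * ((f x + g x) - sqrt ((f x - g x)\<^sup>2 + \<delta>\<^sup>2)))"
    by (auto simp: m_def diff_divide_distrib)
  then have Cm: "C1 m"
    by (simp only:) (intro C1_mult C1_add C1_diff C1_const r assms)
  have gM: "grad M x = a x *\<^sub>R grad f x + (1 - a x) *\<^sub>R grad g x" for x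
    unfolding M_def using has_grad_smooth_max[OF assms(1-3), of 1 x]
    by (intro grad_eqI) (simp add: a_def field_simps)
  have gm: "grad m x = (1 - a x) *\<^sub>R grad f x + a x *\<^sub>R grad g x" for x
    unfolding m_def using has_grad_smooth_max[OF assms(1-3), of "- 1" x]
    by (intro grad_eqI) (simp add: a_def field_simps)
  note c = unit_field_C1c[OF assms(4)] unit_field_C1c[OF assms(5)] unit_field_C1c[OF XY(1)] unit_field_C1c[OF XY(2)]
  have "(\<integral>x. M x * divergence T x \<partial>lebesgue) + (\<integral>x. m x * divergence S x \<partial>lebesgue)
    = - (\<integral>x. grad M x \<bullet> T x + grad m x \<bullet> S x \<partial>lebesgue)"
    by (simp add: integral_by_parts CM Cm c)
  also have "(\<lambda>x. grad M x \<bullet> T x + grad m x \<bullet> S x) = (\<lambda>x. grad f x \<bullet> X x + grad g x \<bullet> Y x)"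
    by (auto simp: fun_eq_iff gM gm X_def Y_def inner_add_left inner_add_right algebra_simps)
  also have "- (\<integral>x. grad f x \<bullet> X x + grad g x \<bullet> Y x \<partial>lebesgue)
     = (\<integral>x. f x * divergence X x \<partial>lebesgue) + (\<integral>x. g x * divergence Y x \<partial>lebesgue)"
    by (simp add: integral_by_parts assms c)
  finally show ?thesis
    using XY unfolding M_def m_def by blast
qed

text \<open>The smooth identity is applied to mollified indicators, whose pairings with
  \<open>X\<close> and \<open>Y\<close> stay below \<open>P\<close> and \<open>Q\<close>. Dominated
  convergence then passes to the indicators, whose maximum and minimum are those of union and
  intersection.\<close>

lemma submodular_by_parts:
  fixes A B :: "'a::euclidean_space set"
  assumes A[measurable]: "A \<in> sets borel" "emeasure lborel A < \<infinity>"
    and B[measurable]: "B \<in> sets borel" "emeasure lborel B < \<infinity>"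
    and P: "\<And>T. unit_field T \<Longrightarrow> (LINT x:A|lebesgue. divergence T x) \<le> P"
    and Q: "\<And>T. unit_field T \<Longrightarrow> (LINT x:B|lebesgue. divergence T x) \<le> Q"
    and T: "unit_field T" and S: "unit_field S"
  shows "(LINT x:A \<union> B|lebesgue. divergence T x) + (LINT x:A \<inter> B|lebesgue. divergence S x) \<le> P + Q"
proof -
  let ?A = "indicator A :: 'a \<Rightarrow> real" and ?B = "indicator B :: 'a \<Rightarrow> real"
  have int: "integrable lborel ?A" "integrable lborel ?B"
    using A B by auto
  \<comment> \<open>One kernel has to serve both sets, since maximum and minimum are formed from the
    two mollified indicators; the smaller of two radii achieves this.\<close>
  define Good where "Good k \<eta> \<longleftrightarrow> (\<exists>d. mollifier d \<eta>) \<and> (\<integral>\<^sup>+x. ennreal \<bar>conv \<eta> ?A x - ?A x\<bar> \<partial>lborel) \<le> ennreal (1 / real (Suc k))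
     \<and> (\<integral>\<^sup>+x. ennreal \<bar>conv \<eta> ?B x - ?B x\<bar> \<partial>lborel) \<le> ennreal (1 / real (Suc k))" for k \<eta>
  have "\<exists>\<eta>. Good k \<eta>" for k
  proof -
    have k: "1 / real (Suc k) > 0" by simp
    obtain d1 where d1: "d1 > 0" "\<forall>\<eta>. mollifier d1 \<eta> \<longrightarrow> (\<integral>\<^sup>+x. ennreal \<bar>conv \<eta> ?A x - ?A x\<bar> \<partial>lborel) \<le> ennreal (1 / real (Suc k))"
      using conv_L1[OF int(1) k] by blast
    obtain d2 where d2: "d2 > 0" "\<forall>\<eta>. mollifier d2 \<eta> \<longrightarrow> (\<integral>\<^sup>+x. ennreal \<bar>conv \<eta> ?B x - ?B x\<bar> \<partial>lborel) \<le> ennreal (1 / real (Suc k))"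
      using conv_L1[OF int(2) k] by blast
    have "min d1 d2 > 0" using d1 d2 by simp
    then obtain \<eta> :: "'a \<Rightarrow> real" where m: "mollifier (min d1 d2) \<eta>"
      using mollifier_exists by blast
    show ?thesis
      using m d1(2)[rule_format, OF mollifier_mono[OF m]] d2(2)[rule_format, OF mollifier_mono[OF m]] unfolding Good_def by auto
  qed
  then have "\<forall>k. \<exists>\<eta>. Good k \<eta>"
    by (rule allI)
  then have "\<exists>\<eta>. \<forall>k. Good k (\<eta> k)"
    by (rule choice)
  then obtain \<eta> where \<eta>: "\<forall>k. Good k (\<eta> k)" ..
  define d where "d k = (SOME d. mollifier d (\<eta> k))" for k
  have m: "mollifier (d k) (\<eta> k)" for k
    unfolding d_def using \<eta>[rule_format, of k, unfolded Good_def] by (rule someI_ex[OF conjunct1])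
  have LA: "(\<integral>\<^sup>+x. ennreal \<bar>conv (\<eta> k) ?A x - ?A x\<bar> \<partial>lborel) \<le> ennreal (1 / real (Suc k))"
    and LB: "(\<integral>\<^sup>+x. ennreal \<bar>conv (\<eta> k) ?B x - ?B x\<bar> \<partial>lborel) \<le> ennreal (1 / real (Suc k))" for k
    using \<eta>[rule_format, of k] unfolding Good_def by simp_all
  define f where "f k = conv (\<eta> k) ?A" for k
  define g where "g k = conv (\<eta> k) ?B" for k
  have Cf: "C1 (f k)" "C1 (g k)" for k
    unfolding f_def g_def by (rule C1_conv[OF mollifierD(1)[OF m]]; use int in simp)+
  have fm[measurable]: "f k \<in> borel_measurable borel" "g k \<in> borel_measurable borel" for k
    using Cf[of k] by (auto intro: borel_measurable_continuous_onI C1_continuous)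
  have f01: "0 \<le> f k x" "f k x \<le> 1" "0 \<le> g k x" "g k x \<le> 1" for k x
    unfolding f_def g_def using conv_indicator_bounds[OF m] A B by auto
  have L1: "integrable lborel h \<and> (\<integral>x. \<bar>h x\<bar> \<partial>lborel) \<le> 1 / real (Suc k)"
    if "h \<in> borel_measurable borel" "(\<integral>\<^sup>+x. ennreal \<bar>h x\<bar> \<partial>lborel) \<le> ennreal (1 / real (Suc k))" for h :: "'a \<Rightarrow> real" and k
  proof -
    have i: "integrable lborel h"
      using that le_less_trans[OF that(2) ennreal_less_top] by (intro integrableI_bounded) auto
    then have "(\<integral>\<^sup>+x. ennreal \<bar>h x\<bar> \<partial>lborel) = ennreal (\<integral>x. \<bar>h x\<bar> \<partial>lborel)"
      by (intro nn_integral_eq_integral) auto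
    then show ?thesis
      using i that(2) by (simp add: ennreal_le_iff)
  qed
  define u where "u k x = \<bar>f k x - ?A x\<bar> + \<bar>g k x - ?B x\<bar>" for k x
  have I1: "integrable lborel (\<lambda>x. f k x - ?A x) \<and> (\<integral>x. \<bar>f k x - ?A x\<bar> \<partial>lborel) \<le> 1 / real (Suc k)" for k
    by (rule L1) (use LA[of k] in \<open>auto simp: f_def[symmetric]\<close>)
  have I2: "integrable lborel (\<lambda>x. g k x - ?B x) \<and> (\<integral>x. \<bar>g k x - ?B x\<bar> \<partial>lborel) \<le> 1 / real (Suc k)" for k
    by (rule L1) (use LB[of k] in \<open>auto simp: g_def[symmetric]\<close>)
  have intu: "integrable lborel (u k)" for k
    unfolding u_def using I1[of k] I2[of k] by auto
  have le: "(\<integral>x. norm (u k x) \<partial>lborel) \<le> 1 / real (Suc k) + 1 / real (Suc k)" for k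
  proof -
    have "(\<integral>x. norm (u k x) \<partial>lborel) = (\<integral>x. \<bar>f k x - ?A x\<bar> \<partial>lborel) + (\<integral>x. \<bar>g k x - ?B x\<bar> \<partial>lborel)"
      unfolding u_def using I1[of k] I2[of k] by (simp add: abs_of_nonneg)
    then show ?thesis using I1[of k] I2[of k] by simp
  qed
  have lim1: "(\<lambda>k. 1 / real (Suc k)) \<longlonglongrightarrow> 0"
    using LIMSEQ_Suc[OF lim_1_over_n] .
  have lim2: "(\<lambda>k. 1 / real (Suc k) + 1 / real (Suc k)) \<longlonglongrightarrow> 0"
    using tendsto_add[OF lim1 lim1] by (simp only: add_0_right)
  have "(\<lambda>k. \<integral>x. norm (u k x) \<partial>lborel) \<longlonglongrightarrow> 0"
  proof (rule tendsto_sandwich[OF _ _ tendsto_const lim2])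
    show "\<forall>\<^sub>F k in sequentially. 0 \<le> (\<integral>x. norm (u k x) \<partial>lborel)"
      by (rule always_eventually) simp
    show "\<forall>\<^sub>F k in sequentially. (\<integral>x. norm (u k x) \<partial>lborel) \<le> 1 / real (Suc k) + 1 / real (Suc k)"
      by (rule always_eventually) (rule allI, rule le)
  qed
  from tendsto_L1_AE_subseq[OF intu this]
  obtain r where "strict_mono r" and r: "AE x in lborel. (\<lambda>n. u (r n) x) \<longlonglongrightarrow> 0"
    by (elim exE conjE) (rule that)
  have ae: "AE x in lebesgue. (\<lambda>n. f (r n) x) \<longlonglongrightarrow> ?A x \<and> (\<lambda>n. g (r n) x) \<longlonglongrightarrow> ?B x"
    using AE_completion[OF r]
  proof (rule eventually_mono)
    fix x assume u: "(\<lambda>n. u (r n) x) \<longlonglongrightarrow> 0"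
    have "(\<lambda>n. f (r n) x - ?A x) \<longlonglongrightarrow> 0" "(\<lambda>n. g (r n) x - ?B x) \<longlonglongrightarrow> 0"
      by (rule Lim_null_comparison[OF always_eventually u]; simp add: u_def)+
    then show "(\<lambda>n. f (r n) x) \<longlonglongrightarrow> ?A x \<and> (\<lambda>n. g (r n) x) \<longlonglongrightarrow> ?B x"
      by (simp add: LIM_zero_iff)
  qed
  \<comment> \<open>The smoothed distance of the two mollified indicators; its smoothing parameter
    tends to zero along with the mollification, so both limits are taken at once.\<close>
  define s where "s n x = sqrt ((f (r n) x - g (r n) x)\<^sup>2 + (1 / real (Suc n))\<^sup>2)" for n x
  have sm[measurable]: "s n \<in> borel_measurable borel" for n
    unfolding s_def by measurable
  have sb: "0 \<le> s n x" "s n x \<le> 2" for n x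
  proof -
    have "s n x \<le> \<bar>f (r n) x - g (r n) x\<bar> + \<bar>1 / real (Suc n)\<bar>"
      unfolding s_def by (rule sqrt_sum_squares_le_sum_abs)
    also have "\<dots> \<le> 1 + 1"
      using f01[of "r n" x] by (intro add_mono) (auto simp: abs_le_iff)
    finally show "s n x \<le> 2" by simp
  qed (simp add: s_def)
  have slim: "AE x in lebesgue. (\<lambda>n. s n x) \<longlonglongrightarrow> \<bar>?A x - ?B x\<bar>"
    using ae
  proof (rule eventually_mono)
    fix x assume *: "(\<lambda>n. f (r n) x) \<longlonglongrightarrow> ?A x \<and> (\<lambda>n. g (r n) x) \<longlonglongrightarrow> ?B x"
    have "(\<lambda>n. s n x) \<longlonglongrightarrow> sqrt ((?A x - ?B x)\<^sup>2 + 0\<^sup>2)"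
      unfolding s_def using * lim1 by (intro tendsto_intros) auto
    then show "(\<lambda>n. s n x) \<longlonglongrightarrow> \<bar>?A x - ?B x\<bar>" by simp
  qed
  \<comment> \<open>The sign \<open>c\<close> treats both cases together: 1 yields the union and -1
    the intersection. The majorant has the factor 2 because both halves of the weight are at most 1
    in absolute value.\<close>
  have lim: "(\<lambda>n. \<integral>x. ((f (r n) x + g (r n) x) / 2 + c * s n x / 2) * divergence X x \<partial>lebesgue)
     \<longlonglongrightarrow> (LINT x:E|lebesgue. divergence X x)"
    if X: "unit_field X" and c: "\<bar>c\<bar> = 1" and E: "E \<in> sets borel"
      "\<And>x. (?A x + ?B x) / 2 + c * \<bar>?A x - ?B x\<bar> / 2 = indicator E x" for X c and E :: "'a set"
    unfolding set_lebesgue_integral_def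
  proof (rule integral_dominated_convergence)
    have [measurable]: "divergence X \<in> borel_measurable borel"
      using integrable_divergence(2)[OF unit_field_C1c[OF X]] by auto
    show "(\<lambda>x. indicator E x *\<^sub>R divergence X x) \<in> borel_measurable lebesgue"
      using borel_measurable_integrable[OF set_integrable_divergence[OF unit_field_C1c[OF X], of E]] E(1) by simp
    show "(\<lambda>x. ((f (r n) x + g (r n) x) / 2 + c * s n x / 2) * divergence X x) \<in> borel_measurable lebesgue" for n
      by (intro measurable_completion) measurable
    show "integrable lebesgue (\<lambda>x. 2 * \<bar>divergence X x\<bar>)"
      using integrable_divergence(1)[OF unit_field_C1c[OF X]] by simp
    show "AE x in lebesgue. (\<lambda>n. ((f (r n) x + g (r n) x) / 2 + c * s n x / 2) * divergence X x) \<longlonglongrightarrow> indicator E x *\<^sub>R divergence X x"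
      using ae slim
    proof eventually_elim
      case (elim x)
      then have "(\<lambda>n. ((f (r n) x + g (r n) x) / 2 + c * s n x / 2) * divergence X x)
        \<longlonglongrightarrow> ((?A x + ?B x) / 2 + c * \<bar>?A x - ?B x\<bar> / 2) * divergence X x"
        by (intro tendsto_intros) auto
      then show ?case by (simp add: E(2))
    qed
    show "AE x in lebesgue. norm (((f (r n) x + g (r n) x) / 2 + c * s n x / 2) * divergence X x) \<le> 2 * \<bar>divergence X x\<bar>" for n
    proof (rule AE_I2)
      fix x
      have "\<bar>c * s n x\<bar> \<le> 2"
        using sb[of n x] c by (simp add: abs_mult)
      moreover have "\<bar>(a + b) / 2 + w / 2\<bar> \<le> 2" if "0 \<le> a" "a \<le> 1" "0 \<le> b" "b \<le> 1" "\<bar>w\<bar> \<le> 2" for a b w :: real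
        using that by (auto simp: abs_le_iff field_simps)
      ultimately have "\<bar>(f (r n) x + g (r n) x) / 2 + c * s n x / 2\<bar> \<le> 2"
        using f01[of "r n" x] by simp
      then show "norm (((f (r n) x + g (r n) x) / 2 + c * s n x / 2) * divergence X x) \<le> 2 * \<bar>divergence X x\<bar>"
        by (simp add: abs_mult mult_right_mono)
    qed
  qed
  have L: "(\<lambda>n. (\<integral>x. ((f (r n) x + g (r n) x) / 2 + 1 * s n x / 2) * divergence T x \<partial>lebesgue)
      + (\<integral>x. ((f (r n) x + g (r n) x) / 2 + (- 1) * s n x / 2) * divergence S x \<partial>lebesgue))
    \<longlonglongrightarrow> (LINT x:A \<union> B|lebesgue. divergence T x) + (LINT x:A \<inter> B|lebesgue. divergence S x)"
    by (rule tendsto_add[OF lim[OF T] lim[OF S]]) (auto simp: indicator_def)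
  show ?thesis
  proof (rule LIMSEQ_le_const2[OF L], intro exI allI impI)
    fix n :: nat
    have "1 / real (Suc n) > 0" by simp
    from smooth_max_min_by_parts[OF this Cf(1)[of "r n"] Cf(2)[of "r n"] T S]
    obtain X Y where XY: "unit_field X" "unit_field Y" and eq:
      "(\<integral>x. ((f (r n) x + g (r n) x) / 2 + s n x / 2) * divergence T x \<partial>lebesgue)
       + (\<integral>x. ((f (r n) x + g (r n) x) / 2 - s n x / 2) * divergence S x \<partial>lebesgue)
       = (\<integral>x. f (r n) x * divergence X x \<partial>lebesgue) + (\<integral>x. g (r n) x * divergence Y x \<partial>lebesgue)"
      unfolding s_def by (elim exE conjE) (rule that, assumption, assumption, simp only: s_def)
    have "(\<integral>x. f (r n) x * divergence X x \<partial>lebesgue) \<le> P" "(\<integral>x. g (r n) x * divergence Y x \<partial>lebesgue) \<le> Q"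
      unfolding f_def g_def using P Q XY by (auto intro!: conv_indicator_divergence[OF m])
    then show "(\<integral>x. ((f (r n) x + g (r n) x) / 2 + 1 * s n x / 2) * divergence T x \<partial>lebesgue)
      + (\<integral>x. ((f (r n) x + g (r n) x) / 2 + (- 1) * s n x / 2) * divergence S x \<partial>lebesgue) \<le> P + Q"
      using eq by simp
  qed
qed

text \<open>Positivity sets of Sobolev functions are only Lebesgue measurable, whereas the
  mollification estimates are stated for Borel sets.\<close>

lemma borel_representative:
  fixes A :: "'a::euclidean_space set"
  assumes "A \<in> lmeasurable"
  obtains A' where "A' \<in> sets borel" "emeasure lborel A' < \<infinity>" "AE x in lebesgue. x \<in> A' \<longleftrightarrow> x \<in> A"
proof -
  have Am: "A \<in> sets lebesgue" using assms by auto
  then obtain g where g[measurable]: "g \<in> borel_measurable lborel" and ae: "AE x in lborel. indicator A x = (g x :: real)"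
    using completion_ex_borel_measurable_real[of "indicator A :: 'a \<Rightarrow> real" lborel] by auto
  define A' where "A' = {x. g x = 1}"
  have A': "A' \<in> sets borel"
    using g unfolding A'_def by measurable
  have ae': "AE x in lebesgue. x \<in> A' \<longleftrightarrow> x \<in> A"
    using AE_completion[OF ae] by (rule eventually_mono) (auto simp: A'_def indicator_def split: if_splits)
  have "emeasure lborel A' = emeasure lebesgue A'"
    using A' by simp
  also have "\<dots> = emeasure lebesgue A"
    using ae' A' Am by (intro emeasure_eq_AE) auto
  also have "\<dots> < \<infinity>"
    using assms by (auto simp: fmeasurable_def)
  finally show thesis
    using that A' ae' by blast
qed

lemma set_integral_cong_AE_set:
  fixes f :: "'a::euclidean_space \<Rightarrow> real"
  assumes "AE x in lebesgue. x \<in> A' \<longleftrightarrow> x \<in> A" "A \<in> sets lebesgue" "A' \<in> sets lebesgue" "f \<in> borel_measurable lebesgue"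
  shows "(LINT x:A'|lebesgue. f x) = (LINT x:A|lebesgue. f x)"
  unfolding set_lebesgue_integral_def
proof (rule integral_cong_AE)
  show "(\<lambda>x. indicator A' x *\<^sub>R f x) \<in> borel_measurable lebesgue" "(\<lambda>x. indicator A x *\<^sub>R f x) \<in> borel_measurable lebesgue"
    using assms by measurable
  show "AE x in lebesgue. indicator A' x *\<^sub>R f x = indicator A x *\<^sub>R f x"
    using assms(1) by (rule eventually_mono) (auto simp: indicator_def)
qed

text \<open>The two suprema on the left run over independent fields \<open>T\<close> and
  \<open>S\<close>. The bound for every pair is therefore carried to the supremum over
  \<open>T\<close> with \<open>S\<close> fixed, and afterwards to the supremum over
  \<open>S\<close>.\<close>

theorem perimeter_submodular:
  fixes A B :: "'a::euclidean_space set"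
  shows "perimeter (A \<union> B) + perimeter (A \<inter> B) \<le> perimeter A + perimeter B"
proof (cases "perimeter A < \<infinity> \<and> perimeter B < \<infinity>")
  case False
  then show ?thesis by (auto simp: not_less top_unique)
next
  case True
  then have finA: "perimeter A < \<infinity>" and finB: "perimeter B < \<infinity>" by auto
  define P where "P = enn2real (perimeter A)"
  define Q where "Q = enn2real (perimeter B)"
  note pA = perimeter_finiteD[OF finA, folded P_def] and pB = perimeter_finiteD[OF finB, folded Q_def]
  obtain A' where A': "A' \<in> sets borel" "emeasure lborel A' < \<infinity>" "AE x in lebesgue. x \<in> A' \<longleftrightarrow> x \<in> A"
    using borel_representative[OF pA(1)] .
  obtain B' where B': "B' \<in> sets borel" "emeasure lborel B' < \<infinity>" "AE x in lebesgue. x \<in> B' \<longleftrightarrow> x \<in> B"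
    using borel_representative[OF pB(1)] .
  have U: "AE x in lebesgue. x \<in> A' \<union> B' \<longleftrightarrow> x \<in> A \<union> B" and I: "AE x in lebesgue. x \<in> A' \<inter> B' \<longleftrightarrow> x \<in> A \<inter> B"
    using A'(3) B'(3) by (eventually_elim, auto)+
  have dm: "divergence T \<in> borel_measurable lebesgue" if "unit_field T" for T
    using integrable_divergence(1)[OF unit_field_C1c[OF that]] by auto
  have PQ: "(LINT x:A \<union> B|lebesgue. divergence T x) + (LINT x:A \<inter> B|lebesgue. divergence S x) \<le> P + Q"
    if T: "unit_field T" and S: "unit_field S" for T S
  proof -
    have "(LINT x:A' \<union> B'|lebesgue. divergence T x) + (LINT x:A' \<inter> B'|lebesgue. divergence S x) \<le> P + Q"
    proof (rule submodular_by_parts[OF A'(1,2) B'(1,2) _ _ T S])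
      show "(LINT x:A'|lebesgue. divergence T x) \<le> P" if "unit_field T" for T
        using pA(3)[OF that] set_integral_cong_AE_set[OF A'(3) _ _ dm[OF that]] pA(1) A'(1) by auto
      show "(LINT x:B'|lebesgue. divergence T x) \<le> Q" if "unit_field T" for T
        using pB(3)[OF that] set_integral_cong_AE_set[OF B'(3) _ _ dm[OF that]] pB(1) B'(1) by auto
    qed
    moreover have "(LINT x:A' \<union> B'|lebesgue. divergence T x) = (LINT x:A \<union> B|lebesgue. divergence T x)"
      by (rule set_integral_cong_AE_set[OF U _ _ dm[OF T]]) (use A' B' pA pB in auto)
    moreover have "(LINT x:A' \<inter> B'|lebesgue. divergence S x) = (LINT x:A \<inter> B|lebesgue. divergence S x)"
      by (rule set_integral_cong_AE_set[OF I _ _ dm[OF S]]) (use A' B' pA pB in auto)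
    ultimately show ?thesis by simp
  qed
  have UM: "A \<union> B \<in> lmeasurable" and IM: "A \<inter> B \<in> lmeasurable"
    using pA(1) pB(1) by (auto intro: fmeasurable.Un fmeasurable.Int)
  have "P \<ge> 0" "Q \<ge> 0"
    by (auto simp: P_def Q_def)
  \<comment> \<open>Testing with \<open>S = 0\<close> first shows that the perimeter of the union is
    finite, so that it can be handled as a real number \<open>p\<close> and subtracted.\<close>
  then have "perimeter (A \<union> B) \<le> ennreal (P + Q)"
    using PQ[OF _ unit_field_zero] by (subst perimeter_le_iff[OF UM]) (auto simp: divergence_zero set_lebesgue_integral_def)
  then have fin: "perimeter (A \<union> B) < \<infinity>"
    by (simp add: le_less_trans)
  define p where "p = enn2real (perimeter (A \<union> B))"
  note pp = perimeter_finiteD[OF fin, folded p_def]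
  have "p \<ge> 0" by (simp add: p_def)
  \<comment> \<open>This is the supremum over \<open>T\<close> for a fixed \<open>S\<close>. The
    choice \<open>T = 0\<close> shows that the right-hand side is nonnegative, as the criterion for
    perimeters demands.\<close>
  have p_le: "p \<le> P + Q - (LINT x:A \<inter> B|lebesgue. divergence S x)" if S: "unit_field S" for S
  proof -
    have 0: "0 \<le> P + Q - (LINT x:A \<inter> B|lebesgue. divergence S x)"
      using PQ[OF unit_field_zero S] by (simp add: divergence_zero set_lebesgue_integral_def)
    have "perimeter (A \<union> B) \<le> ennreal (P + Q - (LINT x:A \<inter> B|lebesgue. divergence S x))"
      by (subst perimeter_le_iff[OF UM 0]) (use PQ[OF _ S] in \<open>auto simp: algebra_simps\<close>)
    then show ?thesis
      unfolding pp(2) using 0 by (simp only: ennreal_le_iff)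
  qed
  from p_le[OF unit_field_zero] have 0: "0 \<le> P + Q - p"
    by (simp add: divergence_zero set_lebesgue_integral_def)
  have "perimeter (A \<inter> B) \<le> ennreal (P + Q - p)"
    by (subst perimeter_le_iff[OF IM 0]) (use p_le in \<open>auto simp: algebra_simps\<close>)
  then have "perimeter (A \<union> B) + perimeter (A \<inter> B) \<le> ennreal p + ennreal (P + Q - p)"
    using pp(2) by (intro add_mono) auto
  also have "\<dots> = ennreal P + ennreal Q"
    using 0 \<open>p \<ge> 0\<close> \<open>P \<ge> 0\<close> \<open>Q \<ge> 0\<close> by (simp add: ennreal_plus[symmetric] del: ennreal_plus)
  also have "\<dots> = perimeter A + perimeter B"
    using pA(2) pB(2) by simp
  finally show ?thesis .
qed

section \<open>The perimeter under homotheties\<close>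

lemma lmeasurable_homothety:
  fixes E :: "'a::euclidean_space set"
  assumes "m \<noteq> 0" "E \<in> lmeasurable" shows "{x. a + m *\<^sub>R x \<in> E} \<in> lmeasurable"
proof -
  have "integrable lebesgue (\<lambda>x. indicator E (a + m *\<^sub>R x) :: real)"
    using assms by (intro integrable_homothety) (auto simp: lmeasurable_iff_integrable)
  moreover have "(\<lambda>x. indicator E (a + m *\<^sub>R x) :: real) = indicator {x. a + m *\<^sub>R x \<in> E}"
    by (auto simp: indicator_def)
  ultimately show ?thesis
    by (simp add: lmeasurable_iff_integrable)
qed

text \<open>Every test field is the pull-back of a test field \<open>T'\<close> by the homothety.
  The divergence contributes one factor \<open>m\<close>, and the change of variables divides by
  m^n, n being the dimension.\<close>

lemma perimeter_homothety_le:
  fixes E :: "'a::euclidean_space set"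
  assumes "m > 0" "perimeter E < \<infinity>"
  shows "perimeter {x. a + m *\<^sub>R x \<in> E} \<le> ennreal (m / m ^ DIM('a) * enn2real (perimeter E))"
proof -
  note pE = perimeter_finiteD[OF assms(2)]
  have m0: "m \<noteq> 0" using assms by simp
  show ?thesis
  proof (subst perimeter_le_iff[OF lmeasurable_homothety[OF m0 pE(1)]]; (intro allI impI)?)
    show "0 \<le> m / m ^ DIM('a) * enn2real (perimeter E)"
      using assms by simp
    fix T assume T: "unit_field (T :: 'a \<Rightarrow> 'a)"
    define T' where "T' = (\<lambda>y. T (- (1 / m) *\<^sub>R a + (1 / m) *\<^sub>R y))"
    have T': "unit_field T'"
      unfolding T'_def by (rule unit_field_homothety[OF T]) (use m0 in simp)
    have T_eq: "T = (\<lambda>x. T' (a + m *\<^sub>R x))"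
      using m0 by (auto simp: T'_def fun_eq_iff scaleR_add_right)
    have dT: "divergence T x = m * divergence T' (a + m *\<^sub>R x)" for x
      by (subst T_eq) (rule divergence_homothety[OF unit_field_C1[OF T']])
    have "(LINT x:{x. a + m *\<^sub>R x \<in> E}|lebesgue. divergence T x)
      = (\<integral>x. m * (indicator E (a + m *\<^sub>R x) *\<^sub>R divergence T' (a + m *\<^sub>R x)) \<partial>lebesgue)"
      unfolding set_lebesgue_integral_def by (rule Bochner_Integration.integral_cong) (auto simp: dT indicator_def)
    also have "\<dots> = m * (\<integral>x. indicator E (a + m *\<^sub>R x) *\<^sub>R divergence T' (a + m *\<^sub>R x) \<partial>lebesgue)"
      by simp
    also have "\<dots> = m / m ^ DIM('a) * (LINT x:E|lebesgue. divergence T' x)"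
    proof -
      have "(LINT x:E|lebesgue. divergence T' x) = \<bar>m\<bar> ^ DIM('a) *\<^sub>R (\<integral>x. indicator E (a + m *\<^sub>R x) *\<^sub>R divergence T' (a + m *\<^sub>R x) \<partial>lebesgue)"
        unfolding set_lebesgue_integral_def
        by (rule integral_homothety[OF m0]) (use set_integrable_divergence[OF unit_field_C1c[OF T']] pE(1) in auto)
      then show ?thesis using assms(1) by simp
    qed
    also have "\<dots> \<le> m / m ^ DIM('a) * enn2real (perimeter E)"
      using assms(1) pE(3)[OF T'] by (intro mult_left_mono) auto
    finally show "(LINT x:{x. a + m *\<^sub>R x \<in> E}|lebesgue. divergence T x) \<le> m / m ^ DIM('a) * enn2real (perimeter E)" .
  qed
qed

text \<open>The reverse inequality is the inequality above for the inverse homothety, applied to the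
  rescaled set.\<close>

lemma perimeter_homothety:
  fixes E :: "'a::euclidean_space set"
  assumes "m > 0" "perimeter E < \<infinity>"
  shows "perimeter {x. a + m *\<^sub>R x \<in> E} = ennreal (m / m ^ DIM('a) * enn2real (perimeter E))"
proof (rule antisym[OF perimeter_homothety_le[OF assms]])
  define E' where "E' = {x. a + m *\<^sub>R x \<in> E}"
  have le: "perimeter E' \<le> ennreal (m / m ^ DIM('a) * enn2real (perimeter E))"
    unfolding E'_def by (rule perimeter_homothety_le[OF assms])
  then have fin: "perimeter E' < \<infinity>"
    by (simp add: le_less_trans)
  have E: "{y. - (1 / m) *\<^sub>R a + (1 / m) *\<^sub>R y \<in> E'} = E"
    using assms(1) by (auto simp: E'_def scaleR_add_right scaleR_right_diff_distrib)
  have "perimeter E \<le> ennreal ((1 / m) / (1 / m) ^ DIM('a) * enn2real (perimeter E'))"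
    using perimeter_homothety_le[OF _ fin, of "1 / m" "- (1 / m) *\<^sub>R a"] assms(1) unfolding E by simp
  then have "enn2real (perimeter E) \<le> (1 / m) / (1 / m) ^ DIM('a) * enn2real (perimeter E')"
    by (intro enn2real_leI) (use assms in auto)
  then have "m / m ^ DIM('a) * enn2real (perimeter E) \<le> enn2real (perimeter E')"
    using assms(1) by (simp add: field_simps)
  then have "ennreal (m / m ^ DIM('a) * enn2real (perimeter E)) \<le> ennreal (enn2real (perimeter E'))"
    by (rule ennreal_leI)
  also have "\<dots> = perimeter E'"
    using perimeter_finiteD(2)[OF fin] by simp
  finally show "ennreal (m / m ^ DIM('a) * enn2real (perimeter E)) \<le> perimeter E'" .
qed

section \<open>The closure of test functions\<close>

text \<open>The squared Sobolev norm, for exponent 2, of the difference of two pairs of a function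
  and a candidate gradient. As an \<open>ennreal\<close> integral it makes sense before any
  integrability is known.\<close>

definition sdist :: "('a::euclidean_space \<Rightarrow> real) \<Rightarrow> ('a \<Rightarrow> 'a) \<Rightarrow> ('a \<Rightarrow> real) \<Rightarrow> ('a \<Rightarrow> 'a) \<Rightarrow> ennreal" where
  "sdist v G w W = (\<integral>\<^sup>+x. ennreal ((v x - w x)\<^sup>2 + (norm (G x - W x))\<^sup>2) \<partial>lebesgue)"

text \<open>The closure of the test functions, with the limit gradient kept as explicit data. Each
  operation on functions thus comes with a formula for its gradient, and the choice hidden in
  \<open>wgrad\<close> enters only when passing from and to \<open>H10\<close>. The set
  \<open>V\<close> may be unbounded.\<close>

definition sob :: "'a::euclidean_space set \<Rightarrow> ('a \<Rightarrow> real) \<Rightarrow> ('a \<Rightarrow> 'a) \<Rightarrow> bool" where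
  "sob V v G \<longleftrightarrow> v \<in> borel_measurable lebesgue \<and> G \<in> borel_measurable lebesgue \<and>
     (\<forall>e>0. \<exists>\<phi>. C1c V \<phi> \<and> sdist v G \<phi> (grad \<phi>) < ennreal e)"

lemma sob_measurable: "sob V v G \<Longrightarrow> v \<in> borel_measurable lebesgue" "sob V v G \<Longrightarrow> G \<in> borel_measurable lebesgue"
  by (auto simp: sob_def)

lemma C1c_measurable:
  fixes \<phi> :: "'a::euclidean_space \<Rightarrow> real"
  assumes "C1c V \<phi>"
  shows "\<phi> \<in> borel_measurable lebesgue" "grad \<phi> \<in> borel_measurable lebesgue"
  using C1c_C1[OF assms] C1_continuous C1_grad_continuous by (auto intro!: borel_measurable_continuous_lebesgue)

lemma C1c_zero_outside:
  fixes \<phi> :: "'a::euclidean_space \<Rightarrow> real"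
  assumes "C1c U \<phi>" "x \<notin> U" shows "\<phi> x = 0 \<and> grad \<phi> x = 0"
  using assms zero_outside_supp[of x \<phi>] grad_zero_outside_supp[of x \<phi>] by (auto simp: C1c_iff)

lemma sq_norm_add_le: "(norm (x + y))\<^sup>2 \<le> 2 * (norm x)\<^sup>2 + 2 * (norm y)\<^sup>2"
proof -
  have "(norm (x + y))\<^sup>2 \<le> (norm x + norm y)\<^sup>2"
    by (intro power_mono norm_triangle_ineq) simp
  also have "\<dots> \<le> 2 * (norm x)\<^sup>2 + 2 * (norm y)\<^sup>2"
    using sum_squares_bound[of "norm x" "norm y"] by (simp add: power2_sum)
  finally show ?thesis .
qed

lemma sq_add_le: "((x::real) + y)\<^sup>2 \<le> 2 * x\<^sup>2 + 2 * y\<^sup>2"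
  using sq_norm_add_le[of x y] by simp

lemma ennreal_lincomb:
  "0 \<le> c \<Longrightarrow> 0 \<le> d \<Longrightarrow> 0 \<le> x \<Longrightarrow> 0 \<le> y \<Longrightarrow>
    ennreal c * ennreal x + ennreal d * ennreal y = ennreal (c * x + d * y)"
  by (simp add: ennreal_mult ennreal_plus)

lemma ennreal_lincomb3:
  "0 \<le> c \<Longrightarrow> 0 \<le> d \<Longrightarrow> 0 \<le> e \<Longrightarrow> 0 \<le> x \<Longrightarrow> 0 \<le> y \<Longrightarrow> 0 \<le> z \<Longrightarrow>
    ennreal c * ennreal x + ennreal d * ennreal y + ennreal e * ennreal z = ennreal (c * x + d * y + e * z)"
  by (simp add: ennreal_mult ennreal_plus)

lemma sobD: "sob V v G \<Longrightarrow> e > 0 \<Longrightarrow> \<exists>\<phi>. C1c V \<phi> \<and> sdist v G \<phi> (grad \<phi>) < ennreal e"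
  by (simp add: sob_def)

text \<open>A triangle inequality for squared distances; the factors 2 come from bounding the square
  of a sum by twice the sum of the squares.\<close>

lemma sdist_triangle:
  assumes [measurable]: "v \<in> borel_measurable lebesgue" "G \<in> borel_measurable lebesgue"
    "w \<in> borel_measurable lebesgue" "W \<in> borel_measurable lebesgue"
    "z \<in> borel_measurable lebesgue" "Z \<in> borel_measurable lebesgue"
  shows "sdist v G w W \<le> ennreal 2 * sdist v G z Z + ennreal 2 * sdist z Z w W"
proof -
  have "sdist v G w W \<le> (\<integral>\<^sup>+x. ennreal 2 * ennreal ((v x - z x)\<^sup>2 + (norm (G x - Z x))\<^sup>2)
      + ennreal 2 * ennreal ((z x - w x)\<^sup>2 + (norm (Z x - W x))\<^sup>2) \<partial>lebesgue)"
    unfolding sdist_def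
  proof (rule nn_integral_mono)
    fix x
    have "(v x - w x)\<^sup>2 + (norm (G x - W x))\<^sup>2
       \<le> 2 * ((v x - z x)\<^sup>2 + (norm (G x - Z x))\<^sup>2) + 2 * ((z x - w x)\<^sup>2 + (norm (Z x - W x))\<^sup>2)"
      using sq_add_le[of "v x - z x" "z x - w x"] sq_norm_add_le[of "G x - Z x" "Z x - W x"] by simp
    then show "ennreal ((v x - w x)\<^sup>2 + (norm (G x - W x))\<^sup>2) \<le> ennreal 2 * ennreal ((v x - z x)\<^sup>2 + (norm (G x - Z x))\<^sup>2)
      + ennreal 2 * ennreal ((z x - w x)\<^sup>2 + (norm (Z x - W x))\<^sup>2)"
      by (subst ennreal_lincomb) (auto intro!: ennreal_leI simp del: ennreal_plus)
  qed
  also have "\<dots> = ennreal 2 * sdist v G z Z + ennreal 2 * sdist z Z w W"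
    unfolding sdist_def by (simp add: nn_integral_add nn_integral_cmult del: ennreal_plus)
  finally show ?thesis .
qed

lemma ennreal_two_quarters:
  assumes "a < ennreal (e / 4)" "b < ennreal (e / 4)" "e > 0"
  shows "ennreal 2 * a + ennreal 2 * b < ennreal e"
proof -
  obtain a' where a': "a = ennreal a'" "0 \<le> a'" "a' < e / 4"
    using assms(1) by (cases a) (auto simp: ennreal_less_iff)
  obtain b' where b': "b = ennreal b'" "0 \<le> b'" "b' < e / 4"
    using assms(2) by (cases b) (auto simp: ennreal_less_iff)
  show ?thesis
    unfolding a'(1) b'(1) using a' b' assms(3)
    by (subst ennreal_lincomb) (auto simp: ennreal_less_iff simp del: ennreal_plus)
qed

lemma sob_closed:
  assumes m: "v \<in> borel_measurable lebesgue" "G \<in> borel_measurable lebesgue"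
    and lim: "\<And>e. e > 0 \<Longrightarrow> \<exists>w W. sob V w W \<and> sdist v G w W < ennreal e"
  shows "sob V v G"
  unfolding sob_def
proof (intro conjI m allI impI)
  fix e :: real assume e: "e > 0"
  then have e4: "e / 4 > 0" by simp
  obtain w W where w: "sob V w W" "sdist v G w W < ennreal (e / 4)"
    using lim[OF e4] by (elim exE conjE)
  obtain \<phi> where \<phi>: "C1c V \<phi>" "sdist w W \<phi> (grad \<phi>) < ennreal (e / 4)"
    using sobD[OF w(1) e4] by (elim exE conjE)
  have "sdist v G \<phi> (grad \<phi>) \<le> ennreal 2 * sdist v G w W + ennreal 2 * sdist w W \<phi> (grad \<phi>)"
    by (intro sdist_triangle m sob_measurable[OF w(1)] C1c_measurable[OF \<phi>(1)])
  also have "\<dots> < ennreal e"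
    by (rule ennreal_two_quarters[OF w(2) \<phi>(2) e])
  finally show "\<exists>\<phi>. C1c V \<phi> \<and> sdist v G \<phi> (grad \<phi>) < ennreal e"
    using \<phi>(1) by blast
qed

lemma sob_C1c:
  fixes \<phi> :: "'a::euclidean_space \<Rightarrow> real"
  assumes "C1c V \<phi>" shows "sob V \<phi> (grad \<phi>)"
proof -
  have "sdist \<phi> (grad \<phi>) \<phi> (grad \<phi>) = 0"
    by (simp add: sdist_def)
  then show ?thesis
    unfolding sob_def using C1c_measurable[OF assms] assms by (metis ennreal_less_zero_iff ennreal_0)
qed

lemma sob_limit:
  assumes m: "v \<in> borel_measurable lebesgue" "G \<in> borel_measurable lebesgue"
    and s: "\<And>k. sob V (w k) (W k)" and lim: "(\<lambda>k. sdist v G (w k) (W k)) \<longlonglongrightarrow> 0"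
  shows "sob V v G"
proof (rule sob_closed[OF m])
  fix e :: real assume "e > 0"
  then have "\<forall>\<^sub>F k in sequentially. sdist v G (w k) (W k) < ennreal e"
    by (intro order_tendstoD(2)[OF lim]) simp
  then show "\<exists>w W. sob V w W \<and> sdist v G w W < ennreal e"
    using s by (auto simp: eventually_sequentially)
qed

text \<open>A subsequence also converges almost everywhere. The chain rule needs this, because it
  evaluates the partial derivatives of the outer function at the approximating functions.\<close>

lemma sob_approx:
  assumes "sob V v G"
  shows "\<exists>\<phi>. (\<forall>k::nat. C1c V (\<phi> k)) \<and> (\<lambda>k. sdist v G (\<phi> k) (grad (\<phi> k))) \<longlonglongrightarrow> 0 \<and>
    (AE x in lebesgue. (\<lambda>k. \<phi> k x) \<longlonglongrightarrow> v x)"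
proof -
  note [measurable] = sob_measurable[OF assms]
  have "\<forall>k::nat. \<exists>\<phi>. C1c V \<phi> \<and> sdist v G \<phi> (grad \<phi>) < ennreal (1 / real (Suc k))"
    using assms unfolding sob_def by simp
  then have "\<exists>\<phi>. \<forall>k::nat. C1c V (\<phi> k) \<and> sdist v G (\<phi> k) (grad (\<phi> k)) < ennreal (1 / real (Suc k))"
    by (rule choice)
  then obtain \<phi> where \<phi>: "\<And>k::nat. C1c V (\<phi> k)" "\<And>k::nat. sdist v G (\<phi> k) (grad (\<phi> k)) < ennreal (1 / real (Suc k))"
    by blast
  note [measurable] = C1c_measurable[OF \<phi>(1)]
  define u where "u k x = (v x - \<phi> k x)\<^sup>2 + (norm (G x - grad (\<phi> k) x))\<^sup>2" for k x
  have u0: "0 \<le> u k x" for k x by (simp add: u_def)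
  have [measurable]: "u k \<in> borel_measurable lebesgue" for k
    unfolding u_def by measurable
  have sd: "sdist v G (\<phi> k) (grad (\<phi> k)) = (\<integral>\<^sup>+x. ennreal (u k x) \<partial>lebesgue)" for k
    by (simp add: sdist_def u_def)
  have lim1: "(\<lambda>k. ennreal (1 / real (Suc k))) \<longlonglongrightarrow> ennreal 0"
    by (rule tendsto_ennrealI[OF LIMSEQ_Suc[OF lim_1_over_n]])
  have lim: "(\<lambda>k. sdist v G (\<phi> k) (grad (\<phi> k))) \<longlonglongrightarrow> 0"
  proof (rule tendsto_sandwich[OF _ _ tendsto_const])
    show "(\<lambda>k. ennreal (1 / real (Suc k))) \<longlonglongrightarrow> 0" using lim1 by simp
    show "\<forall>\<^sub>F k in sequentially. sdist v G (\<phi> k) (grad (\<phi> k)) \<le> ennreal (1 / real (Suc k))"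
      using \<phi>(2) by (intro always_eventually allI less_imp_le)
  qed simp
  have int: "integrable lebesgue (u k)" for k
  proof (rule integrableI_bounded)
    show "(\<integral>\<^sup>+x. ennreal (norm (u k x)) \<partial>lebesgue) < \<infinity>"
      using less_trans[OF \<phi>(2)[of k] ennreal_less_top] u0 by (simp add: sd)
  qed simp
  have "(\<lambda>k. \<integral>x. norm (u k x) \<partial>lebesgue) \<longlonglongrightarrow> 0"
  proof -
    have "ennreal (\<integral>x. norm (u k x) \<partial>lebesgue) = sdist v G (\<phi> k) (grad (\<phi> k))" for k
      unfolding sd using int[of k] u0 by (subst nn_integral_eq_integral[symmetric]) auto
    then have "(\<lambda>k. ennreal (\<integral>x. norm (u k x) \<partial>lebesgue)) \<longlonglongrightarrow> ennreal 0"
      using lim by simp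
    then show ?thesis
      by (rule tendsto_ennrealD) auto
  qed
  from tendsto_L1_AE_subseq[OF int this]
  obtain r where r: "strict_mono r" "AE x in lebesgue. (\<lambda>n. u (r n) x) \<longlonglongrightarrow> 0"
    by (elim exE conjE) (rule that)
  have "AE x in lebesgue. (\<lambda>n. \<phi> (r n) x) \<longlonglongrightarrow> v x"
    using r(2)
  proof (rule eventually_mono)
    fix x assume u: "(\<lambda>n. u (r n) x) \<longlonglongrightarrow> 0"
    have "(\<lambda>n. (v x - \<phi> (r n) x)\<^sup>2) \<longlonglongrightarrow> 0"
      by (rule Lim_null_comparison[OF always_eventually u]) (simp add: u_def)
    from tendsto_real_sqrt[OF this] have "(\<lambda>n. v x - \<phi> (r n) x) \<longlonglongrightarrow> 0"
      by (simp add: tendsto_rabs_zero_iff)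
    from tendsto_diff[OF tendsto_const[of "v x"] this] show "(\<lambda>n. \<phi> (r n) x) \<longlonglongrightarrow> v x"
      by simp
  qed
  moreover have "(\<lambda>n. sdist v G (\<phi> (r n)) (grad (\<phi> (r n)))) \<longlonglongrightarrow> 0"
    using LIMSEQ_subseq_LIMSEQ[OF lim r(1)] by (simp add: o_def)
  ultimately show ?thesis
    using \<phi>(1) by (intro exI[of _ "\<lambda>n. \<phi> (r n)"]) simp
qed

lemma nn_integral_sq_finite:
  assumes "sob V v G"
  shows "(\<integral>\<^sup>+x. ennreal ((v x)\<^sup>2 + (norm (G x))\<^sup>2) \<partial>lebesgue) < \<infinity>"
proof -
  note m = sob_measurable[OF assms]
  obtain \<phi> where \<phi>: "C1c V \<phi>" "sdist v G \<phi> (grad \<phi>) < ennreal 1"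
    using sobD[OF assms zero_less_one] by (elim exE conjE)
  have C: "C1 \<phi>" "compact (supp \<phi>)"
    using \<phi>(1) by (auto simp: C1c_iff)
  have "integrable lebesgue (\<lambda>x. (\<phi> x)\<^sup>2 + (norm (grad \<phi> x))\<^sup>2)"
  proof (rule integrable_compact_support(2)[OF _ C(2)])
    have "continuous_on UNIV \<phi>" "continuous_on UNIV (grad \<phi>)"
      using C C1_continuous C1_grad_continuous by blast+
    then show "continuous_on UNIV (\<lambda>x. (\<phi> x)\<^sup>2 + (norm (grad \<phi> x))\<^sup>2)"
      by (intro continuous_intros)
    show "(\<phi> x)\<^sup>2 + (norm (grad \<phi> x))\<^sup>2 = 0" if "x \<notin> supp \<phi>" for x
      using zero_outside_supp[OF that] grad_zero_outside_supp[OF that] by simp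
  qed
  then have 1: "sdist \<phi> (grad \<phi>) (\<lambda>x. 0) (\<lambda>x. 0) < \<infinity>"
    by (simp add: sdist_def integrable_iff_bounded)
  have "sdist v G (\<lambda>x. 0) (\<lambda>x. 0) \<le> ennreal 2 * sdist v G \<phi> (grad \<phi>) + ennreal 2 * sdist \<phi> (grad \<phi>) (\<lambda>x. 0) (\<lambda>x. 0)"
    by (intro sdist_triangle m C1c_measurable[OF \<phi>(1)]) auto
  also have "\<dots> < \<infinity>"
    using 1 less_trans[OF \<phi>(2) ennreal_less_top] by (simp add: ennreal_mult_less_top)
  finally show ?thesis
    by (simp add: sdist_def)
qed

lemma sob_L2:
  assumes "sob V v G"
  shows "integrable lebesgue (\<lambda>x. (v x)\<^sup>2)" "integrable lebesgue (\<lambda>x. (norm (G x))\<^sup>2)"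
proof -
  note [measurable] = sob_measurable[OF assms]
  have i: "integrable lebesgue (\<lambda>x. (v x)\<^sup>2 + (norm (G x))\<^sup>2)"
    using nn_integral_sq_finite[OF assms] by (intro integrableI_bounded) auto
  show "integrable lebesgue (\<lambda>x. (v x)\<^sup>2)"
    by (rule Bochner_Integration.integrable_bound[OF i]) auto
  show "integrable lebesgue (\<lambda>x. (norm (G x))\<^sup>2)"
    by (rule Bochner_Integration.integrable_bound[OF i]) auto
qed

section \<open>The chain rule in the closure of the test functions\<close>

lemma lipschitz_two_variables:
  fixes H :: "real \<Rightarrow> real \<Rightarrow> real"
  assumes d: "\<And>x y. ((\<lambda>p. H (fst p) (snd p)) has_derivative (\<lambda>q. Hx x y * fst q + Hy x y * snd q)) (at (x, y))"
    and bd: "\<And>x y. \<bar>Hx x y\<bar> \<le> C" "\<And>x y. \<bar>Hy x y\<bar> \<le> C" and C: "C \<ge> 0"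
  shows "(H x y - H x' y')\<^sup>2 \<le> 4 * C\<^sup>2 * ((x - x')\<^sup>2 + (y - y')\<^sup>2)"
proof -
  have on: "onorm (\<lambda>q. Hx x y * fst q + Hy x y * snd q) \<le> 2 * C" for x y
  proof (rule onorm_le)
    fix q :: "real \<times> real"
    have "norm (Hx x y * fst q + Hy x y * snd q) \<le> \<bar>Hx x y\<bar> * \<bar>fst q\<bar> + \<bar>Hy x y\<bar> * \<bar>snd q\<bar>"
      by (metis abs_mult norm_triangle_ineq real_norm_def)
    also have "\<dots> \<le> C * norm q + C * norm q"
      using bd C norm_fst_le[of "fst q" "snd q"] norm_snd_le[of "snd q" "fst q"] by (intro add_mono mult_mono) (auto simp: real_norm_def[symmetric] simp del: real_norm_def)
    finally show "norm (Hx x y * fst q + Hy x y * snd q) \<le> 2 * C * norm q" by simp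
  qed
  have "norm (H (fst (x, y)) (snd (x, y)) - H (fst (x', y')) (snd (x', y'))) \<le> 2 * C * norm ((x, y) - (x', y'))"
  proof (rule differentiable_bound[where S = UNIV and f = "\<lambda>p. H (fst p) (snd p)" and f' = "\<lambda>p q. Hx (fst p) (snd p) * fst q + Hy (fst p) (snd p) * snd q"])
    show "((\<lambda>p. H (fst p) (snd p)) has_derivative (\<lambda>q. Hx (fst p) (snd p) * fst q + Hy (fst p) (snd p) * snd q)) (at p within UNIV)" for p
      using d[of "fst p" "snd p"] by simp
  qed (use on in auto)
  then have "\<bar>H x y - H x' y'\<bar> \<le> 2 * C * norm (x - x', y - y')"
    by simp
  then have "(H x y - H x' y')\<^sup>2 \<le> (2 * C * norm (x - x', y - y'))\<^sup>2"
    by (metis abs_ge_zero power2_abs power_mono)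
  also have "\<dots> = 4 * C\<^sup>2 * ((x - x')\<^sup>2 + (y - y')\<^sup>2)"
    by (simp add: power_mult_distrib norm_Pair)
  finally show ?thesis .
qed

lemma C1_two_variables:
  fixes H :: "real \<Rightarrow> real \<Rightarrow> real" and f g :: "'a::euclidean_space \<Rightarrow> real"
  assumes d: "\<And>x y. ((\<lambda>p. H (fst p) (snd p)) has_derivative (\<lambda>q. Hx x y * fst q + Hy x y * snd q)) (at (x, y))"
    and c: "continuous_on UNIV (\<lambda>p. Hx (fst p) (snd p))" "continuous_on UNIV (\<lambda>p. Hy (fst p) (snd p))"
    and fg: "C1 f" "C1 g"
  shows "C1 (\<lambda>x. H (f x) (g x))"
    "grad (\<lambda>x. H (f x) (g x)) x = Hx (f x) (g x) *\<^sub>R grad f x + Hy (f x) (g x) *\<^sub>R grad g x"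
proof -
  have D: "((\<lambda>x. H (f x) (g x)) has_derivative (\<lambda>h. (Hx (f x) (g x) *\<^sub>R grad f x + Hy (f x) (g x) *\<^sub>R grad g x) \<bullet> h)) (at x)" for x
    using diff_chain_at[OF has_derivative_Pair[OF C1_has_grad[OF fg(1)] C1_has_grad[OF fg(2)]] d]
    by (simp add: o_def inner_add_left)
  have fc: "continuous_on UNIV (\<lambda>x. (f x, g x))"
    by (intro continuous_intros C1_continuous fg)
  have "continuous_on UNIV (\<lambda>x. Hx (f x) (g x))" "continuous_on UNIV (\<lambda>x. Hy (f x) (g x))"
    using continuous_on_compose2[OF c(1) fc] continuous_on_compose2[OF c(2) fc] by simp_all
  then show "C1 (\<lambda>x. H (f x) (g x))"
    by (intro C1_gradI[OF D] continuous_intros C1_grad_continuous fg)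
  show "grad (\<lambda>x. H (f x) (g x)) x = Hx (f x) (g x) *\<^sub>R grad f x + Hy (f x) (g x) *\<^sub>R grad g x"
    by (rule grad_eqI[OF D])
qed

text \<open>Compose the approximating test functions with \<open>H\<close>. The gradient error
  splits into bounded coefficients times errors of the gradients, small in the square norm, and
  coefficient errors times fixed gradients, small by dominated convergence. The assumption
  \<open>sup\<close> isolates the only question about supports, so that \<open>Z\<close> may differ
  from \<open>V\<close> and \<open>W\<close>.\<close>

lemma sob_smooth_compose:
  fixes H :: "real \<Rightarrow> real \<Rightarrow> real" and a b :: "'a::euclidean_space \<Rightarrow> real"
  assumes a: "sob V a A" and b: "sob W b B"
    and d: "\<And>x y. ((\<lambda>p. H (fst p) (snd p)) has_derivative (\<lambda>q. Hx x y * fst q + Hy x y * snd q)) (at (x, y))"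
    and c: "continuous_on UNIV (\<lambda>p. Hx (fst p) (snd p))" "continuous_on UNIV (\<lambda>p. Hy (fst p) (snd p))"
    and bd: "\<And>x y. \<bar>Hx x y\<bar> \<le> C" "\<And>x y. \<bar>Hy x y\<bar> \<le> C" and C: "C \<ge> 0"
    and sup: "\<And>\<phi> \<psi>. C1c V \<phi> \<Longrightarrow> C1c W \<psi> \<Longrightarrow> C1 (\<lambda>x. H (\<phi> x) (\<psi> x)) \<Longrightarrow> C1c Z (\<lambda>x. H (\<phi> x) (\<psi> x))"
  shows "sob Z (\<lambda>x. H (a x) (b x)) (\<lambda>x. Hx (a x) (b x) *\<^sub>R A x + Hy (a x) (b x) *\<^sub>R B x)"
proof -
  note [measurable] = sob_measurable[OF a] sob_measurable[OF b]
  have comp_m: "(\<lambda>x. F (f x) (g x)) \<in> borel_measurable lebesgue"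
    if F: "continuous_on UNIV (\<lambda>p. F (fst p) (snd p))" and [measurable]: "f \<in> borel_measurable lebesgue" "g \<in> borel_measurable lebesgue"
    for F :: "real \<Rightarrow> real \<Rightarrow> real" and f g :: "'a \<Rightarrow> real"
    using borel_measurable_continuous_on[OF F, of "\<lambda>x. (f x, g x)" lebesgue] by simp
  have cH: "continuous_on UNIV (\<lambda>p. H (fst p) (snd p))"
    unfolding continuous_on_eq_continuous_within
    using has_derivative_continuous[OF d[of "fst p" "snd p" for p]] by auto
  obtain \<phi> where \<phi>: "\<And>k::nat. C1c V (\<phi> k)" and \<phi>l: "(\<lambda>k. sdist a A (\<phi> k) (grad (\<phi> k))) \<longlonglongrightarrow> 0"
    and \<phi>p: "AE x in lebesgue. (\<lambda>k. \<phi> k x) \<longlonglongrightarrow> a x"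
    using sob_approx[OF a] by blast
  obtain \<psi> where \<psi>: "\<And>k::nat. C1c W (\<psi> k)" and \<psi>l: "(\<lambda>k. sdist b B (\<psi> k) (grad (\<psi> k))) \<longlonglongrightarrow> 0"
    and \<psi>p: "AE x in lebesgue. (\<lambda>k. \<psi> k x) \<longlonglongrightarrow> b x"
    using sob_approx[OF b] by blast
  note [measurable] = C1c_measurable[OF \<phi>] C1c_measurable[OF \<psi>]
  define \<theta> where "\<theta> k x = H (\<phi> k x) (\<psi> k x)" for k x
  define v where "v x = H (a x) (b x)" for x
  define G where "G x = Hx (a x) (b x) *\<^sub>R A x + Hy (a x) (b x) *\<^sub>R B x" for x
  have \<theta>1: "C1 (\<theta> k)" for k
    unfolding \<theta>_def by (rule C1_two_variables(1)[OF d c C1c_C1[OF \<phi>] C1c_C1[OF \<psi>]])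
  have \<theta>Z: "C1c Z (\<theta> k)" for k
    using sup[OF \<phi> \<psi> \<theta>1[unfolded \<theta>_def]] by (simp add: \<theta>_def[abs_def])
  have g\<theta>: "grad (\<theta> k) x = Hx (\<phi> k x) (\<psi> k x) *\<^sub>R grad (\<phi> k) x + Hy (\<phi> k x) (\<psi> k x) *\<^sub>R grad (\<psi> k) x" for k x
    unfolding \<theta>_def by (rule C1_two_variables(2)[OF d c C1c_C1[OF \<phi>] C1c_C1[OF \<psi>]])
  note ma = sob_measurable(1)[OF a] sob_measurable(1)[OF b]
  note m\<phi> = C1c_measurable(1)[OF \<phi>] C1c_measurable(1)[OF \<psi>]
  note [measurable] = comp_m[OF c(1) ma] comp_m[OF c(2) ma] comp_m[OF cH ma] comp_m[OF c(1) m\<phi>] comp_m[OF c(2) m\<phi>]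
  have vG: "v \<in> borel_measurable lebesgue" "G \<in> borel_measurable lebesgue"
    unfolding v_def G_def by measurable
  \<comment> \<open>The part of the error in which the coefficients differ while the gradients are
    the fixed limits; it is controlled through convergence almost everywhere.\<close>
  define E where "E k x = (Hx (a x) (b x) - Hx (\<phi> k x) (\<psi> k x))\<^sup>2 * (norm (A x))\<^sup>2
     + (Hy (a x) (b x) - Hy (\<phi> k x) (\<psi> k x))\<^sup>2 * (norm (B x))\<^sup>2" for k x
  have E0: "0 \<le> E k x" for k x by (simp add: E_def)
  have [measurable]: "E k \<in> borel_measurable lebesgue" for k
    unfolding E_def by measurable
  \<comment> \<open>This constant serves three times: as the squared Lipschitz constant of
    \<open>H\<close>, as the factor of the gradient errors, where the square estimate is used twice,
    and as a bound on squared differences of coefficients.\<close>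
  define K where "K = 4 * C\<^sup>2"
  have K: "K \<ge> 0" by (simp add: K_def)
  let ?da = "\<lambda>k x. (a x - \<phi> k x)\<^sup>2 + (norm (A x - grad (\<phi> k) x))\<^sup>2"
  let ?db = "\<lambda>k x. (b x - \<psi> k x)\<^sup>2 + (norm (B x - grad (\<psi> k) x))\<^sup>2"
  have pt: "(v x - \<theta> k x)\<^sup>2 + (norm (G x - grad (\<theta> k) x))\<^sup>2 \<le> K * ?da k x + K * ?db k x + 4 * E k x" for k x
  proof -
    have 1: "(v x - \<theta> k x)\<^sup>2 \<le> K * (a x - \<phi> k x)\<^sup>2 + K * (b x - \<psi> k x)\<^sup>2"
      using lipschitz_two_variables[OF d bd C, of "a x" "b x" "\<phi> k x" "\<psi> k x"]
      by (simp add: v_def \<theta>_def K_def distrib_left)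
    have G_eq: "G x - grad (\<theta> k) x = (Hx (\<phi> k x) (\<psi> k x) *\<^sub>R (A x - grad (\<phi> k) x) + Hy (\<phi> k x) (\<psi> k x) *\<^sub>R (B x - grad (\<psi> k) x))
      + ((Hx (a x) (b x) - Hx (\<phi> k x) (\<psi> k x)) *\<^sub>R A x + (Hy (a x) (b x) - Hy (\<phi> k x) (\<psi> k x)) *\<^sub>R B x)" (is "_ = (?p + ?q) + (?r + ?s)")
      by (simp add: G_def g\<theta> algebra_simps)
    have sq: "(norm (t *\<^sub>R z))\<^sup>2 \<le> C\<^sup>2 * (norm z)\<^sup>2" if "\<bar>t\<bar> \<le> C" for t and z :: 'a
      using that C by (simp add: power_mult_distrib mult_right_mono abs_le_square_iff[symmetric])
    have "(norm (G x - grad (\<theta> k) x))\<^sup>2 \<le> 2 * (norm (?p + ?q))\<^sup>2 + 2 * (norm (?r + ?s))\<^sup>2"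
      unfolding G_eq by (rule sq_norm_add_le)
    also have "\<dots> \<le> 2 * (2 * (norm ?p)\<^sup>2 + 2 * (norm ?q)\<^sup>2) + 2 * (2 * (norm ?r)\<^sup>2 + 2 * (norm ?s)\<^sup>2)"
      by (intro add_mono mult_left_mono sq_norm_add_le) auto
    also have "\<dots> = 4 * (norm ?p)\<^sup>2 + 4 * (norm ?q)\<^sup>2 + 4 * E k x"
      by (simp add: E_def power_mult_distrib)
    also have "\<dots> \<le> K * (norm (A x - grad (\<phi> k) x))\<^sup>2 + K * (norm (B x - grad (\<psi> k) x))\<^sup>2 + 4 * E k x"
      using sq[OF bd(1), of "\<phi> k x" "\<psi> k x" "A x - grad (\<phi> k) x"] sq[OF bd(2), of "\<phi> k x" "\<psi> k x" "B x - grad (\<psi> k) x"]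
      by (simp add: K_def)
    finally show ?thesis
      using 1 by (simp add: distrib_left)
  qed
  have sd_le: "sdist v G (\<theta> k) (grad (\<theta> k)) \<le> ennreal K * sdist a A (\<phi> k) (grad (\<phi> k)) + ennreal K * sdist b B (\<psi> k) (grad (\<psi> k))
      + ennreal 4 * (\<integral>\<^sup>+x. ennreal (E k x) \<partial>lebesgue)" for k
  proof -
    have "sdist v G (\<theta> k) (grad (\<theta> k)) \<le> (\<integral>\<^sup>+x. ennreal K * ennreal (?da k x) + ennreal K * ennreal (?db k x) + ennreal 4 * ennreal (E k x) \<partial>lebesgue)"
      unfolding sdist_def
    proof (rule nn_integral_mono)
      fix x
      have "ennreal ((v x - \<theta> k x)\<^sup>2 + (norm (G x - grad (\<theta> k) x))\<^sup>2) \<le> ennreal (K * ?da k x + K * ?db k x + 4 * E k x)"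
        by (rule ennreal_leI[OF pt])
      also have "\<dots> = ennreal K * ennreal (?da k x) + ennreal K * ennreal (?db k x) + ennreal 4 * ennreal (E k x)"
        using K E0[of k x] by (intro ennreal_lincomb3[symmetric]) auto
      finally show "ennreal ((v x - \<theta> k x)\<^sup>2 + (norm (G x - grad (\<theta> k) x))\<^sup>2) \<le> \<dots>" .
    qed
    also have "\<dots> = ennreal K * sdist a A (\<phi> k) (grad (\<phi> k)) + ennreal K * sdist b B (\<psi> k) (grad (\<psi> k))
      + ennreal 4 * (\<integral>\<^sup>+x. ennreal (E k x) \<partial>lebesgue)"
      unfolding sdist_def by (simp add: nn_integral_add nn_integral_cmult del: ennreal_plus)
    finally show ?thesis .
  qed
  have Elim: "(\<lambda>k. \<integral>\<^sup>+x. ennreal (E k x) \<partial>lebesgue) \<longlonglongrightarrow> (\<integral>\<^sup>+x. 0 \<partial>(lebesgue :: 'a measure))"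
  proof (rule nn_integral_dominated_convergence[where w = "\<lambda>x. ennreal (K * (norm (A x))\<^sup>2 + K * (norm (B x))\<^sup>2)"])
    have sqd: "(s - t)\<^sup>2 \<le> K" if "\<bar>s\<bar> \<le> C" "\<bar>t\<bar> \<le> C" for s t :: real
    proof -
      have "\<bar>s - t\<bar> \<le> 2 * C" using that by linarith
      then have "(s - t)\<^sup>2 \<le> (2 * C)\<^sup>2" by (metis abs_ge_zero power2_abs power_mono)
      then show ?thesis by (simp add: K_def power_mult_distrib)
    qed
    show "AE x in lebesgue. ennreal (E k x) \<le> ennreal (K * (norm (A x))\<^sup>2 + K * (norm (B x))\<^sup>2)" for k
      unfolding E_def by (intro AE_I2 ennreal_leI add_mono mult_right_mono sqd bd) auto
    have "integrable lebesgue (\<lambda>x. K * (norm (A x))\<^sup>2 + K * (norm (B x))\<^sup>2)"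
      using sob_L2(2)[OF a] sob_L2(2)[OF b] by auto
    then show "(\<integral>\<^sup>+x. ennreal (K * (norm (A x))\<^sup>2 + K * (norm (B x))\<^sup>2) \<partial>lebesgue) < \<infinity>"
      using K by (simp add: integrable_iff_bounded)
    show "AE x in lebesgue. (\<lambda>k. ennreal (E k x)) \<longlonglongrightarrow> 0"
      using \<phi>p \<psi>p
    proof eventually_elim
      case (elim x)
      have cc: "(\<lambda>k. F (\<phi> k x) (\<psi> k x)) \<longlonglongrightarrow> F (a x) (b x)"
        if F: "continuous_on UNIV (\<lambda>p. F (fst p) (snd p))" for F :: "real \<Rightarrow> real \<Rightarrow> real"
        using continuous_on_tendsto_compose[OF F tendsto_Pair[OF elim]] by simp
      have "(\<lambda>k. E k x) \<longlonglongrightarrow> (Hx (a x) (b x) - Hx (a x) (b x))\<^sup>2 * (norm (A x))\<^sup>2 + (Hy (a x) (b x) - Hy (a x) (b x))\<^sup>2 * (norm (B x))\<^sup>2"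
        unfolding E_def by (intro tendsto_intros cc c)
      then have "(\<lambda>k. E k x) \<longlonglongrightarrow> 0" by simp
      from tendsto_ennrealI[OF this] show ?case by simp
    qed
  qed auto
  have lim: "(\<lambda>k. ennreal K * sdist a A (\<phi> k) (grad (\<phi> k)) + ennreal K * sdist b B (\<psi> k) (grad (\<psi> k))
      + ennreal 4 * (\<integral>\<^sup>+x. ennreal (E k x) \<partial>lebesgue)) \<longlonglongrightarrow> ennreal K * 0 + ennreal K * 0 + ennreal 4 * 0"
    using Elim by (intro tendsto_add ennreal_tendsto_cmult \<phi>l \<psi>l) auto
  have "(\<lambda>k. sdist v G (\<theta> k) (grad (\<theta> k))) \<longlonglongrightarrow> 0"
  proof (rule tendsto_sandwich[OF _ _ tendsto_const])
    show "(\<lambda>k. ennreal K * sdist a A (\<phi> k) (grad (\<phi> k)) + ennreal K * sdist b B (\<psi> k) (grad (\<psi> k))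
      + ennreal 4 * (\<integral>\<^sup>+x. ennreal (E k x) \<partial>lebesgue)) \<longlonglongrightarrow> 0"
      using lim by simp
    show "\<forall>\<^sub>F k in sequentially. sdist v G (\<theta> k) (grad (\<theta> k)) \<le> ennreal K * sdist a A (\<phi> k) (grad (\<phi> k)) + ennreal K * sdist b B (\<psi> k) (grad (\<psi> k))
      + ennreal 4 * (\<integral>\<^sup>+x. ennreal (E k x) \<partial>lebesgue)"
      by (intro always_eventually allI sd_le)
  qed simp
  from sob_limit[OF vG sob_C1c[OF \<theta>Z] this] show ?thesis
    unfolding v_def G_def .
qed

text \<open>The functions \<open>H j\<close> are smooth approximations of a Lipschitz function such as the minimum.
  Their partial derivatives need to converge everywhere, which is how the gradient of the limit is
  chosen on the set where the limit function is not differentiable.\<close>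

lemma sob_compose:
  fixes H :: "nat \<Rightarrow> real \<Rightarrow> real \<Rightarrow> real" and a b :: "'a::euclidean_space \<Rightarrow> real"
  assumes a: "sob V a A" and b: "sob W b B"
    and d: "\<And>j x y. ((\<lambda>p. H j (fst p) (snd p)) has_derivative (\<lambda>q. Hx j x y * fst q + Hy j x y * snd q)) (at (x, y))"
    and c: "\<And>j. continuous_on UNIV (\<lambda>p. Hx j (fst p) (snd p))" "\<And>j. continuous_on UNIV (\<lambda>p. Hy j (fst p) (snd p))"
    and bd: "\<And>j x y. \<bar>Hx j x y\<bar> \<le> C" "\<And>j x y. \<bar>Hy j x y\<bar> \<le> C"
    and zero: "\<And>j. H j 0 0 = 0"
    and sup: "\<And>j \<phi> \<psi>. C1c V \<phi> \<Longrightarrow> C1c W \<psi> \<Longrightarrow> C1 (\<lambda>x. H j (\<phi> x) (\<psi> x)) \<Longrightarrow> C1c Z (\<lambda>x. H j (\<phi> x) (\<psi> x))"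
    and l: "\<And>x y. (\<lambda>j. H j x y) \<longlonglongrightarrow> h x y" "\<And>x y. (\<lambda>j. Hx j x y) \<longlonglongrightarrow> P x y" "\<And>x y. (\<lambda>j. Hy j x y) \<longlonglongrightarrow> Q x y"
  shows "sob Z (\<lambda>x. h (a x) (b x)) (\<lambda>x. P (a x) (b x) *\<^sub>R A x + Q (a x) (b x) *\<^sub>R B x)"
proof -
  have C: "C \<ge> 0" using bd(1)[of 0 0 0] by linarith
  note [measurable] = sob_measurable[OF a] sob_measurable[OF b]
  define v where "v j x = H j (a x) (b x)" for j x
  define G where "G j x = Hx j (a x) (b x) *\<^sub>R A x + Hy j (a x) (b x) *\<^sub>R B x" for j x
  define v' where "v' x = h (a x) (b x)" for x
  define G' where "G' x = P (a x) (b x) *\<^sub>R A x + Q (a x) (b x) *\<^sub>R B x" for x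
  have s: "sob Z (v j) (G j)" for j
    unfolding v_def G_def by (rule sob_smooth_compose[OF a b d c bd C sup])
  note [measurable] = sob_measurable[OF s]
  have vl: "(\<lambda>j. v j x) \<longlonglongrightarrow> v' x" and Gl: "(\<lambda>j. G j x) \<longlonglongrightarrow> G' x" for x
    unfolding v_def v'_def G_def G'_def by (intro tendsto_intros l)+
  have v'm[measurable]: "v' \<in> borel_measurable lebesgue" and G'm[measurable]: "G' \<in> borel_measurable lebesgue"
    using borel_measurable_LIMSEQ_metric[OF sob_measurable(1)[OF s] vl] borel_measurable_LIMSEQ_metric[OF sob_measurable(2)[OF s] Gl] by auto
  \<comment> \<open>An integrable majorant. The functions contribute 2 (4 + 4) = 16 times
    \<open>C\<^sup>2\<close>, the gradients 2 (2 + 2) = 8 times; the larger number is taken for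
    both.\<close>
  define w where "w x = 16 * C\<^sup>2 * ((a x)\<^sup>2 + (b x)\<^sup>2) + 16 * C\<^sup>2 * ((norm (A x))\<^sup>2 + (norm (B x))\<^sup>2)" for x
  have vb: "(v j x)\<^sup>2 \<le> 4 * C\<^sup>2 * ((a x)\<^sup>2 + (b x)\<^sup>2)" for j x
    using lipschitz_two_variables[OF d bd C, of j "a x" "b x" 0 0] by (simp add: v_def zero)
  have sq: "(norm (t *\<^sub>R z))\<^sup>2 \<le> C\<^sup>2 * (norm z)\<^sup>2" if "\<bar>t\<bar> \<le> C" for t and z :: 'a
    using that C by (simp add: power_mult_distrib mult_right_mono abs_le_square_iff[symmetric])
  have Gb: "(norm (G j x))\<^sup>2 \<le> 2 * C\<^sup>2 * ((norm (A x))\<^sup>2 + (norm (B x))\<^sup>2)" for j x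
  proof -
    have "(norm (G j x))\<^sup>2 \<le> 2 * (norm (Hx j (a x) (b x) *\<^sub>R A x))\<^sup>2 + 2 * (norm (Hy j (a x) (b x) *\<^sub>R B x))\<^sup>2"
      unfolding G_def by (rule sq_norm_add_le)
    also have "\<dots> \<le> 2 * (C\<^sup>2 * (norm (A x))\<^sup>2) + 2 * (C\<^sup>2 * (norm (B x))\<^sup>2)"
      by (intro add_mono mult_left_mono sq bd) auto
    finally show ?thesis
      by (simp add: distrib_left)
  qed
  have v'b: "(v' x)\<^sup>2 \<le> 4 * C\<^sup>2 * ((a x)\<^sup>2 + (b x)\<^sup>2)" for x
    by (rule LIMSEQ_le_const2[OF tendsto_power[OF vl]]) (use vb in auto)
  have G'b: "(norm (G' x))\<^sup>2 \<le> 2 * C\<^sup>2 * ((norm (A x))\<^sup>2 + (norm (B x))\<^sup>2)" for x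
    by (rule LIMSEQ_le_const2[OF tendsto_power[OF tendsto_norm[OF Gl]]]) (use Gb in auto)
  have dom: "(v' x - v j x)\<^sup>2 + (norm (G' x - G j x))\<^sup>2 \<le> w x" for j x
  proof -
    have 1: "(v' x - v j x)\<^sup>2 \<le> 16 * C\<^sup>2 * ((a x)\<^sup>2 + (b x)\<^sup>2)"
      using sq_add_le[of "v' x" "- v j x"] vb[of j x] v'b[of x] by simp
    have "(norm (G' x - G j x))\<^sup>2 \<le> 2 * (norm (G' x))\<^sup>2 + 2 * (norm (G j x))\<^sup>2"
      using sq_norm_add_le[of "G' x" "- G j x"] by simp
    also have "\<dots> \<le> 8 * C\<^sup>2 * ((norm (A x))\<^sup>2 + (norm (B x))\<^sup>2)"
      using Gb[of j x] G'b[of x] by simp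
    also have "\<dots> \<le> 16 * C\<^sup>2 * ((norm (A x))\<^sup>2 + (norm (B x))\<^sup>2)"
      by (intro mult_right_mono) auto
    finally show ?thesis
      using 1 by (simp add: w_def)
  qed
  have "(\<lambda>j. sdist v' G' (v j) (G j)) \<longlonglongrightarrow> (\<integral>\<^sup>+x. 0 \<partial>(lebesgue :: 'a measure))"
    unfolding sdist_def
  proof (rule nn_integral_dominated_convergence[where w = "\<lambda>x. ennreal (w x)"])
    show "(\<lambda>x. ennreal (w x)) \<in> borel_measurable lebesgue"
      unfolding w_def by measurable
    show "AE x in lebesgue. ennreal ((v' x - v j x)\<^sup>2 + (norm (G' x - G j x))\<^sup>2) \<le> ennreal (w x)" for j
      by (intro AE_I2 ennreal_leI dom)
    have "integrable lebesgue w"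
      unfolding w_def using sob_L2[OF a] sob_L2[OF b] by (intro Bochner_Integration.integrable_add integrable_mult_right) auto
    moreover have "0 \<le> w x" for x by (simp add: w_def)
    ultimately show "(\<integral>\<^sup>+x. ennreal (w x) \<partial>lebesgue) < \<infinity>"
      by (simp add: integrable_iff_bounded)
    show "AE x in lebesgue. (\<lambda>j. ennreal ((v' x - v j x)\<^sup>2 + (norm (G' x - G j x))\<^sup>2)) \<longlonglongrightarrow> 0"
    proof (rule AE_I2)
      fix x
      have "(\<lambda>j. (v' x - v j x)\<^sup>2 + (norm (G' x - G j x))\<^sup>2) \<longlonglongrightarrow> (v' x - v' x)\<^sup>2 + (norm (G' x - G' x))\<^sup>2"
        by (intro tendsto_intros vl Gl)
      then have "(\<lambda>j. (v' x - v j x)\<^sup>2 + (norm (G' x - G j x))\<^sup>2) \<longlonglongrightarrow> 0" by simp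
      from tendsto_ennrealI[OF this] show "(\<lambda>j. ennreal ((v' x - v j x)\<^sup>2 + (norm (G' x - G j x))\<^sup>2)) \<longlonglongrightarrow> 0"
        by simp
    qed
  qed measurable
  then have "(\<lambda>j. sdist v' G' (v j) (G j)) \<longlonglongrightarrow> 0" by simp
  from sob_limit[OF v'm G'm s this] show ?thesis
    unfolding v'_def G'_def .
qed

text \<open>For positive \<open>\<delta>\<close> a \<open>C1\<close> approximation of the positive
  part from below, zero exactly for s \<le> 0. Squaring the positive part removes the kink;
  subtracting \<open>\<delta>\<close> restores the value zero, so that compositions keep compact
  supports.\<close>

definition soft_pos :: "real \<Rightarrow> real \<Rightarrow> real" where
  "soft_pos \<delta> s = sqrt ((max 0 s)\<^sup>2 + \<delta>\<^sup>2) - \<delta>"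

text \<open>The derivative of \<open>soft_pos\<close>. It vanishes for s \<le> 0 whatever
  \<open>\<delta>\<close> is, so its limit is the indicator of s > 0, with the value zero at the
  kink.\<close>

definition soft_step :: "real \<Rightarrow> real \<Rightarrow> real" where
  "soft_step \<delta> s = smooth_sign \<delta> (max 0 s)"

lemma has_derivative_soft_pos:
  assumes "\<delta> > 0" shows "(soft_pos \<delta> has_real_derivative soft_step \<delta> s) (at s)"
proof -
  have pos: "(max 0 s)\<^sup>2 + \<delta>\<^sup>2 > 0" using assms by (simp add: add_nonneg_pos)
  have "((\<lambda>s. (max 0 s)\<^sup>2 + \<delta>\<^sup>2) has_real_derivative 2 * max 0 s) (at s)"
    using DERIV_add[OF has_real_derivative_sq_pos_part DERIV_const] by simp
  from DERIV_chain2[OF DERIV_real_sqrt[OF pos] this]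
  have "((\<lambda>s. sqrt ((max 0 s)\<^sup>2 + \<delta>\<^sup>2)) has_real_derivative soft_step \<delta> s) (at s)"
    by (simp add: soft_step_def smooth_sign_def field_simps)
  from DERIV_diff[OF this DERIV_const[of \<delta>]] show ?thesis
    unfolding soft_pos_def[abs_def] by simp
qed

lemma has_derivative_soft_pos_compose:
  assumes "\<delta> > 0" "(g has_derivative g') (at p)"
  shows "((\<lambda>p. soft_pos \<delta> (g p)) has_derivative (\<lambda>q. g' q * soft_step \<delta> (g p))) (at p)"
  by (rule DERIV_compose_FDERIV[where g = g and x = p and s = UNIV and f = "soft_pos \<delta>",
    OF has_derivative_soft_pos[OF assms(1)] assms(2)])

lemma soft_step_bounds: "\<delta> > 0 \<Longrightarrow> 0 \<le> soft_step \<delta> s" "\<delta> > 0 \<Longrightarrow> soft_step \<delta> s \<le> 1"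
  using smooth_sign_bound[of \<delta> "max 0 s"] sqrt_sq_add_pos[of \<delta> "max 0 s"]
  by (auto simp: soft_step_def abs_le_iff smooth_sign_def)

lemma continuous_soft_step: "\<delta> > 0 \<Longrightarrow> continuous_on S (soft_step \<delta>)"
  unfolding soft_step_def[abs_def]
  by (rule continuous_on_compose2[OF C1_continuous[OF C1_smooth_sign]]) (auto intro!: continuous_intros)

lemma continuous_soft_pos: "\<delta> > 0 \<Longrightarrow> continuous_on S (soft_pos \<delta>)"
  unfolding soft_pos_def[abs_def] by (intro continuous_intros)

lemma soft_pos_zero: "\<delta> > 0 \<Longrightarrow> s \<le> 0 \<Longrightarrow> soft_pos \<delta> s = 0"
  by (simp add: soft_pos_def max_def)

lemma soft_step_zero: "s \<le> 0 \<Longrightarrow> soft_step \<delta> s = 0"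
  by (simp add: soft_step_def smooth_sign_def max_def)

lemma soft_pos_nonneg: "\<delta> > 0 \<Longrightarrow> 0 \<le> soft_pos \<delta> s"
  using real_sqrt_le_mono[of "\<delta>\<^sup>2" "(max 0 s)\<^sup>2 + \<delta>\<^sup>2"] by (simp add: soft_pos_def)

lemma soft_pos_ge: "\<delta> > 0 \<Longrightarrow> max 0 s - \<delta> \<le> soft_pos \<delta> s"
  using real_sqrt_le_mono[of "(max 0 s)\<^sup>2" "(max 0 s)\<^sup>2 + \<delta>\<^sup>2"] by (simp add: soft_pos_def)

definition width :: "nat \<Rightarrow> real" where
  "width j = 1 / real (Suc j)"

lemma width_pos: "width j > 0"
  by (simp add: width_def)

lemma width_tendsto: "width \<longlonglongrightarrow> 0"
  unfolding width_def[abs_def] using LIMSEQ_Suc[OF lim_1_over_n] .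

text \<open>The argument may move with \<open>j\<close>, as the nested approximation of the minimum
  requires.\<close>

lemma soft_pos_tendsto:
  assumes "s \<longlonglongrightarrow> s0" shows "(\<lambda>j. soft_pos (width j) (s j)) \<longlonglongrightarrow> max 0 s0"
proof -
  have "(\<lambda>j. soft_pos (width j) (s j)) \<longlonglongrightarrow> sqrt ((max 0 s0)\<^sup>2 + 0\<^sup>2) - 0"
    unfolding soft_pos_def by (intro tendsto_intros assms width_tendsto)
  then show ?thesis by simp
qed

lemma soft_step_tendsto:
  assumes "s \<longlonglongrightarrow> s0" "s0 > 0" shows "(\<lambda>j. soft_step (width j) (s j)) \<longlonglongrightarrow> 1"
proof -
  have "(\<lambda>j. soft_step (width j) (s j)) \<longlonglongrightarrow> max 0 s0 / sqrt ((max 0 s0)\<^sup>2 + 0\<^sup>2)"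
    unfolding soft_step_def smooth_sign_def using assms(2) by (intro tendsto_intros assms width_tendsto) auto
  then show ?thesis using assms(2) by simp
qed

section \<open>Linear combinations, truncation, minimum\<close>

lemma C1c_two_functions:
  fixes \<phi> \<psi> :: "'a::euclidean_space \<Rightarrow> real"
  assumes "C1c V \<phi>" "C1c V \<psi>" "C1 (\<lambda>x. H (\<phi> x) (\<psi> x))" "H 0 0 = (0::real)"
  shows "C1c V (\<lambda>x. H (\<phi> x) (\<psi> x))"
proof (rule C1cI[OF assms(3)])
  show "compact (supp \<phi> \<union> supp \<psi>)" "supp \<phi> \<union> supp \<psi> \<subseteq> V"
    using assms by (auto simp: C1c_iff)
  show "H (\<phi> x) (\<psi> x) = 0" if "x \<notin> supp \<phi> \<union> supp \<psi>" for x
    using that zero_outside_supp[of x \<phi>] zero_outside_supp[of x \<psi>] assms(4) by simp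
qed

text \<open>For the minimum with a function that is supported elsewhere: here the support is
  controlled by the first function alone.\<close>

lemma C1c_left_zero:
  fixes \<phi> \<psi> :: "'a::euclidean_space \<Rightarrow> real"
  assumes "C1c V \<phi>" "C1 (\<lambda>x. H (\<phi> x) (\<psi> x))" "\<And>y. H 0 y = (0::real)"
  shows "C1c V (\<lambda>x. H (\<phi> x) (\<psi> x))"
proof (rule C1cI[OF assms(2)])
  show "compact (supp \<phi>)" "supp \<phi> \<subseteq> V"
    using assms by (auto simp: C1c_iff)
  show "H (\<phi> x) (\<psi> x) = 0" if "x \<notin> supp \<phi>" for x
    using that zero_outside_supp[of x \<phi>] assms(3) by simp
qed

lemma sob_lincomb:
  assumes a: "sob V a A" and b: "sob V b B"
  shows "sob V (\<lambda>x. c * a x + d * b x) (\<lambda>x. c *\<^sub>R A x + d *\<^sub>R B x)"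
proof (rule sob_smooth_compose[OF a b, where H = "\<lambda>x y. c * x + d * y" and Hx = "\<lambda>x y. c" and Hy = "\<lambda>x y. d" and C = "\<bar>c\<bar> + \<bar>d\<bar>"])
  show "((\<lambda>p. c * fst p + d * snd p) has_derivative (\<lambda>q. c * fst q + d * snd q)) (at (x, y))" for x y
    by (auto intro!: derivative_eq_intros)
  show "C1c V (\<lambda>x. c * \<phi> x + d * \<psi> x)" if "C1c V \<phi>" "C1c V \<psi>" "C1 (\<lambda>x. c * \<phi> x + d * \<psi> x)" for \<phi> \<psi>
    by (rule C1c_two_functions[OF that(1,2), where H = "\<lambda>x y. c * x + d * y"]) (use that in auto)
qed auto

text \<open>Because of \<open>c \<ge> 0\<close> the truncation vanishes wherever \<open>a\<close>
  does, so truncated test functions remain test functions on \<open>V\<close>. The cases c = 0 and c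
  = 1 together cut a function to values between 0 and 1.\<close>

lemma sob_pos_part:
  fixes a :: "'a::euclidean_space \<Rightarrow> real"
  assumes a: "sob V a A" and c: "c \<ge> 0"
  shows "sob V (\<lambda>x. max 0 (a x - c)) (\<lambda>x. of_bool (a x > c) *\<^sub>R A x)"
proof -
  \<comment> \<open>The second argument is a dummy, so that the chain rule for two variables applies
    with both functions equal to \<open>a\<close>.\<close>
  have "sob V (\<lambda>x. max 0 (a x - c)) (\<lambda>x. of_bool (a x > c) *\<^sub>R A x + 0 *\<^sub>R A x)"
  proof (rule sob_compose[OF a a, where H = "\<lambda>j x y. soft_pos (width j) (x - c)"
      and Hx = "\<lambda>j x y. soft_step (width j) (x - c)" and Hy = "\<lambda>j x y. 0" and C = 1
      and h = "\<lambda>x y. max 0 (x - c)" and P = "\<lambda>x y. of_bool (x > c)" and Q = "\<lambda>x y. 0"])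
    fix j :: nat and x y :: real
    have "((\<lambda>p::real \<times> real. fst p - c) has_derivative fst) (at (x, y))"
      by (auto intro!: derivative_eq_intros)
    from has_derivative_soft_pos_compose[OF width_pos this, of j]
    show "((\<lambda>p. soft_pos (width j) (fst p - c)) has_derivative (\<lambda>q. soft_step (width j) (x - c) * fst q + 0 * snd q)) (at (x, y))"
      by (simp add: mult.commute)
    show "\<bar>soft_step (width j) (x - c)\<bar> \<le> 1"
      using soft_step_bounds[OF width_pos] by (simp add: abs_of_nonneg)
    show "soft_pos (width j) (0 - c) = 0"
      using c by (intro soft_pos_zero width_pos) simp
    show "(\<lambda>j. soft_pos (width j) (x - c)) \<longlonglongrightarrow> max 0 (x - c)"
      by (rule soft_pos_tendsto[OF tendsto_const])
    show "(\<lambda>j. soft_step (width j) (x - c)) \<longlonglongrightarrow> of_bool (x > c)"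
    proof (cases "x > c")
      case True
      then show ?thesis using soft_step_tendsto[OF tendsto_const, of "x - c"] by simp
    qed (simp add: soft_step_zero)
    show "continuous_on UNIV (\<lambda>p::real \<times> real. soft_step (width j) (fst p - c))"
      by (rule continuous_on_compose2[OF continuous_soft_step[OF width_pos, of UNIV]]) (auto intro!: continuous_intros)
    show "C1c V (\<lambda>x. soft_pos (width j) (\<phi> x - c))" if "C1c V \<phi>" "C1c V \<psi>" "C1 (\<lambda>x. soft_pos (width j) (\<phi> x - c))" for \<phi> \<psi> :: "'a \<Rightarrow> real"
      by (rule C1c_two_functions[OF that(1,2), where H = "\<lambda>x y. soft_pos (width j) (x - c)"])
         (use that c in \<open>auto intro!: soft_pos_zero width_pos\<close>)
  qed auto
  then show ?thesis by simp
qed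

text \<open>Approximating the minimum by functions vanishing for \<open>x = 0\<close> keeps the support in that of
  the first function. The inner approximation errs by at most \<open>width j\<close>, which the shift of the
  outer one absorbs.\<close>

lemma sob_min:
  assumes a: "sob V a A" and b: "sob W b B"
  shows "sob V (\<lambda>x. min (a x) (max 0 (b x)))
    (\<lambda>x. (1 - of_bool (a x > max 0 (b x))) *\<^sub>R A x + of_bool (a x > max 0 (b x) \<and> b x > 0) *\<^sub>R B x)"
proof -
  \<comment> \<open>Writing y+ for the positive part of y, min(x, y+) equals x - (x - y+)+. Both
    positive parts are softened here.\<close>
  define H where "H j x y = x - soft_pos (width j) (x - soft_pos (width j) y - width j)" for j x y
  define s where "s j x y = soft_step (width j) (x - soft_pos (width j) y - width j)" for j x y
  have s01: "0 \<le> s j x y" "s j x y \<le> 1" for j x y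
    unfolding s_def by (rule soft_step_bounds[OF width_pos])+
  have H0: "H j 0 y = 0" for j y
    using soft_pos_nonneg[OF width_pos, of j y] width_pos[of j]
    by (simp add: H_def soft_pos_zero[OF width_pos])
  have arg_c: "continuous_on UNIV (\<lambda>p. fst p - soft_pos (width j) (snd p) - width j)" for j
    by (intro continuous_intros continuous_on_compose2[OF continuous_soft_pos[OF width_pos, of UNIV]]) auto
  have s_c: "continuous_on UNIV (\<lambda>p. s j (fst p) (snd p))" for j
    unfolding s_def by (rule continuous_on_compose2[OF continuous_soft_step[OF width_pos, of UNIV] arg_c]) auto
  have arg_l: "(\<lambda>j. x - soft_pos (width j) y - width j) \<longlonglongrightarrow> x - max 0 y - 0" for x y
    by (intro tendsto_intros soft_pos_tendsto width_tendsto)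
  have sl: "(\<lambda>j. s j x y) \<longlonglongrightarrow> of_bool (x > max 0 y)" for x y
  proof (cases "x > max 0 y")
    case True
    then show ?thesis
      using soft_step_tendsto[OF arg_l, of x y] by (simp add: s_def)
  next
    case False
    have "s j x y = 0" for j
      unfolding s_def using soft_pos_ge[OF width_pos, of y j] False by (intro soft_step_zero) auto
    then have "(\<lambda>j. s j x y) = (\<lambda>j. 0)" by auto
    moreover have "of_bool (x > max 0 y) = (0::real)" using False by (simp only: of_bool_eq)
    ultimately show ?thesis by (simp only: tendsto_const)
  qed
  have "sob V (\<lambda>x. a x - max 0 (a x - max 0 (b x) - 0))
    (\<lambda>x. (1 - of_bool (a x > max 0 (b x))) *\<^sub>R A x + (of_bool (a x > max 0 (b x)) * of_bool (b x > 0)) *\<^sub>R B x)"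
  proof (rule sob_compose[OF a b, where H = H and Hx = "\<lambda>j x y. 1 - s j x y"
      and Hy = "\<lambda>j x y. s j x y * soft_step (width j) y" and C = 1
      and h = "\<lambda>x y. x - max 0 (x - max 0 y - 0)" and P = "\<lambda>x y. 1 - of_bool (x > max 0 y)"
      and Q = "\<lambda>x y. of_bool (x > max 0 y) * of_bool (y > 0)"])
    fix j :: nat and x y :: real
    have "((\<lambda>p::real \<times> real. soft_pos (width j) (snd p)) has_derivative (\<lambda>q. snd q * soft_step (width j) y)) (at (x, y))"
      using has_derivative_soft_pos_compose[OF width_pos bounded_linear_imp_has_derivative[OF bounded_linear_snd], of j "(x, y)"] by simp
    then have "((\<lambda>p::real \<times> real. fst p - soft_pos (width j) (snd p) - width j) has_derivative (\<lambda>q. fst q - snd q * soft_step (width j) y)) (at (x, y))"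
      by (auto intro!: derivative_eq_intros)
    from has_derivative_soft_pos_compose[OF width_pos this, of j]
    have "((\<lambda>p. soft_pos (width j) (fst p - soft_pos (width j) (snd p) - width j)) has_derivative
      (\<lambda>q. (fst q - snd q * soft_step (width j) y) * s j x y)) (at (x, y))"
      by (simp add: s_def)
    from has_derivative_diff[OF bounded_linear_imp_has_derivative[OF bounded_linear_fst] this]
    show "((\<lambda>p. H j (fst p) (snd p)) has_derivative (\<lambda>q. (1 - s j x y) * fst q + s j x y * soft_step (width j) y * snd q)) (at (x, y))"
      unfolding H_def by (rule has_derivative_eq_rhs) (auto simp: algebra_simps)
    show "continuous_on UNIV (\<lambda>p. 1 - s j (fst p) (snd p))"
      by (intro continuous_intros s_c)
    show "continuous_on UNIV (\<lambda>p. s j (fst p) (snd p) * soft_step (width j) (snd p))"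
      by (intro continuous_intros s_c continuous_on_compose2[OF continuous_soft_step[OF width_pos, of UNIV]]) auto
    show "\<bar>1 - s j x y\<bar> \<le> 1"
      using s01[of j x y] by auto
    show "\<bar>s j x y * soft_step (width j) y\<bar> \<le> 1"
      using s01[of j x y] soft_step_bounds[OF width_pos, of j y] by (simp add: abs_mult mult_le_one)
    show "H j 0 0 = 0" by (rule H0)
    show "C1c V (\<lambda>x. H j (\<phi> x) (\<psi> x))" if "C1c V \<phi>" "C1c W \<psi>" "C1 (\<lambda>x. H j (\<phi> x) (\<psi> x))" for \<phi> \<psi>
      by (rule C1c_left_zero[OF that(1,3) H0])
    show "(\<lambda>j. H j x y) \<longlonglongrightarrow> x - max 0 (x - max 0 y - 0)"
      unfolding H_def by (intro tendsto_diff tendsto_const soft_pos_tendsto arg_l)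
    show "(\<lambda>j. 1 - s j x y) \<longlonglongrightarrow> 1 - of_bool (x > max 0 y)"
      by (intro tendsto_intros sl)
    have "(\<lambda>j. soft_step (width j) y) \<longlonglongrightarrow> of_bool (y > 0)"
    proof (cases "y > 0")
      case True
      then show ?thesis using soft_step_tendsto[OF tendsto_const, of y] by simp
    qed (simp add: soft_step_zero)
    then show "(\<lambda>j. s j x y * soft_step (width j) y) \<longlonglongrightarrow> of_bool (x > max 0 y) * of_bool (y > 0)"
      by (intro tendsto_intros sl)
  qed
  moreover have "(\<lambda>x. a x - max 0 (a x - max 0 (b x) - 0)) = (\<lambda>x. min (a x) (max 0 (b x)))"
    by (auto simp: fun_eq_iff min_def max_def)
  ultimately show ?thesis
    by (simp add: of_bool_conj mult.assoc)
qed

lemma sob_homothety: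
  fixes v :: "'a::euclidean_space \<Rightarrow> real"
  assumes s: "sob V v G" and m: "m \<noteq> 0" and VW: "\<And>x. a + m *\<^sub>R x \<in> V \<Longrightarrow> x \<in> W"
  shows "sob W (\<lambda>x. v (a + m *\<^sub>R x)) (\<lambda>x. m *\<^sub>R G (a + m *\<^sub>R x))"
proof -
  note [measurable] = sob_measurable[OF s] measurable_homothety[OF m, of a]
  have [measurable]: "(\<lambda>x. v (a + m *\<^sub>R x)) \<in> borel_measurable lebesgue" "(\<lambda>x. G (a + m *\<^sub>R x)) \<in> borel_measurable lebesgue"
    by measurable
  \<comment> \<open>The numerator accounts for the factor \<open>m\<close> that the gradient picks
    up, the denominator for the change of variables; approximating \<open>v\<close> to within
    \<open>e / K\<close> therefore suffices.\<close>
  define K where "K = (1 + m\<^sup>2) / \<bar>m\<bar> ^ DIM('a)"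
  have K: "K > 0" unfolding K_def using m by (simp add: add_pos_nonneg)
  show ?thesis
    unfolding sob_def
  proof (intro conjI allI impI)
    fix e :: real assume e: "e > 0"
    obtain \<phi> where \<phi>: "C1c V \<phi>" "sdist v G \<phi> (grad \<phi>) < ennreal (e / K)"
      using sobD[OF s divide_pos_pos[OF e K]] by (elim exE conjE)
    note [measurable] = C1c_measurable[OF \<phi>(1)]
    define F where "F x = (v x - \<phi> x)\<^sup>2 + (norm (G x - grad \<phi> x))\<^sup>2" for x
    have [measurable]: "F \<in> borel_measurable lebesgue"
      unfolding F_def by measurable
    have gr: "grad (\<lambda>x. \<phi> (a + m *\<^sub>R x)) x = m *\<^sub>R grad \<phi> (a + m *\<^sub>R x)" for x
      by (rule grad_homothety[OF C1c_C1[OF \<phi>(1)]])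
    have "sdist (\<lambda>x. v (a + m *\<^sub>R x)) (\<lambda>x. m *\<^sub>R G (a + m *\<^sub>R x)) (\<lambda>x. \<phi> (a + m *\<^sub>R x)) (grad (\<lambda>x. \<phi> (a + m *\<^sub>R x)))
      \<le> (\<integral>\<^sup>+x. ennreal (1 + m\<^sup>2) * ennreal (F (a + m *\<^sub>R x)) \<partial>lebesgue)"
      unfolding sdist_def gr
    proof (rule nn_integral_mono)
      fix x
      have "(v y - \<phi> y)\<^sup>2 + (norm (m *\<^sub>R G y - m *\<^sub>R grad \<phi> y))\<^sup>2 \<le> (1 + m\<^sup>2) * F y" for y
      proof -
        have "(norm (m *\<^sub>R G y - m *\<^sub>R grad \<phi> y))\<^sup>2 = m\<^sup>2 * (norm (G y - grad \<phi> y))\<^sup>2"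
          by (simp only: scaleR_diff_right[symmetric] norm_scaleR power_mult_distrib power2_abs)
        then show ?thesis
          by (simp add: F_def distrib_left distrib_right)
      qed
      then show "ennreal ((v (a + m *\<^sub>R x) - \<phi> (a + m *\<^sub>R x))\<^sup>2 + (norm (m *\<^sub>R G (a + m *\<^sub>R x) - m *\<^sub>R grad \<phi> (a + m *\<^sub>R x)))\<^sup>2)
        \<le> ennreal (1 + m\<^sup>2) * ennreal (F (a + m *\<^sub>R x))"
        by (subst ennreal_mult[symmetric]) (auto simp: F_def intro!: ennreal_leI simp del: ennreal_plus)
    qed
    also have "\<dots> = ennreal (1 + m\<^sup>2) * (\<integral>\<^sup>+x. ennreal (F (a + m *\<^sub>R x)) \<partial>lebesgue)"
      by (rule nn_integral_cmult) measurable
    also have "(\<integral>\<^sup>+x. ennreal (F (a + m *\<^sub>R x)) \<partial>lebesgue) = ennreal (1 / \<bar>m\<bar> ^ DIM('a)) * (\<integral>\<^sup>+x. ennreal (F x) \<partial>lebesgue)"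
      using m by (subst nn_integral_homothety[OF m, of "\<lambda>x. ennreal (F x)" a])
        (auto simp: mult.assoc[symmetric] ennreal_mult[symmetric])
    also have "ennreal (1 + m\<^sup>2) * (ennreal (1 / \<bar>m\<bar> ^ DIM('a)) * (\<integral>\<^sup>+x. ennreal (F x) \<partial>lebesgue)) = ennreal K * sdist v G \<phi> (grad \<phi>)"
      by (simp add: sdist_def F_def K_def mult.assoc[symmetric] ennreal_mult[symmetric] del: ennreal_plus)
    also have "\<dots> < ennreal e"
    proof -
      obtain r where r: "sdist v G \<phi> (grad \<phi>) = ennreal r" "0 \<le> r" "r < e / K"
        using \<phi>(2) by (cases "sdist v G \<phi> (grad \<phi>)") (auto simp: ennreal_less_iff)
      then show ?thesis
        using K e by (simp add: ennreal_mult[symmetric] ennreal_less_iff field_simps)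
    qed
    finally show "\<exists>\<phi>. C1c W \<phi> \<and> sdist (\<lambda>x. v (a + m *\<^sub>R x)) (\<lambda>x. m *\<^sub>R G (a + m *\<^sub>R x)) \<phi> (grad \<phi>) < ennreal e"
      using C1c_homothety[OF \<phi>(1) m VW] by blast
  qed measurable
qed

text \<open>Test functions and their gradients vanish outside \<open>V\<close>, so the distance to
  any of them bounds the square integral of \<open>v\<close> and \<open>G\<close> over the
  complement.\<close>

lemma sob_zero_outside:
  assumes s: "sob V v G" and V: "V \<in> sets lebesgue"
  shows "AE x in lebesgue. x \<notin> V \<longrightarrow> v x = 0 \<and> G x = 0"
proof -
  note [measurable] = sob_measurable[OF s] V
  let ?F = "\<lambda>x. indicator (- V) x * ((v x)\<^sup>2 + (norm (G x))\<^sup>2)"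
  have "(\<integral>\<^sup>+x. ennreal (?F x) \<partial>lebesgue) \<le> 0"
  proof (rule ennreal_le_epsilon)
    fix e :: real assume "e > 0"
    then obtain \<phi> where \<phi>: "C1c V \<phi>" "sdist v G \<phi> (grad \<phi>) < ennreal e"
      using sobD[OF s] by blast
    have "?F x \<le> (v x - \<phi> x)\<^sup>2 + (norm (G x - grad \<phi> x))\<^sup>2" for x
    proof (cases "x \<in> V")
      case False
      then show ?thesis using C1c_zero_outside[OF \<phi>(1) False] by simp
    qed simp
    then have "(\<integral>\<^sup>+x. ennreal (?F x) \<partial>lebesgue) \<le> sdist v G \<phi> (grad \<phi>)"
      unfolding sdist_def by (intro nn_integral_mono ennreal_leI)
    then show "(\<integral>\<^sup>+x. ennreal (?F x) \<partial>lebesgue) \<le> 0 + ennreal e"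
      using \<phi>(2) by simp
  qed
  then have "(\<integral>\<^sup>+x. ennreal (?F x) \<partial>lebesgue) = 0" by simp
  then have "AE x in lebesgue. ennreal (?F x) = 0"
    by (subst (asm) nn_integral_0_iff_AE) measurable
  then show ?thesis
    by (rule eventually_mono) (auto simp: ennreal_eq_0_iff indicator_def sum_power2_le_zero_iff split: if_splits)
qed

text \<open>The derivative of \<phi>^2 (x . b) in a coordinate direction b integrates to zero, which
  expresses the integral of \<phi>^2 through the product of \<phi>, x . b and the partial derivative
  of \<phi>. On the support |x . b| \<le> R, and half of \<phi>^2 is absorbed on the left.\<close>

lemma poincare_C1c:
  fixes \<phi> :: "'a::euclidean_space \<Rightarrow> real"
  assumes \<phi>: "C1c (ball 0 R) \<phi>"
  shows "(\<integral>x. (\<phi> x)\<^sup>2 \<partial>lebesgue) \<le> 4 * R\<^sup>2 * (\<integral>x. (norm (grad \<phi> x))\<^sup>2 \<partial>lebesgue)"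
proof -
  have C: "C1 \<phi>" "compact (supp \<phi>)" "supp \<phi> \<subseteq> ball 0 R"
    using \<phi> by (auto simp: C1c_iff)
  have c\<phi>: "continuous_on UNIV \<phi>" "continuous_on UNIV (grad \<phi>)"
    using C C1_continuous C1_grad_continuous by blast+
  note z = zero_outside_supp[of _ \<phi>] grad_zero_outside_supp[of _ \<phi>]
  obtain b :: 'a where b: "b \<in> Basis" using nonempty_Basis by blast
  have i1: "integrable lebesgue (\<lambda>x. (\<phi> x)\<^sup>2)"
    by (rule integrable_compact_support(2)[OF _ C(2)]) (use c\<phi> z in \<open>auto intro!: continuous_intros\<close>)
  have i2: "integrable lebesgue (\<lambda>x. (norm (grad \<phi> x))\<^sup>2)"
    by (rule integrable_compact_support(2)[OF _ C(2)]) (use c\<phi> z in \<open>auto intro!: continuous_intros\<close>)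
  let ?f = "\<lambda>x. (\<phi> x * \<phi> x) * (x \<bullet> b)"
  have f1: "C1 ?f"
    by (intro C1_mult C1_inner C1_const C C1_bounded_linear[OF bounded_linear_ident])
  have fc: "C1c UNIV ?f"
    by (rule C1cI[OF f1 C(2)]) (use z in auto)
  have fd: "(?f has_derivative (\<lambda>h. (2 * \<phi> x * (x \<bullet> b)) * (grad \<phi> x \<bullet> h) + (\<phi> x)\<^sup>2 * (h \<bullet> b))) (at x)" for x
    by (rule has_derivative_eq_rhs[OF has_derivative_mult[OF has_derivative_mult[OF C1_has_grad[OF C(1)] C1_has_grad[OF C(1)]]
        has_derivative_inner_left[OF has_derivative_ident]]])
       (auto simp: fun_eq_iff algebra_simps power2_eq_square)
  have fd': "frechet_derivative ?f (at x) b = 2 * \<phi> x * (x \<bullet> b) * (grad \<phi> x \<bullet> b) + (\<phi> x)\<^sup>2" for x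
    using fun_cong[OF frechet_derivative_at[OF fd, of x], of b] b by (simp add: inner_same_Basis)
  have i3: "integrable lebesgue (\<lambda>x. 2 * \<phi> x * (x \<bullet> b) * (grad \<phi> x \<bullet> b))"
    by (rule integrable_compact_support(2)[OF _ C(2)]) (use c\<phi> z in \<open>auto intro!: continuous_intros\<close>)
  have "(\<integral>x. 2 * \<phi> x * (x \<bullet> b) * (grad \<phi> x \<bullet> b) + (\<phi> x)\<^sup>2 \<partial>lebesgue) = 0"
    using integral_partial_derivative[OF fc, of b] unfolding fd' .
  then have "(\<integral>x. (\<phi> x)\<^sup>2 \<partial>lebesgue) = (\<integral>x. - (2 * \<phi> x * (x \<bullet> b) * (grad \<phi> x \<bullet> b)) \<partial>lebesgue)"
    using i1 i3 by simp
  also have "\<dots> \<le> (\<integral>x. (1/2) * (\<phi> x)\<^sup>2 + 2 * R\<^sup>2 * (norm (grad \<phi> x))\<^sup>2 \<partial>lebesgue)"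
  proof (rule integral_mono)
    fix x
    show "- (2 * \<phi> x * (x \<bullet> b) * (grad \<phi> x \<bullet> b)) \<le> (1/2) * (\<phi> x)\<^sup>2 + 2 * R\<^sup>2 * (norm (grad \<phi> x))\<^sup>2"
    proof (cases "x \<in> supp \<phi>")
      case True
      then have "norm x \<le> R" using C(3) by auto
      then have "\<bar>x \<bullet> b\<bar> \<le> R" using Basis_le_norm[OF b, of x] by linarith
      moreover have "\<bar>grad \<phi> x \<bullet> b\<bar> \<le> norm (grad \<phi> x)" by (rule Basis_le_norm[OF b])
      ultimately have "\<bar>(x \<bullet> b) * (grad \<phi> x \<bullet> b)\<bar> \<le> R * norm (grad \<phi> x)"
        unfolding abs_mult by (intro mult_mono) auto
      then have "((x \<bullet> b) * (grad \<phi> x \<bullet> b))\<^sup>2 \<le> (R * norm (grad \<phi> x))\<^sup>2"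
        by (metis abs_ge_zero power2_abs power_mono)
      \<comment> \<open>The difference of the two sides is half the square of s + 2 t; the weight
        1/2 is what allows the absorption.\<close>
      moreover have "- (2 * s * t) \<le> (1/2) * s\<^sup>2 + 2 * t\<^sup>2" for s t :: real
        using zero_le_power2[of "s + 2 * t"] by (simp add: power2_eq_square algebra_simps)
      from this[of "\<phi> x" "(x \<bullet> b) * (grad \<phi> x \<bullet> b)"]
      have "- (2 * \<phi> x * (x \<bullet> b) * (grad \<phi> x \<bullet> b)) \<le> (1/2) * (\<phi> x)\<^sup>2 + 2 * ((x \<bullet> b) * (grad \<phi> x \<bullet> b))\<^sup>2"
        by (simp add: mult.assoc)
      ultimately show ?thesis
        by (simp add: power_mult_distrib)
    qed (use z in auto)
  qed (use i1 i2 i3 in auto)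
  also have "\<dots> = (1/2) * (\<integral>x. (\<phi> x)\<^sup>2 \<partial>lebesgue) + 2 * R\<^sup>2 * (\<integral>x. (norm (grad \<phi> x))\<^sup>2 \<partial>lebesgue)"
    using i1 i2 by simp
  finally show ?thesis by simp
qed

text \<open>If \<open>G\<close> vanishes, the gradients of the approximating test functions tend to
  zero, by the Poincare inequality so do these functions, and hence \<open>v\<close> is
  zero.\<close>

lemma sob_zero_gradient:
  fixes v :: "'a::euclidean_space \<Rightarrow> real"
  assumes s: "sob (ball 0 R) v G" and 0: "AE x in lebesgue. G x = 0"
  shows "AE x in lebesgue. v x = 0"
proof -
  note [measurable] = sob_measurable[OF s]
  \<comment> \<open>Here 2 is the factor of the distance from \<open>v\<close> to \<phi>, and 8 R^2
    is twice the Poincare constant 4 R^2 for \<phi>.\<close>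
  define K where "K = 2 + 8 * R\<^sup>2"
  have K: "K > 0" by (simp add: K_def add_pos_nonneg)
  have "(\<integral>\<^sup>+x. ennreal ((v x)\<^sup>2) \<partial>lebesgue) \<le> 0"
  proof (rule ennreal_le_epsilon)
    fix e :: real assume e: "e > 0"
    obtain \<phi> where \<phi>: "C1c (ball 0 R) \<phi>" "sdist v G \<phi> (grad \<phi>) < ennreal (e / K)"
      using sobD[OF s divide_pos_pos[OF e K]] by (elim exE conjE)
    note [measurable] = C1c_measurable[OF \<phi>(1)]
    have L2: "integrable lebesgue (\<lambda>x. (\<phi> x)\<^sup>2)" "integrable lebesgue (\<lambda>x. (norm (grad \<phi> x))\<^sup>2)"
      using sob_L2[OF sob_C1c[OF \<phi>(1)]] by auto
    have eq: "sdist v G \<phi> (grad \<phi>) = (\<integral>\<^sup>+x. ennreal ((v x - \<phi> x)\<^sup>2) + ennreal ((norm (grad \<phi> x))\<^sup>2) \<partial>lebesgue)"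
      unfolding sdist_def by (rule nn_integral_cong_AE, use 0 in eventually_elim) simp
    have "(\<integral>\<^sup>+x. ennreal ((v x - \<phi> x)\<^sup>2) \<partial>lebesgue) \<le> sdist v G \<phi> (grad \<phi>)"
      unfolding eq by (rule nn_integral_mono) simp
    then have 1: "(\<integral>\<^sup>+x. ennreal ((v x - \<phi> x)\<^sup>2) \<partial>lebesgue) \<le> ennreal (e / K)"
      using \<phi>(2) by simp
    have "(\<integral>\<^sup>+x. ennreal ((norm (grad \<phi> x))\<^sup>2) \<partial>lebesgue) \<le> sdist v G \<phi> (grad \<phi>)"
      unfolding eq by (rule nn_integral_mono) simp
    then have "(\<integral>\<^sup>+x. ennreal ((norm (grad \<phi> x))\<^sup>2) \<partial>lebesgue) \<le> ennreal (e / K)"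
      using \<phi>(2) by simp
    then have g: "(\<integral>x. (norm (grad \<phi> x))\<^sup>2 \<partial>lebesgue) \<le> e / K"
      using e K by (subst (asm) nn_integral_eq_integral[OF L2(2)]) (auto simp: ennreal_le_iff)
    have "(\<integral>x. (\<phi> x)\<^sup>2 \<partial>lebesgue) \<le> 4 * R\<^sup>2 * (e / K)"
      using order_trans[OF poincare_C1c[OF \<phi>(1)] mult_left_mono[OF g]] by simp
    then have 2: "(\<integral>\<^sup>+x. ennreal ((\<phi> x)\<^sup>2) \<partial>lebesgue) \<le> ennreal (4 * R\<^sup>2 * (e / K))"
      by (subst nn_integral_eq_integral[OF L2(1)]) (auto intro: ennreal_leI)
    have "(\<integral>\<^sup>+x. ennreal ((v x)\<^sup>2) \<partial>lebesgue) \<le> (\<integral>\<^sup>+x. ennreal 2 * ennreal ((v x - \<phi> x)\<^sup>2) + ennreal 2 * ennreal ((\<phi> x)\<^sup>2) \<partial>lebesgue)"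
    proof (rule nn_integral_mono)
      fix x
      show "ennreal ((v x)\<^sup>2) \<le> ennreal 2 * ennreal ((v x - \<phi> x)\<^sup>2) + ennreal 2 * ennreal ((\<phi> x)\<^sup>2)"
        using sq_add_le[of "v x - \<phi> x" "\<phi> x"]
        by (subst ennreal_lincomb) (auto intro!: ennreal_leI simp del: ennreal_plus)
    qed
    also have "\<dots> = ennreal 2 * (\<integral>\<^sup>+x. ennreal ((v x - \<phi> x)\<^sup>2) \<partial>lebesgue) + ennreal 2 * (\<integral>\<^sup>+x. ennreal ((\<phi> x)\<^sup>2) \<partial>lebesgue)"
      by (simp add: nn_integral_add nn_integral_cmult)
    also have "\<dots> \<le> ennreal 2 * ennreal (e / K) + ennreal 2 * ennreal (4 * R\<^sup>2 * (e / K))"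
      by (intro add_mono mult_left_mono 1 2) auto
    also have "\<dots> = ennreal (2 * (e / K) + 2 * (4 * R\<^sup>2 * (e / K)))"
      using e K by (intro ennreal_lincomb) auto
    also have "2 * (e / K) + 2 * (4 * R\<^sup>2 * (e / K)) = e"
    proof -
      have "2 * q + 2 * (4 * R\<^sup>2 * q) = K * q" for q
        by (simp add: K_def algebra_simps)
      from this[of "e / K"] show ?thesis using K by simp
    qed
    finally show "(\<integral>\<^sup>+x. ennreal ((v x)\<^sup>2) \<partial>lebesgue) \<le> 0 + ennreal e" by simp
  qed
  then have "(\<integral>\<^sup>+x. ennreal ((v x)\<^sup>2) \<partial>lebesgue) = 0" by simp
  then have "AE x in lebesgue. ennreal ((v x)\<^sup>2) = 0"
    by (subst (asm) nn_integral_0_iff_AE) measurable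
  then show ?thesis
    by (rule eventually_mono) (simp add: ennreal_eq_0_iff)
qed

section \<open>Weak gradients and the space \<open>H10\<close>\<close>

lemma integrable_mult_L2:
  fixes f g :: "'a \<Rightarrow> real"
  assumes "f \<in> borel_measurable M" "g \<in> borel_measurable M"
    "integrable M (\<lambda>x. (f x)\<^sup>2)" "integrable M (\<lambda>x. (g x)\<^sup>2)"
  shows "integrable M (\<lambda>x. f x * g x)"
proof (rule Bochner_Integration.integrable_bound)
  show "integrable M (\<lambda>x. (f x)\<^sup>2 + (g x)\<^sup>2)"
    using assms by simp
  show "(\<lambda>x. f x * g x) \<in> borel_measurable M"
    using assms by measurable
  have "\<bar>s * t\<bar> \<le> s\<^sup>2 + t\<^sup>2" for s t :: real
  proof -
    have "2 * \<bar>s\<bar> * \<bar>t\<bar> \<le> \<bar>s\<bar>\<^sup>2 + \<bar>t\<bar>\<^sup>2" by (rule sum_squares_bound)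
    moreover have "0 \<le> \<bar>s\<bar> * \<bar>t\<bar>" by simp
    ultimately show ?thesis unfolding abs_mult power2_abs by linarith
  qed
  then show "AE x in M. norm (f x * g x) \<le> norm ((f x)\<^sup>2 + (g x)\<^sup>2)"
    by (intro AE_I2) simp
qed

lemma set_integrable_L2:
  fixes f :: "'a::euclidean_space \<Rightarrow> 'b::euclidean_space"
  assumes [measurable]: "f \<in> borel_measurable lebesgue" and f: "integrable lebesgue (\<lambda>x. (norm (f x))\<^sup>2)" and C: "compact C"
  shows "set_integrable lebesgue C f"
  unfolding set_integrable_def
proof (rule Bochner_Integration.integrable_bound)
  have C': "C \<in> lmeasurable" using C by (rule lmeasurable_compact)
  then have [measurable]: "C \<in> sets lebesgue" by auto
  show "integrable lebesgue (\<lambda>x. indicator C x + (norm (f x))\<^sup>2)"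
    using f C' by (auto simp: lmeasurable_iff_integrable)
  show "(\<lambda>x. indicator C x *\<^sub>R f x) \<in> borel_measurable lebesgue"
    by measurable
  have "s \<le> 1 + s\<^sup>2" for s :: real
    using zero_le_power2[of "s - 1/2"] by (simp add: power2_eq_square algebra_simps)
  then show "AE x in lebesgue. norm (indicator C x *\<^sub>R f x) \<le> norm (indicator C x + (norm (f x))\<^sup>2)"
    by (intro AE_I2) (auto simp: indicator_def)
qed

lemma divergence_scaleR_Basis:
  fixes \<psi> :: "'a::euclidean_space \<Rightarrow> real"
  assumes "C1 \<psi>" shows "divergence (\<lambda>x. \<psi> x *\<^sub>R b) x = grad \<psi> x \<bullet> b"
proof -
  have "frechet_derivative (\<lambda>x::'a. b) (at x) = (\<lambda>h. 0)"
    by (rule frechet_derivative_at[symmetric]) (rule has_derivative_const)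
  then have "divergence (\<lambda>x::'a. b) x = 0"
    by (simp add: divergence_def)
  then show ?thesis
    using divergence_scaleR[OF assms C1_const[of b], of x] by simp
qed

text \<open>The identity is exact for a test function in place of \<open>v\<close>, so the defect
  \<open>I\<close> can be written with the differences v - \<phi> and G - grad \<phi> only. A
  weighted Young inequality bounds it by the distance to \<phi> and the norm \<open>N\<close> of
  \<psi>.\<close>

lemma sob_by_parts:
  fixes v :: "'a::euclidean_space \<Rightarrow> real"
  assumes s: "sob U v G" and \<psi>: "C1c U \<psi>" and b: "b \<in> Basis"
  shows "(\<integral>x. v x * (grad \<psi> x \<bullet> b) \<partial>lebesgue) = - (\<integral>x. \<psi> x * (G x \<bullet> b) \<partial>lebesgue)"
    and "integrable lebesgue (\<lambda>x. v x * (grad \<psi> x \<bullet> b))" "integrable lebesgue (\<lambda>x. \<psi> x * (G x \<bullet> b))"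
proof -
  note [measurable] = sob_measurable[OF s] C1c_measurable[OF \<psi>]
  have L2: "integrable lebesgue (\<lambda>x. (f x)\<^sup>2)"
    if "integrable lebesgue (\<lambda>x. (norm (F x))\<^sup>2)" and [measurable]: "F \<in> borel_measurable lebesgue" and "f = (\<lambda>x. F x \<bullet> b)"
    for f and F :: "'a \<Rightarrow> 'a"
  proof (rule Bochner_Integration.integrable_bound[OF that(1)])
    show "(\<lambda>x. (f x)\<^sup>2) \<in> borel_measurable lebesgue" unfolding that(3) by measurable
    show "AE x in lebesgue. norm ((f x)\<^sup>2) \<le> norm ((norm (F x))\<^sup>2)"
      using Basis_le_norm[OF b] by (intro AE_I2) (simp add: that(3) abs_le_square_iff[symmetric])
  qed
  have L2\<psi>: "integrable lebesgue (\<lambda>x. (\<psi> x)\<^sup>2)" "integrable lebesgue (\<lambda>x. (grad \<psi> x \<bullet> b)\<^sup>2)"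
    using sob_L2[OF sob_C1c[OF \<psi>]] by (auto intro: L2)
  have L2v: "integrable lebesgue (\<lambda>x. (v x)\<^sup>2)" "integrable lebesgue (\<lambda>x. (G x \<bullet> b)\<^sup>2)"
    using sob_L2[OF s] by (auto intro: L2)
  show i: "integrable lebesgue (\<lambda>x. v x * (grad \<psi> x \<bullet> b))" "integrable lebesgue (\<lambda>x. \<psi> x * (G x \<bullet> b))"
    by (rule integrable_mult_L2; use L2\<psi> L2v in simp)+
  define I where "I = (\<integral>x. v x * (grad \<psi> x \<bullet> b) \<partial>lebesgue) + (\<integral>x. \<psi> x * (G x \<bullet> b) \<partial>lebesgue)"
  have iN: "integrable lebesgue (\<lambda>x. (grad \<psi> x \<bullet> b)\<^sup>2 + (\<psi> x)\<^sup>2)"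
    using L2\<psi> by simp
  define N where "N = (\<integral>x. (grad \<psi> x \<bullet> b)\<^sup>2 + (\<psi> x)\<^sup>2 \<partial>lebesgue)"
  have N: "N \<ge> 0" unfolding N_def by simp
  \<comment> \<open>The free weight \<open>t\<close> makes the term with \<open>N\<close> small; the
    accuracy \<open>e\<close> is adjusted to \<open>t\<close> afterwards.\<close>
  have key: "\<bar>I\<bar> \<le> t / 2 * e + N / (2 * t)" if t: "t > 0" and e: "e > 0" for t e
  proof -
    obtain \<phi> where \<phi>: "C1c U \<phi>" "sdist v G \<phi> (grad \<phi>) < ennreal e"
      using sobD[OF s e] by (elim exE conjE)
    note [measurable] = C1c_measurable[OF \<phi>(1)]
    let ?F = "\<lambda>x. (v x - \<phi> x)\<^sup>2 + (norm (G x - grad \<phi> x))\<^sup>2"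
    have iF: "integrable lebesgue ?F"
      using less_trans[OF \<phi>(2) ennreal_less_top] by (intro integrableI_bounded) (simp_all add: sdist_def del: ennreal_plus)
    then have "sdist v G \<phi> (grad \<phi>) = ennreal (\<integral>x. ?F x \<partial>lebesgue)"
      unfolding sdist_def by (intro nn_integral_eq_integral) auto
    then have F: "(\<integral>x. ?F x \<partial>lebesgue) \<le> e"
      using \<phi>(2) e by (simp add: ennreal_less_iff)
    have c: "C1c UNIV (\<lambda>x. \<psi> x *\<^sub>R b)"
    proof (rule C1cI)
      show "C1 (\<lambda>x. \<psi> x *\<^sub>R b)" by (intro C1_scaleR C1_const C1c_C1[OF \<psi>])
      show "compact (supp \<psi>)" using \<psi> by (simp add: C1c_iff)
      show "\<psi> x *\<^sub>R b = 0" if "x \<notin> supp \<psi>" for x using zero_outside_supp[OF that] by simp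
    qed simp
    note p = integral_by_parts[OF C1c_C1[OF \<phi>(1)] c, unfolded divergence_scaleR_Basis[OF C1c_C1[OF \<psi>]]]
    have I_eq: "I = (\<integral>x. (v x * (grad \<psi> x \<bullet> b) + \<psi> x * (G x \<bullet> b)) - (\<phi> x * (grad \<psi> x \<bullet> b) + grad \<phi> x \<bullet> (\<psi> x *\<^sub>R b)) \<partial>lebesgue)"
      unfolding I_def using i p by simp
    have "\<bar>I\<bar> \<le> (\<integral>x. t / 2 * ?F x + (1 / (2 * t)) * ((grad \<psi> x \<bullet> b)\<^sup>2 + (\<psi> x)\<^sup>2) \<partial>lebesgue)"
      unfolding real_norm_def[symmetric] I_eq
    proof (rule Bochner_Integration.integral_norm_bound_integral)
      show "integrable lebesgue (\<lambda>x. (v x * (grad \<psi> x \<bullet> b) + \<psi> x * (G x \<bullet> b)) - (\<phi> x * (grad \<psi> x \<bullet> b) + grad \<phi> x \<bullet> (\<psi> x *\<^sub>R b)))"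
        using i p by simp
      show "integrable lebesgue (\<lambda>x. t / 2 * ?F x + (1 / (2 * t)) * ((grad \<psi> x \<bullet> b)\<^sup>2 + (\<psi> x)\<^sup>2))"
        by (rule Bochner_Integration.integrable_add[OF integrable_mult_right[OF iF] integrable_mult_right[OF iN]])
      fix x
      have y: "\<bar>r * q\<bar> \<le> t / 2 * r\<^sup>2 + (1 / (2 * t)) * q\<^sup>2" for r q :: real
      proof -
        have "2 * (sqrt t * \<bar>r\<bar>) * (\<bar>q\<bar> / sqrt t) \<le> (sqrt t * \<bar>r\<bar>)\<^sup>2 + (\<bar>q\<bar> / sqrt t)\<^sup>2"
          by (rule sum_squares_bound)
        then show ?thesis
          using t by (simp add: power_mult_distrib power_divide abs_mult field_simps)
      qed
      have "\<bar>(G x - grad \<phi> x) \<bullet> b\<bar>\<^sup>2 \<le> (norm (G x - grad \<phi> x))\<^sup>2"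
        by (intro power_mono Basis_le_norm b) simp
      then have g: "t / 2 * ((G x - grad \<phi> x) \<bullet> b)\<^sup>2 \<le> t / 2 * (norm (G x - grad \<phi> x))\<^sup>2"
        using t by (intro mult_left_mono) auto
      have "(v x * (grad \<psi> x \<bullet> b) + \<psi> x * (G x \<bullet> b)) - (\<phi> x * (grad \<psi> x \<bullet> b) + grad \<phi> x \<bullet> (\<psi> x *\<^sub>R b))
        = (v x - \<phi> x) * (grad \<psi> x \<bullet> b) + ((G x - grad \<phi> x) \<bullet> b) * \<psi> x"
        by (simp add: algebra_simps)
      also have "norm \<dots> \<le> \<bar>(v x - \<phi> x) * (grad \<psi> x \<bullet> b)\<bar> + \<bar>((G x - grad \<phi> x) \<bullet> b) * \<psi> x\<bar>"
        unfolding real_norm_def by (rule abs_triangle_ineq)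
      also have "\<dots> \<le> (t / 2 * (v x - \<phi> x)\<^sup>2 + (1 / (2 * t)) * (grad \<psi> x \<bullet> b)\<^sup>2)
         + (t / 2 * ((G x - grad \<phi> x) \<bullet> b)\<^sup>2 + (1 / (2 * t)) * (\<psi> x)\<^sup>2)"
        by (intro add_mono y)
      also have "\<dots> \<le> t / 2 * ?F x + (1 / (2 * t)) * ((grad \<psi> x \<bullet> b)\<^sup>2 + (\<psi> x)\<^sup>2)"
        using g unfolding distrib_left by linarith
      finally show "norm ((v x * (grad \<psi> x \<bullet> b) + \<psi> x * (G x \<bullet> b)) - (\<phi> x * (grad \<psi> x \<bullet> b) + grad \<phi> x \<bullet> (\<psi> x *\<^sub>R b)))
        \<le> t / 2 * ?F x + (1 / (2 * t)) * ((grad \<psi> x \<bullet> b)\<^sup>2 + (\<psi> x)\<^sup>2)" .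
    qed
    also have "\<dots> = t / 2 * (\<integral>x. ?F x \<partial>lebesgue) + (1 / (2 * t)) * N"
      unfolding N_def
      by (rule trans[OF Bochner_Integration.integral_add[OF integrable_mult_right[OF iF] integrable_mult_right[OF iN]]])
         (simp only: integral_mult_right_zero)
    also have "\<dots> \<le> t / 2 * e + N / (2 * t)"
      using F t by (intro add_mono mult_left_mono) auto
    finally show ?thesis .
  qed
  have "\<bar>I\<bar> \<le> 0"
  proof (rule field_le_epsilon)
    fix e :: real assume e: "e > 0"
    \<comment> \<open>Then t e = N + e, so N / (2 t) is at most e / 2, and accuracy e / t makes the
      other term exactly e / 2. The 1 keeps \<open>t\<close> positive when
      \<open>N = 0\<close>.\<close>
    define t where "t = N / e + 1"
    have t: "t > 0" using N e by (simp add: t_def add_nonneg_pos)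
    have "\<bar>I\<bar> \<le> t / 2 * (e / t) + N / (2 * t)"
      by (rule key[OF t divide_pos_pos[OF e t]])
    also have "t / 2 * (e / t) = e / 2" using t by simp
    also have "N / (2 * t) \<le> e / 2"
      using t e N by (simp add: field_simps t_def)
    finally show "\<bar>I\<bar> \<le> 0 + e" by simp
  qed
  then show "(\<integral>x. v x * (grad \<psi> x \<bullet> b) \<partial>lebesgue) = - (\<integral>x. \<psi> x * (G x \<bullet> b) \<partial>lebesgue)"
    by (simp add: I_def)
qed

lemma sob_weak_gradient:
  fixes v :: "'a::euclidean_space \<Rightarrow> real"
  assumes s: "sob U v G"
  shows "weak_gradient U v G"
  unfolding weak_gradient_def
proof (intro conjI allI impI ballI)
  show "locally_integrable_on v U" "locally_integrable_on G U"
    unfolding locally_integrable_on_def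
    using set_integrable_L2[OF sob_measurable(1)[OF s]] set_integrable_L2[OF sob_measurable(2)[OF s]] sob_L2[OF s] by auto
  fix \<psi> :: "'a \<Rightarrow> real" and b :: 'a assume \<psi>: "C1c U \<psi>" and b: "b \<in> Basis"
  have o: "\<psi> x = 0 \<and> frechet_derivative \<psi> (at x) b = 0" if "x \<notin> U" for x
    using C1c_zero_outside[OF \<psi> that] b by (metis grad_inner_Basis inner_zero_left)
  have "(LINT x:U|lebesgue. v x * frechet_derivative \<psi> (at x) b) = (\<integral>x. v x * (grad \<psi> x \<bullet> b) \<partial>lebesgue)"
    unfolding set_lebesgue_integral_def using o by (intro Bochner_Integration.integral_cong) (auto simp: grad_inner_Basis b indicator_def)
  moreover have "(LINT x:U|lebesgue. \<psi> x * (G x \<bullet> b)) = (\<integral>x. \<psi> x * (G x \<bullet> b) \<partial>lebesgue)"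
    unfolding set_lebesgue_integral_def using o by (intro Bochner_Integration.integral_cong) (auto simp: indicator_def)
  ultimately show "(LINT x:U|lebesgue. v x * frechet_derivative \<psi> (at x) b) = - (LINT x:U|lebesgue. \<psi> x * (G x \<bullet> b))"
    using sob_by_parts(1)[OF s \<psi> b] by simp
qed

text \<open>The fundamental lemma is applied to each component of the difference. Local
  integrability suffices for splitting the integral, because test functions are bounded with compact
  support.\<close>

lemma weak_gradient_unique:
  fixes v :: "'a::euclidean_space \<Rightarrow> real"
  assumes w: "weak_gradient (ball a R) v G" "weak_gradient (ball a R) v G'"
  shows "AE x in lebesgue. x \<in> ball a R \<longrightarrow> G x = G' x"
proof -
  have li: "locally_integrable_on G (ball a R)" "locally_integrable_on G' (ball a R)"
    using w by (auto simp: weak_gradient_def)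
  have ae: "AE x in lebesgue. x \<in> ball a R \<longrightarrow> (G x - G' x) \<bullet> b = 0" if b: "b \<in> Basis" for b
  proof (rule fundamental_lemma)
    show "locally_integrable_on (\<lambda>x. (G x - G' x) \<bullet> b) (ball a R)"
      unfolding locally_integrable_on_def set_integrable_def
    proof (intro allI impI)
      fix C assume C: "compact C \<and> C \<subseteq> ball a R"
      then have "integrable lebesgue (\<lambda>x. indicator C x *\<^sub>R G x)" "integrable lebesgue (\<lambda>x. indicator C x *\<^sub>R G' x)"
        using li by (auto simp: locally_integrable_on_def set_integrable_def)
      then have "integrable lebesgue (\<lambda>x. (indicator C x *\<^sub>R G x - indicator C x *\<^sub>R G' x) \<bullet> b)"
        by (intro integrable_inner_left Bochner_Integration.integrable_diff)
      then show "integrable lebesgue (\<lambda>x. indicator C x *\<^sub>R ((G x - G' x) \<bullet> b))"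
        by (simp add: inner_diff_left right_diff_distrib)
    qed
    fix \<phi> :: "'a \<Rightarrow> real" assume \<phi>: "C1c (ball a R) \<phi>"
    have C: "compact (supp \<phi>)" "supp \<phi> \<subseteq> ball a R"
      using \<phi> by (auto simp: C1c_iff)
    obtain B where B: "\<forall>x. norm (\<phi> x) \<le> B"
      using C1c_bounded[OF \<phi>] by blast
    have int: "integrable lebesgue (\<lambda>x. indicator (ball a R) x *\<^sub>R (\<phi> x * (F x \<bullet> b)))"
      if F: "locally_integrable_on F (ball a R)" for F :: "'a \<Rightarrow> 'a"
    proof -
      have "integrable lebesgue (\<lambda>x. indicator (supp \<phi>) x *\<^sub>R F x)"
        using F C by (auto simp: locally_integrable_on_def set_integrable_def)
      then have "integrable lebesgue (\<lambda>x. (indicator (supp \<phi>) x *\<^sub>R F x) \<bullet> b)"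
        by (rule integrable_inner_left)
      from integrable_bounded_mult[OF this, of \<phi> B] B C1c_measurable(1)[OF \<phi>]
      have "integrable lebesgue (\<lambda>x. ((indicator (supp \<phi>) x *\<^sub>R F x) \<bullet> b) *\<^sub>R \<phi> x)"
        by blast
      also have "(\<lambda>x. ((indicator (supp \<phi>) x *\<^sub>R F x) \<bullet> b) *\<^sub>R \<phi> x) = (\<lambda>x. indicator (ball a R) x *\<^sub>R (\<phi> x * (F x \<bullet> b)))"
      proof
        fix x show "((indicator (supp \<phi>) x *\<^sub>R F x) \<bullet> b) *\<^sub>R \<phi> x = indicator (ball a R) x *\<^sub>R (\<phi> x * (F x \<bullet> b))"
          using C(2) zero_outside_supp[of x \<phi>] by (cases "x \<in> supp \<phi>") (auto simp: indicator_def)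
      qed
      finally show ?thesis .
    qed
    have "(LINT x:ball a R|lebesgue. \<phi> x * (G x \<bullet> b)) = (LINT x:ball a R|lebesgue. \<phi> x * (G' x \<bullet> b))"
      using w[unfolded weak_gradient_def, THEN conjunct2, THEN conjunct2, rule_format, OF \<phi> b] by simp
    moreover have "(LINT x:ball a R|lebesgue. \<phi> x * ((G x - G' x) \<bullet> b))
      = (LINT x:ball a R|lebesgue. \<phi> x * (G x \<bullet> b)) - (LINT x:ball a R|lebesgue. \<phi> x * (G' x \<bullet> b))"
      unfolding set_lebesgue_integral_def
      by (subst Bochner_Integration.integral_diff[symmetric, OF int[OF li(1)] int[OF li(2)]])
         (auto intro!: Bochner_Integration.integral_cong simp: inner_diff_left algebra_simps)
    ultimately show "(LINT x:ball a R|lebesgue. \<phi> x * ((G x - G' x) \<bullet> b)) = 0"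
      by simp
  qed
  have "AE x in lebesgue. \<forall>b\<in>Basis. x \<in> ball a R \<longrightarrow> (G x - G' x) \<bullet> b = 0"
    by (rule AE_finite_allI) (use ae in auto)
  then show ?thesis
    by (rule eventually_mono) (auto simp: euclidean_eq_iff[of "G _"] inner_diff_left)
qed

section \<open>Passage between \<open>H10\<close> and the closure of the test functions\<close>

lemma norm_powr_two: "norm x powr 2 = (norm x)\<^sup>2"
  by (simp add: powr_numeral)

text \<open>The link between the gradient selected by Hilbert choice and the explicit one: both are
  weak gradients, and these are unique up to a null set.\<close>

lemma wgrad_AE_eq:
  fixes v :: "'a::euclidean_space \<Rightarrow> real"
  assumes s: "sob (ball 0 R) v G"
  shows "AE x in lebesgue. x \<in> ball 0 R \<longrightarrow> wgrad (ball 0 R) v x = G x"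
proof -
  have "weak_gradient (ball 0 R) v (wgrad (ball 0 R) v)"
    unfolding wgrad_def by (rule someI[where P = "weak_gradient (ball 0 R) v", OF sob_weak_gradient[OF s]])
  from weak_gradient_unique[OF this sob_weak_gradient[OF s]] show ?thesis .
qed

lemma wgrad_indicator_AE_eq:
  fixes v :: "'a::euclidean_space \<Rightarrow> real"
  assumes s: "sob (ball 0 R) v G"
  shows "AE x in lebesgue. indicator (ball 0 R) x *\<^sub>R wgrad (ball 0 R) v x = G x"
proof -
  have "ball 0 R \<in> sets lebesgue" by simp
  from wgrad_AE_eq[OF s] sob_zero_outside[OF s this] show ?thesis
  proof eventually_elim
    case (elim x)
    then show ?case by (cases "x \<in> ball 0 R") auto
  qed
qed

text \<open>The indicator is there because nothing is known about \<open>wgrad\<close> outside the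
  ball, whereas gradients in \<open>sob\<close> are measured on the whole space.\<close>

lemma H10_imp_sob:
  fixes v :: "'a::euclidean_space \<Rightarrow> real"
  assumes v: "v \<in> H10 (ball 0 R)"
  shows "sob (ball 0 R) v (\<lambda>x. indicator (ball 0 R) x *\<^sub>R wgrad (ball 0 R) v x)"
proof -
  let ?U = "ball 0 R :: 'a set"
  define G where "G x = indicator ?U x *\<^sub>R wgrad ?U v x" for x
  have z: "v x = 0" if "x \<notin> ?U" for x
    using v that by (simp add: H10_def)
  have Lp: "Lp_on 2 ?U v" "Lp_on 2 ?U (wgrad ?U v)"
    using v by (auto simp: H10_def sobolev_W1_def)
  have v_eq: "(\<lambda>x. indicator ?U x *\<^sub>R v x) = v"
    using z by (auto simp: indicator_def fun_eq_iff)
  have vm[measurable]: "v \<in> borel_measurable lebesgue"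
    using Lp(1) v_eq by (simp add: Lp_on_def set_borel_measurable_def)
  have Gm[measurable]: "G \<in> borel_measurable lebesgue"
    using Lp(2) by (simp add: Lp_on_def set_borel_measurable_def G_def[abs_def])
  have "(\<lambda>x. indicator ?U x *\<^sub>R (norm (v x) powr 2)) = (\<lambda>x. (v x)\<^sup>2)"
    using z by (auto simp: indicator_def fun_eq_iff norm_powr_two simp del: real_norm_def) (simp_all add: norm_powr_two)
  then have v2: "integrable lebesgue (\<lambda>x. (v x)\<^sup>2)"
    using Lp(1) by (simp add: Lp_on_def set_integrable_def)
  have "(\<lambda>x. indicator ?U x *\<^sub>R (norm (wgrad ?U v x) powr 2)) = (\<lambda>x. (norm (G x))\<^sup>2)"
    by (auto simp: indicator_def fun_eq_iff norm_powr_two G_def)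
  then have G2: "integrable lebesgue (\<lambda>x. (norm (G x))\<^sup>2)"
    using Lp(2) by (simp add: Lp_on_def set_integrable_def)
  have "sob ?U v G"
    unfolding sob_def
  proof (intro conjI vm Gm allI impI)
    fix e :: real assume e: "e > 0"
    then obtain \<phi> where \<phi>: "C1c ?U \<phi>"
      "(LINT x:?U|lebesgue. (v x - \<phi> x)\<^sup>2) + (LINT x:?U|lebesgue. (norm (wgrad ?U v x - grad \<phi> x))\<^sup>2) < e"
      using v unfolding H10_def by blast
    note [measurable] = C1c_measurable[OF \<phi>(1)]
    note o = C1c_zero_outside[OF \<phi>(1)]
    have 1: "(LINT x:?U|lebesgue. (v x - \<phi> x)\<^sup>2) = (\<integral>x. (v x - \<phi> x)\<^sup>2 \<partial>lebesgue)"
      unfolding set_lebesgue_integral_def using o z by (intro Bochner_Integration.integral_cong) (auto simp: indicator_def)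
    have 2: "(LINT x:?U|lebesgue. (norm (wgrad ?U v x - grad \<phi> x))\<^sup>2) = (\<integral>x. (norm (G x - grad \<phi> x))\<^sup>2 \<partial>lebesgue)"
      unfolding set_lebesgue_integral_def using o by (intro Bochner_Integration.integral_cong) (auto simp: indicator_def G_def)
    note \<phi>L2 = sob_L2[OF sob_C1c[OF \<phi>(1)]]
    \<comment> \<open>Integrability has to be established first: the Bochner integral of a function
      that is not integrable is 0, so small integrals alone would not bound
      \<open>sdist\<close>.\<close>
    have i1: "integrable lebesgue (\<lambda>x. (v x - \<phi> x)\<^sup>2)"
    proof (rule Bochner_Integration.integrable_bound)
      show "integrable lebesgue (\<lambda>x. 2 * (v x)\<^sup>2 + 2 * (\<phi> x)\<^sup>2)" using v2 \<phi>L2 by simp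
      show "AE x in lebesgue. norm ((v x - \<phi> x)\<^sup>2) \<le> norm (2 * (v x)\<^sup>2 + 2 * (\<phi> x)\<^sup>2)"
        using sq_add_le[of "v x" "- \<phi> x" for x] by (intro AE_I2) simp
    qed measurable
    have i2: "integrable lebesgue (\<lambda>x. (norm (G x - grad \<phi> x))\<^sup>2)"
    proof (rule Bochner_Integration.integrable_bound)
      show "integrable lebesgue (\<lambda>x. 2 * (norm (G x))\<^sup>2 + 2 * (norm (grad \<phi> x))\<^sup>2)" using G2 \<phi>L2 by simp
      show "AE x in lebesgue. norm ((norm (G x - grad \<phi> x))\<^sup>2) \<le> norm (2 * (norm (G x))\<^sup>2 + 2 * (norm (grad \<phi> x))\<^sup>2)"
        using sq_norm_add_le[of "G x" "- grad \<phi> x" for x] by (intro AE_I2) simp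
    qed measurable
    have "sdist v G \<phi> (grad \<phi>) = ennreal (\<integral>x. (v x - \<phi> x)\<^sup>2 + (norm (G x - grad \<phi> x))\<^sup>2 \<partial>lebesgue)"
      unfolding sdist_def using i1 i2 by (intro nn_integral_eq_integral) auto
    also have "\<dots> < ennreal e"
      using \<phi>(2) i1 i2 e unfolding 1 2 by (intro ennreal_lessI) auto
    finally show "\<exists>\<phi>. C1c ?U \<phi> \<and> sdist v G \<phi> (grad \<phi>) < ennreal e"
      using \<phi>(1) by blast
  qed
  then show ?thesis unfolding G_def .
qed

lemma sob_imp_H10:
  fixes v :: "'a::euclidean_space \<Rightarrow> real"
  assumes s: "sob (ball 0 R) v G" and z: "\<And>x. x \<notin> ball 0 R \<Longrightarrow> v x = 0"
  shows "v \<in> H10 (ball 0 R)"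
proof -
  let ?U = "ball 0 R :: 'a set"
  let ?W = "\<lambda>x. indicator ?U x *\<^sub>R wgrad ?U v x"
  note m[measurable] = sob_measurable[OF s]
  have ae: "AE x in lebesgue. ?W x = G x" by (rule wgrad_indicator_AE_eq[OF s])
  \<comment> \<open>As an arbitrary choice \<open>wgrad\<close> is measurable only because it equals
    \<open>G\<close> almost everywhere and Lebesgue measure is complete.\<close>
  have Wm[measurable]: "?W \<in> borel_measurable lebesgue"
  proof -
    have "AE x in lebesgue. G x = ?W x" using ae by (rule eventually_mono) simp
    then show ?thesis
      by (rule borel_measurable_AE[OF m(2)])
  qed
  have v_eq: "(\<lambda>x. indicator ?U x *\<^sub>R v x) = v"
    using z by (auto simp: indicator_def fun_eq_iff)
  have "(\<lambda>x. indicator ?U x *\<^sub>R (norm (v x) powr 2)) = (\<lambda>x. (v x)\<^sup>2)"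
    using z by (auto simp: indicator_def fun_eq_iff norm_powr_two simp del: real_norm_def) (simp_all add: norm_powr_two)
  then have L1: "Lp_on 2 ?U v"
    unfolding Lp_on_def set_borel_measurable_def set_integrable_def v_eq using m(1) sob_L2(1)[OF s] by simp
  have "integrable lebesgue (\<lambda>x. (norm (?W x))\<^sup>2)"
  proof (subst integrable_cong_AE[where g = "\<lambda>x. (norm (G x))\<^sup>2"])
    show "AE x in lebesgue. (norm (?W x))\<^sup>2 = (norm (G x))\<^sup>2" using ae by (rule eventually_mono) simp
    show "(\<lambda>x. (norm (?W x))\<^sup>2) \<in> borel_measurable lebesgue"
      by (rule borel_measurable_power[OF measurable_compose[OF Wm borel_measurable_norm]])
  qed (use sob_L2(2)[OF s] in simp_all)
  moreover have "(\<lambda>x. indicator ?U x *\<^sub>R (norm (wgrad ?U v x) powr 2)) = (\<lambda>x. (norm (?W x))\<^sup>2)"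
    by (auto simp: indicator_def fun_eq_iff norm_powr_two)
  ultimately have L2: "Lp_on 2 ?U (wgrad ?U v)"
    unfolding Lp_on_def set_borel_measurable_def set_integrable_def using Wm by simp
  have "\<exists>\<phi>. C1c ?U \<phi> \<and> (LINT x:?U|lebesgue. (v x - \<phi> x)\<^sup>2) + (LINT x:?U|lebesgue. (norm (wgrad ?U v x - grad \<phi> x))\<^sup>2) < e"
    if e: "e > 0" for e
  proof -
    obtain \<phi> where \<phi>: "C1c ?U \<phi>" "sdist v G \<phi> (grad \<phi>) < ennreal e"
      using sobD[OF s e] by (elim exE conjE)
    note [measurable] = C1c_measurable[OF \<phi>(1)]
    note o = C1c_zero_outside[OF \<phi>(1)]
    let ?F = "\<lambda>x. (v x - \<phi> x)\<^sup>2 + (norm (G x - grad \<phi> x))\<^sup>2"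
    have iF: "integrable lebesgue ?F"
      using less_trans[OF \<phi>(2) ennreal_less_top] by (intro integrableI_bounded) (simp_all add: sdist_def del: ennreal_plus)
    have i1: "integrable lebesgue (\<lambda>x. (v x - \<phi> x)\<^sup>2)" and i2: "integrable lebesgue (\<lambda>x. (norm (G x - grad \<phi> x))\<^sup>2)"
      by (rule Bochner_Integration.integrable_bound[OF iF]; (measurable; fail | (intro AE_I2, simp)))+
    have 1: "(LINT x:?U|lebesgue. (v x - \<phi> x)\<^sup>2) = (\<integral>x. (v x - \<phi> x)\<^sup>2 \<partial>lebesgue)"
      unfolding set_lebesgue_integral_def using o z by (intro Bochner_Integration.integral_cong) (auto simp: indicator_def)
    have "(LINT x:?U|lebesgue. (norm (wgrad ?U v x - grad \<phi> x))\<^sup>2) = (\<integral>x. (norm (?W x - grad \<phi> x))\<^sup>2 \<partial>lebesgue)"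
      unfolding set_lebesgue_integral_def using o by (intro Bochner_Integration.integral_cong) (auto simp: indicator_def)
    also have "\<dots> = (\<integral>x. (norm (G x - grad \<phi> x))\<^sup>2 \<partial>lebesgue)"
    proof (rule integral_cong_AE)
      show "AE x in lebesgue. (norm (?W x - grad \<phi> x))\<^sup>2 = (norm (G x - grad \<phi> x))\<^sup>2" using ae by (rule eventually_mono) simp
      show "(\<lambda>x. (norm (?W x - grad \<phi> x))\<^sup>2) \<in> borel_measurable lebesgue"
        by (rule borel_measurable_power[OF measurable_compose[OF borel_measurable_diff[OF Wm C1c_measurable(2)[OF \<phi>(1)]] borel_measurable_norm]])
    qed measurable
    finally have "(LINT x:?U|lebesgue. (v x - \<phi> x)\<^sup>2) + (LINT x:?U|lebesgue. (norm (wgrad ?U v x - grad \<phi> x))\<^sup>2) = (\<integral>x. ?F x \<partial>lebesgue)"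
      using 1 i1 i2 by simp
    moreover have "sdist v G \<phi> (grad \<phi>) = ennreal (\<integral>x. ?F x \<partial>lebesgue)"
      unfolding sdist_def using iF by (intro nn_integral_eq_integral) auto
    ultimately show ?thesis
      using \<phi> e by (auto simp: ennreal_less_iff)
  qed
  then show ?thesis
    using L1 L2 z sob_weak_gradient[OF s] by (auto simp: H10_def sobolev_W1_def)
qed

text \<open>Taken over the whole space, so that a homothety changes it by a constant factor only;
  for gradients of functions in the closure on the ball, the outer part contributes nothing.\<close>

definition dirichlet :: "real \<Rightarrow> ('a::euclidean_space \<Rightarrow> 'a) \<Rightarrow> ennreal" where
  "dirichlet p G = (\<integral>\<^sup>+x. ennreal (norm (G x) powr p) \<partial>lebesgue)"

lemma energy_eq:
  fixes v :: "'a::euclidean_space \<Rightarrow> real"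
  assumes s: "sob (ball 0 R) v G" and p: "p > 0"
  shows "energy p R v = dirichlet p G + perimeter {x. v x > 0}"
proof -
  have "(\<integral>\<^sup>+x\<in>ball 0 R. ennreal (norm (wgrad (ball 0 R) v x) powr p) \<partial>lebesgue) = dirichlet p G"
    unfolding dirichlet_def
  proof (rule nn_integral_cong_AE)
    show "AE x in lebesgue. ennreal (norm (wgrad (ball 0 R) v x) powr p) * indicator (ball 0 R) x = ennreal (norm (G x) powr p)"
      using wgrad_indicator_AE_eq[OF s] by (rule eventually_mono) (use p in \<open>auto simp: indicator_def split: if_splits\<close>)
  qed
  then show ?thesis
    by (simp add: energy_def)
qed

section \<open>The constraint\<close>

lemma lebesgue_average_tendsto:
  fixes g :: "'a::euclidean_space \<Rightarrow> real"
  assumes [measurable]: "g \<in> borel_measurable lebesgue" and cont: "isCont g x"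
  shows "((\<lambda>r. (LINT y:ball x r|lebesgue. g y) / measure lebesgue (ball x r)) \<longlongrightarrow> g x) (at_right 0)"
proof (rule tendstoI)
  fix e :: real assume e: "e > 0"
  obtain d where d: "d > 0" "\<forall>y. dist y x < d \<longrightarrow> dist (g y) (g x) < e / 2"
    using cont[unfolded continuous_at_eps_delta, rule_format, of "e / 2"] e by auto
  have "\<forall>\<^sub>F r in at_right 0. r \<in> {0<..<d}"
    by (rule eventually_at_right_real[OF d(1)])
  then show "\<forall>\<^sub>F r in at_right 0. dist ((LINT y:ball x r|lebesgue. g y) / measure lebesgue (ball x r)) (g x) < e"
  proof (rule eventually_mono)
    fix r assume r: "r \<in> {0<..<d}"
    let ?M = "measure lebesgue (ball x r)"
    have M: "?M > 0"
      using content_ball_pos[of r x] r by simp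
    have [measurable]: "ball x r \<in> sets lebesgue" by simp
    have i1: "integrable lebesgue (\<lambda>y. indicator (ball x r) y :: real)"
      using lmeasurable_iff_integrable lmeasurable_ball by blast
    have b: "\<bar>g y - g x\<bar> \<le> e / 2" if "y \<in> ball x r" for y
      using d(2) that r by (auto simp: dist_commute dist_real_def less_imp_le)
    have i3: "integrable lebesgue (\<lambda>y. indicator (ball x r) y * (g y - g x))"
    proof (rule Bochner_Integration.integrable_bound)
      show "integrable lebesgue (\<lambda>y. (e / 2) * indicator (ball x r) y)" using i1 by simp
      show "AE y in lebesgue. norm (indicator (ball x r) y * (g y - g x)) \<le> norm ((e / 2) * indicator (ball x r) y)"
        using b e by (intro AE_I2) (auto simp: indicator_def)
    qed measurable
    have M_eq: "(\<integral>y. indicator (ball x r) y \<partial>lebesgue) = ?M"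
      by simp
    have "(LINT y:ball x r|lebesgue. g y) = (\<integral>y. indicator (ball x r) y * (g y - g x) + g x * indicator (ball x r) y \<partial>lebesgue)"
      unfolding set_lebesgue_integral_def by (intro Bochner_Integration.integral_cong) (auto simp: indicator_def)
    also have "\<dots> = (\<integral>y. indicator (ball x r) y * (g y - g x) \<partial>lebesgue) + g x * ?M"
      using i1 i3 M_eq by simp
    finally have "(LINT y:ball x r|lebesgue. g y) / ?M - g x = (\<integral>y. indicator (ball x r) y * (g y - g x) \<partial>lebesgue) / ?M"
      using M by (simp add: field_simps)
    moreover have "\<bar>\<integral>y. indicator (ball x r) y * (g y - g x) \<partial>lebesgue\<bar> \<le> (e / 2) * ?M"
    proof -
      have "norm (\<integral>y. indicator (ball x r) y * (g y - g x) \<partial>lebesgue) \<le> (\<integral>y. (e / 2) * indicator (ball x r) y \<partial>lebesgue)"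
      proof (rule Bochner_Integration.integral_norm_bound_integral[OF i3])
        show "norm (indicator (ball x r) y * (g y - g x)) \<le> (e / 2) * indicator (ball x r) y" for y
          using b e by (auto simp: indicator_def)
      qed (use i1 in simp)
      then show ?thesis using M_eq by simp
    qed
    ultimately have "\<bar>(LINT y:ball x r|lebesgue. g y) / ?M - g x\<bar> \<le> e / 2"
      using M by (simp add: abs_divide field_simps)
    then show "dist ((LINT y:ball x r|lebesgue. g y) / ?M) (g x) < e"
      using e by (simp add: dist_real_def)
  qed
qed

text \<open>At a point of continuity the averages of |v - c| tend to |v(x) - c|, and limits are
  unique.\<close>

lemma lebesgue_value_isCont:
  fixes v :: "'a::euclidean_space \<Rightarrow> real"
  assumes [measurable]: "v \<in> borel_measurable lebesgue" and cont: "isCont v x"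
  shows "lebesgue_value v x c \<longleftrightarrow> v x = c"
proof -
  have "((\<lambda>r. (LINT y:ball x r|lebesgue. \<bar>v y - c\<bar>) / measure lebesgue (ball x r)) \<longlongrightarrow> \<bar>v x - c\<bar>) (at_right 0)"
    by (rule lebesgue_average_tendsto) (use cont in \<open>auto intro!: continuous_intros\<close>)
  moreover have "at_right (0::real) \<noteq> bot"
    by (rule trivial_limit_at_right_real)
  ultimately show ?thesis
    unfolding lebesgue_value_def using tendsto_unique by fastforce
qed

section \<open>Capacity and admissibility\<close>

lemma sobolev_capacity_mono: "E \<subseteq> F \<Longrightarrow> sobolev_capacity p E \<le> sobolev_capacity p F"
  unfolding sobolev_capacity_def by (rule INF_superset_mono[OF _ order_refl]) blast

lemma sobolev_capacity_zero_mono: "sobolev_capacity p F = 0 \<Longrightarrow> E \<subseteq> F \<Longrightarrow> sobolev_capacity p E = 0"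
  using sobolev_capacity_mono[of E F p] by simp

text \<open>A function admissible for the capacity is at least 1 on an open neighbourhood of
  \<open>E\<close>, so its energy bounds the measure of that neighbourhood. Neighbourhoods with
  energies tending to zero intersect in a null set containing \<open>E\<close>.\<close>

lemma sobolev_capacity_zero_imp_null:
  fixes E :: "'a::euclidean_space set"
  assumes p: "p > 0" and 0: "sobolev_capacity p E = 0"
  shows "E \<in> null_sets lebesgue"
proof -
  have ex: "\<exists>V. open V \<and> E \<subseteq> V \<and> emeasure lebesgue V \<le> ennreal e" if e: "e > 0" for e
  proof -
    have "sobolev_capacity p E < ennreal e" using 0 e by simp
    then obtain \<phi> V where \<phi>: "open V" "E \<subseteq> V" "AE x in lebesgue. x \<in> V \<longrightarrow> \<phi> x \<ge> 1"
      "(\<integral>\<^sup>+x. ennreal (\<bar>\<phi> x\<bar> powr p + norm (wgrad UNIV \<phi> x) powr p) \<partial>lebesgue) < ennreal e"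
      unfolding sobolev_capacity_def INF_less_iff by blast
    have "emeasure lebesgue V = (\<integral>\<^sup>+x. indicator V x \<partial>lebesgue)"
      using \<phi>(1) by simp
    also have "\<dots> \<le> (\<integral>\<^sup>+x. ennreal (\<bar>\<phi> x\<bar> powr p + norm (wgrad UNIV \<phi> x) powr p) \<partial>lebesgue)"
    proof (rule nn_integral_mono_AE)
      show "AE x in lebesgue. indicator V x \<le> ennreal (\<bar>\<phi> x\<bar> powr p + norm (wgrad UNIV \<phi> x) powr p)"
        using \<phi>(3)
      proof (rule eventually_mono)
        fix x assume *: "x \<in> V \<longrightarrow> \<phi> x \<ge> 1"
        show "indicator V x \<le> ennreal (\<bar>\<phi> x\<bar> powr p + norm (wgrad UNIV \<phi> x) powr p)"
        proof (cases "x \<in> V")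
          case True
          then have "1 \<le> \<bar>\<phi> x\<bar> powr p" using * p by (intro ge_one_powr_ge_zero) auto
          then have "1 \<le> \<bar>\<phi> x\<bar> powr p + norm (wgrad UNIV \<phi> x) powr p"
            by (smt (verit) powr_ge_zero)
          then show ?thesis
            using True ennreal_leI by fastforce
        qed simp
      qed
    qed
    finally show ?thesis using \<phi> by (intro exI[of _ V]) auto
  qed
  then have "\<forall>n. \<exists>V. open V \<and> E \<subseteq> V \<and> emeasure lebesgue V \<le> ennreal (width n)"
    using width_pos by blast
  from choice[OF this] obtain V where V: "\<forall>n. open (V n) \<and> E \<subseteq> V n \<and> emeasure lebesgue (V n) \<le> ennreal (width n)" ..
  define N where "N = (\<Inter>n. V n)"
  have Vm: "V n \<in> sets lebesgue" for n using V by simp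
  then have Nm: "N \<in> sets lebesgue" unfolding N_def by auto
  have "emeasure lebesgue N \<le> ennreal (width n)" for n
  proof -
    have "emeasure lebesgue N \<le> emeasure lebesgue (V n)"
      by (rule emeasure_mono[OF _ Vm]) (auto simp: N_def)
    then show ?thesis using V order_trans by blast
  qed
  then have "emeasure lebesgue N \<le> ennreal 0"
    using tendsto_ennrealI[OF width_tendsto] by (intro LIMSEQ_le_const) auto
  then have "N \<in> null_sets lebesgue"
    using Nm by (auto simp: null_sets_def)
  moreover have "E \<subseteq> N" using V by (auto simp: N_def)
  ultimately show ?thesis
    by (rule completion.complete2[rotated])
qed

text \<open>The exceptional set is phrased through continuity and value at points of
  \<open>K\<close>, a form which minima, averages and truncations inherit pointwise.\<close>

lemma admissibleI:
  fixes v :: "'a::euclidean_space \<Rightarrow> real"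
  assumes s: "sob (ball 0 R) v G" and z: "\<And>x. x \<notin> ball 0 R \<Longrightarrow> v x = 0"
    and c: "sobolev_capacity p {x \<in> K. \<not> (isCont v x \<and> v x = 1)} = 0"
  shows "v \<in> admissible p R K"
proof -
  have "{x \<in> K. \<not> lebesgue_value v x 1} \<subseteq> {x \<in> K. \<not> (isCont v x \<and> v x = 1)}"
    using lebesgue_value_isCont[OF sob_measurable(1)[OF s]] by blast
  then show ?thesis
    using sob_imp_H10[OF s z] sobolev_capacity_zero_mono[OF c] by (simp add: admissible_def)
qed

text \<open>\<open>K\<close> lies in the open ball, so continuity there gives \<open>isCont\<close>
  at each point of \<open>K\<close> and the Lebesgue value becomes the ordinary one.\<close>

lemma admissibleD:
  fixes v :: "'a::euclidean_space \<Rightarrow> real"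
  assumes v: "v \<in> admissible p R K" and K: "K \<subseteq> ball 0 R" and c: "continuous_on (ball 0 R) v"
  shows "v \<in> H10 (ball 0 R)" "sobolev_capacity p {x \<in> K. \<not> (isCont v x \<and> v x = 1)} = 0"
proof -
  show H: "v \<in> H10 (ball 0 R)" using v by (simp add: admissible_def)
  have "isCont v x" if "x \<in> K" for x
    using c K that by (simp add: continuous_on_eq_continuous_at subset_iff)
  then have "{x \<in> K. \<not> (isCont v x \<and> v x = 1)} \<subseteq> {x \<in> K. \<not> lebesgue_value v x 1}"
    using lebesgue_value_isCont[OF sob_measurable(1)[OF H10_imp_sob[OF H]]] by blast
  then show "sobolev_capacity p {x \<in> K. \<not> (isCont v x \<and> v x = 1)} = 0"
    using v sobolev_capacity_zero_mono by (auto simp: admissible_def)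
qed

section \<open>Cut-off functions and balls\<close>

text \<open>A quadratic spline rising from 0 for s \<le> 0 to 1 for s \<ge> 2. Its derivative is the
  hat function on [0, 2] with peak 1 at s = 1.\<close>

definition cutoff :: "real \<Rightarrow> real" where
  "cutoff s = ((max 0 s)\<^sup>2 - 2 * (max 0 (s - 1))\<^sup>2 + (max 0 (s - 2))\<^sup>2) / 2"

definition cutoff' :: "real \<Rightarrow> real" where
  "cutoff' s = max 0 s - 2 * max 0 (s - 1) + max 0 (s - 2)"

lemma has_derivative_cutoff: "(cutoff has_real_derivative cutoff' s) (at s)"
proof -
  have d: "((\<lambda>s. (max 0 (s - c))\<^sup>2) has_real_derivative 2 * max 0 (s - c)) (at s)" for c
  proof -
    have "((\<lambda>s. s - c) has_real_derivative 1) (at s)" by (auto intro!: derivative_eq_intros)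
    from DERIV_chain2[OF has_real_derivative_sq_pos_part this] show ?thesis by simp
  qed
  have D: "((\<lambda>s. ((max 0 (s - 0))\<^sup>2 - 2 * (max 0 (s - 1))\<^sup>2 + (max 0 (s - 2))\<^sup>2) / 2) has_real_derivative
     (2 * max 0 (s - 0) - 2 * (2 * max 0 (s - 1)) + 2 * max 0 (s - 2)) / 2) (at s)"
    by (intro DERIV_cdivide DERIV_add DERIV_diff DERIV_cmult d)
  show ?thesis
    unfolding cutoff_def[abs_def] using DERIV_cong[OF D, of "cutoff' s"]
    by (simp add: cutoff'_def add_divide_distrib diff_divide_distrib)
qed

lemma continuous_cutoff': "continuous_on S cutoff'"
  unfolding cutoff'_def[abs_def] by (intro continuous_intros)

lemma C1_cutoff: "C1 cutoff"
  by (rule C1_realI[OF has_derivative_cutoff continuous_cutoff'])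

lemma cutoff'_bound: "\<bar>cutoff' s\<bar> \<le> 1"
  by (auto simp: cutoff'_def max_def abs_le_iff)

lemma cutoff'_zero: "s \<le> 0 \<or> 2 \<le> s \<Longrightarrow> cutoff' s = 0"
  by (auto simp: cutoff'_def max_def)

lemma cutoff_zero: "s \<le> 0 \<Longrightarrow> cutoff s = 0"
  by (auto simp: cutoff_def max_def)

lemma cutoff_one: "2 \<le> s \<Longrightarrow> cutoff s = 1"
  by (simp add: cutoff_def max_def power2_eq_square algebra_simps)

lemma cutoff_first: "0 \<le> s \<Longrightarrow> s \<le> 1 \<Longrightarrow> cutoff s = s\<^sup>2 / 2"
  by (auto simp: cutoff_def max_def)

lemma cutoff_second: "1 \<le> s \<Longrightarrow> s \<le> 2 \<Longrightarrow> cutoff s = 1 - (2 - s)\<^sup>2 / 2"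
  by (auto simp: cutoff_def max_def power2_eq_square field_simps)

lemma cutoff_pos: "s > 0 \<Longrightarrow> cutoff s > 0"
proof -
  assume s: "s > 0"
  consider "s \<le> 1" | "1 \<le> s" "s \<le> 2" | "2 \<le> s" by linarith
  then show ?thesis
  proof cases
    case 2
    then have "(2 - s)\<^sup>2 \<le> 1" by (intro power_le_one) auto
    then show ?thesis using cutoff_second[OF 2] by simp
  qed (use s in \<open>auto simp: cutoff_first cutoff_one\<close>)
qed

lemma cutoff_le_one: "cutoff s \<le> 1"
proof -
  consider "s \<le> 0" | "0 \<le> s" "s \<le> 1" | "1 \<le> s" "s \<le> 2" | "2 \<le> s" by linarith
  then show ?thesis
  proof cases
    case 2
    then have "s\<^sup>2 \<le> 1" by (intro power_le_one) auto
    then show ?thesis using cutoff_first[OF 2] by simp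
  qed (auto simp: cutoff_zero cutoff_one cutoff_second)
qed

lemma cutoff_nonneg: "0 \<le> cutoff s"
  using cutoff_pos[of s] cutoff_zero[of s] by (cases "s > 0") auto

text \<open>A bump that is positive exactly on the ball of radius \<open>r\<close> and equals 1
  where |x|^2 \<le> r^2 - 2 w. Using the squared norm keeps it differentiable at the origin.\<close>

definition radial :: "real \<Rightarrow> real \<Rightarrow> 'a::euclidean_space \<Rightarrow> real" where
  "radial r w x = cutoff ((r\<^sup>2 - x \<bullet> x) / w)"

lemma radial_properties:
  fixes x :: "'a::euclidean_space"
  assumes w: "w > 0" and r: "r > 0"
  shows "C1 (radial r w :: 'a \<Rightarrow> real)"
    "grad (radial r w) x = (- (2 * cutoff' ((r\<^sup>2 - x \<bullet> x) / w) / w)) *\<^sub>R x"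
    "radial r w x > 0 \<longleftrightarrow> norm x < r" "r \<le> norm x \<Longrightarrow> radial r w x = 0"
    "(norm x)\<^sup>2 \<le> r\<^sup>2 - 2 * w \<Longrightarrow> radial r w x = 1"
    "0 \<le> radial r w x" "radial r w x \<le> 1"
proof -
  have C: "C1 (\<lambda>x::'a. (1 / w) * (r\<^sup>2 - x \<bullet> x))"
    by (intro C1_mult C1_diff C1_const C1_inner C1_bounded_linear[OF bounded_linear_ident])
  have "radial r w = (\<lambda>x::'a. cutoff ((1 / w) * (r\<^sup>2 - x \<bullet> x)))"
    by (simp add: radial_def fun_eq_iff)
  then show "C1 (radial r w :: 'a \<Rightarrow> real)"
    using C1_compose[OF C1_cutoff C] by simp
  have "((\<lambda>x. (r\<^sup>2 - x \<bullet> x) / w) has_derivative (\<lambda>h. (- 2 / w) * (x \<bullet> h))) (at x)"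
    using w by (auto intro!: derivative_eq_intros simp: fun_eq_iff inner_commute field_simps)
  from DERIV_compose_FDERIV[where f = cutoff and s = UNIV, OF has_derivative_cutoff this]
  have "(radial r w has_derivative (\<lambda>h. ((- (2 * cutoff' ((r\<^sup>2 - x \<bullet> x) / w) / w)) *\<^sub>R x) \<bullet> h)) (at x)"
    unfolding radial_def[abs_def] by (rule has_derivative_eq_rhs) (auto simp: fun_eq_iff)
  then show "grad (radial r w) x = (- (2 * cutoff' ((r\<^sup>2 - x \<bullet> x) / w) / w)) *\<^sub>R x"
    by (rule grad_eqI)
  have sq: "norm x < r \<longleftrightarrow> x \<bullet> x < r\<^sup>2" "r \<le> norm x \<longleftrightarrow> r\<^sup>2 \<le> x \<bullet> x"
    using r norm_lt_square[of x r] norm_ge_square[of r x] by auto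
  show "r \<le> norm x \<Longrightarrow> radial r w x = 0"
    unfolding radial_def using sq(2) w by (intro cutoff_zero) (simp add: divide_nonpos_pos)
  then show "radial r w x > 0 \<longleftrightarrow> norm x < r"
    using cutoff_pos[of "(r\<^sup>2 - x \<bullet> x) / w"] sq(1) w by (cases "norm x < r") (auto simp: radial_def)
  show "(norm x)\<^sup>2 \<le> r\<^sup>2 - 2 * w \<Longrightarrow> radial r w x = 1"
    unfolding radial_def power2_norm_eq_inner using w by (intro cutoff_one) (simp add: field_simps)
  show "0 \<le> radial r w x" "radial r w x \<le> 1"
    by (auto simp: radial_def cutoff_nonneg cutoff_le_one)
qed

text \<open>With this \<open>w\<close> the plateau is the ball of radius \<open>\<rho>\<close>,
  which confines the gradient to the annulus. There it is at most 2 r / w = 4 r / ((r - \<rho>) (r +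
  \<rho>)), and r \<le> r + \<rho>.\<close>

lemma radial_gradient_bound:
  fixes x :: "'a::euclidean_space"
  assumes \<rho>: "0 < \<rho>" "\<rho> < r" and w: "w = (r\<^sup>2 - \<rho>\<^sup>2) / 2"
  shows "norm (grad (radial r w) x) \<le> 4 / (r - \<rho>) * indicator (ball 0 r - ball 0 \<rho>) x"
proof -
  have w0: "w > 0" unfolding w using \<rho> by (simp add: power_strict_mono)
  have r: "r > 0" using \<rho> by simp
  have g: "norm (grad (radial r w) x) = 2 * \<bar>cutoff' ((r\<^sup>2 - x \<bullet> x) / w)\<bar> / w * norm x"
    using w0 by (simp add: radial_properties(2)[OF w0 r] abs_mult)
  show ?thesis
  proof (cases "x \<in> ball 0 r - ball 0 \<rho>")
    case True
    have "norm (grad (radial r w) x) \<le> 2 * 1 / w * r"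
      unfolding g using True w0 cutoff'_bound by (intro mult_mono divide_right_mono) auto
    also have "\<dots> = 4 * r / ((r - \<rho>) * (r + \<rho>))"
      by (simp add: w power2_eq_square algebra_simps)
    also have "\<dots> \<le> 4 * (r + \<rho>) / ((r - \<rho>) * (r + \<rho>))"
      using \<rho> by (intro divide_right_mono) auto
    also have "\<dots> = 4 / (r - \<rho>)"
      using \<rho> by (intro mult_divide_mult_cancel_right) simp
    finally show ?thesis using True by simp
  next
    case False
    then consider "norm x \<ge> r" | "norm x < \<rho>" by (auto simp: not_le)
    then have "cutoff' ((r\<^sup>2 - x \<bullet> x) / w) = 0"
    proof cases
      case 1
      then have "r\<^sup>2 \<le> x \<bullet> x" using r by (simp add: power2_norm_eq_inner[symmetric] power_mono)
      then show ?thesis using w0 by (intro cutoff'_zero disjI1) (simp add: divide_nonpos_pos)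
    next
      case 2
      then have "x \<bullet> x \<le> \<rho>\<^sup>2" by (simp add: power2_norm_eq_inner[symmetric] power_mono)
      then have "2 * w \<le> r\<^sup>2 - x \<bullet> x" by (simp add: w)
      then show ?thesis using w0 by (intro cutoff'_zero disjI2) (simp add: field_simps)
    qed
    then show ?thesis using False by (simp add: g)
  qed
qed

text \<open>Bernoulli's inequality for the power of \<rho> / r bounds the volume linearly in the
  thickness, which compensates the size of the gradient above.\<close>

lemma measure_annulus_le:
  assumes \<rho>: "0 < \<rho>" "\<rho> < r"
  shows "measure lebesgue (ball (0::'a::euclidean_space) r - ball 0 \<rho>)
    \<le> unit_ball_vol (real DIM('a)) * (real DIM('a) * r ^ DIM('a) / r) * (r - \<rho>)"
proof -
  let ?n = "DIM('a)"
  have "measure lebesgue (ball (0::'a) r - ball 0 \<rho>) = measure lebesgue (ball (0::'a) r) - measure lebesgue (ball (0::'a) \<rho>)"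
    using \<rho> by (intro measurable_measure_Diff) (auto simp: subset_ball)
  also have "\<dots> = unit_ball_vol (real ?n) * (r ^ ?n - \<rho> ^ ?n)"
    using \<rho> by (simp add: content_ball algebra_simps)
  also have "r ^ ?n - \<rho> ^ ?n \<le> real ?n * r ^ ?n / r * (r - \<rho>)"
  proof -
    have "- 1 \<le> \<rho> / r - 1" using \<rho> by simp
    from Bernoulli_inequality[OF this, of ?n]
    have "1 + real ?n * (\<rho> / r - 1) \<le> (\<rho> / r) ^ ?n" by simp
    then have "r ^ ?n * (1 + real ?n * (\<rho> / r - 1)) \<le> r ^ ?n * (\<rho> / r) ^ ?n"
      using \<rho> by (intro mult_left_mono) auto
    also have "r ^ ?n * (\<rho> / r) ^ ?n = \<rho> ^ ?n"
      using \<rho> by (simp add: power_divide)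
    finally show ?thesis
      using \<rho> by (simp add: field_simps)
  qed
  finally show ?thesis
    by (simp add: mult_left_mono mult.assoc)
qed

text \<open>Radial bumps with thinning annuli approximate the indicator of the ball. After
  integration by parts the gradient, of order 1 / (r - \<rho>), meets an annulus of volume of order
  r - \<rho>, so the pairings have a bound independent of the thickness.\<close>

lemma perimeter_ball_finite:
  assumes r: "r > 0" shows "perimeter (ball (0::'a::euclidean_space) r) < \<infinity>"
proof -
  define C where "C = 4 * (unit_ball_vol (real DIM('a)) * (real DIM('a) * r ^ DIM('a) / r))"
  have C0: "C \<ge> 0" using r by (simp add: C_def)
  have B: "ball (0::'a) r \<in> lmeasurable" by simp
  \<comment> \<open>The offset 2 keeps the inner radius positive already for k = 0.\<close>
  define \<rho> where "\<rho> k = r * (1 - 1 / real (k + 2))" for k :: nat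
  have \<rho>: "0 < \<rho> k" "\<rho> k < r" for k
    using r by (auto simp: \<rho>_def field_simps intro!: add_pos_nonneg)
  have \<rho>l: "\<rho> \<longlonglongrightarrow> r"
  proof -
    have "(\<lambda>k. 1 / real (k + 2)) \<longlonglongrightarrow> 0"
      by (rule LIMSEQ_ignore_initial_segment[OF lim_1_over_n])
    from tendsto_mult[OF tendsto_const[of r] tendsto_diff[OF tendsto_const[of 1] this]] show ?thesis
      by (simp add: \<rho>_def[abs_def])
  qed
  define w where "w k = (r\<^sup>2 - (\<rho> k)\<^sup>2) / 2" for k
  have w: "w k > 0" for k
    unfolding w_def using \<rho>[of k] by (simp add: power_strict_mono)
  note rp = radial_properties[OF w r]
  have "(LINT x:ball 0 r|lebesgue. divergence T x) \<le> C" if T: "unit_field T" for T :: "'a \<Rightarrow> 'a"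
  proof -
    have le: "(\<integral>x. radial r (w k) x * divergence T x \<partial>lebesgue) \<le> C" for k
    proof -
      note ibp = integral_by_parts[OF rp(1)[of k] unit_field_C1c[OF T]]
      have bd: "- (grad (radial r (w k)) x \<bullet> T x) \<le> 4 / (r - \<rho> k) * indicator (ball 0 r - ball 0 (\<rho> k)) x" for x
      proof -
        have "- (grad (radial r (w k)) x \<bullet> T x) \<le> norm (grad (radial r (w k)) x) * norm (T x)"
          using Cauchy_Schwarz_ineq2[of "grad (radial r (w k)) x" "T x"] by linarith
        also have "\<dots> \<le> norm (grad (radial r (w k)) x) * 1"
          using T by (intro mult_left_mono) (auto simp: unit_field_def)
        also have "\<dots> \<le> 4 / (r - \<rho> k) * indicator (ball 0 r - ball 0 (\<rho> k)) x"
          using radial_gradient_bound[OF \<rho> w_def] by simp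
        finally show ?thesis .
      qed
      have D: "ball (0::'a) r - ball 0 (\<rho> k) \<in> lmeasurable" by (intro fmeasurable.Diff) auto
      have "(\<integral>x. radial r (w k) x * divergence T x \<partial>lebesgue) = (\<integral>x. - (grad (radial r (w k)) x \<bullet> T x) \<partial>lebesgue)"
        using ibp by simp
      also have "\<dots> \<le> (\<integral>x. 4 / (r - \<rho> k) * indicator (ball (0::'a) r - ball 0 (\<rho> k)) x \<partial>lebesgue)"
      proof (rule integral_mono)
        show "integrable lebesgue (\<lambda>x. - (grad (radial r (w k)) x \<bullet> T x))" using ibp(3) by simp
        show "integrable lebesgue (\<lambda>x. 4 / (r - \<rho> k) * indicator (ball (0::'a) r - ball 0 (\<rho> k)) x :: real)"
          using D unfolding lmeasurable_iff_integrable by (rule integrable_mult_right)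
      qed (rule bd)
      also have "\<dots> = 4 / (r - \<rho> k) * measure lebesgue (ball (0::'a) r - ball 0 (\<rho> k))"
        using D by simp
      also have "\<dots> \<le> 4 / (r - \<rho> k) * (unit_ball_vol (real DIM('a)) * (real DIM('a) * r ^ DIM('a) / r) * (r - \<rho> k))"
        using \<rho>[of k] by (intro mult_left_mono measure_annulus_le) auto
      also have "\<dots> = C"
        using \<rho>[of k] by (simp add: C_def)
      finally show ?thesis .
    qed
    have "(\<lambda>k. \<integral>x. radial r (w k) x * divergence T x \<partial>lebesgue) \<longlonglongrightarrow> (LINT x:ball 0 r|lebesgue. divergence T x)"
      unfolding set_lebesgue_integral_def
    proof (rule integral_dominated_convergence)
      show "(\<lambda>x. indicator (ball 0 r) x *\<^sub>R divergence T x) \<in> borel_measurable lebesgue"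
        using borel_measurable_integrable[OF set_integrable_divergence[OF unit_field_C1c[OF T]]] by simp
      show "(\<lambda>x. radial r (w k) x * divergence T x) \<in> borel_measurable lebesgue" for k
        using borel_measurable_integrable[OF integral_by_parts(2)[OF rp(1)[of k] unit_field_C1c[OF T]]] .
      show "integrable lebesgue (\<lambda>x. norm (divergence T x))"
        using integrable_divergence(1)[OF unit_field_C1c[OF T]] by (rule integrable_norm)
      show "AE x in lebesgue. norm (radial r (w k) x * divergence T x) \<le> norm (divergence T x)" for k
      proof (rule AE_I2)
        fix x :: 'a
        have "\<bar>radial r (w k) x\<bar> \<le> 1" using rp(6)[of k x] rp(7)[of k x] by simp
        then show "norm (radial r (w k) x * divergence T x) \<le> norm (divergence T x)"
          by (simp add: abs_mult mult_left_le_one_le)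
      qed
      show "AE x in lebesgue. (\<lambda>k. radial r (w k) x * divergence T x) \<longlonglongrightarrow> indicator (ball 0 r) x *\<^sub>R divergence T x"
      proof (rule AE_I2)
        fix x :: 'a
        show "(\<lambda>k. radial r (w k) x * divergence T x) \<longlonglongrightarrow> indicator (ball 0 r) x *\<^sub>R divergence T x"
        proof (cases "norm x < r")
          case True
          then have "\<forall>\<^sub>F k in sequentially. norm x < \<rho> k"
            by (rule order_tendstoD(1)[OF \<rho>l])
          then have "\<forall>\<^sub>F k in sequentially. radial r (w k) x = 1"
          proof (rule eventually_mono)
            fix k assume "norm x < \<rho> k"
            then have "(norm x)\<^sup>2 \<le> (\<rho> k)\<^sup>2" by (intro power_mono) auto
            then show "radial r (w k) x = 1"
              by (intro rp(5)) (simp add: w_def diff_divide_distrib)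
          qed
          then have "\<forall>\<^sub>F k in sequentially. radial r (w k) x * divergence T x = indicator (ball 0 r) x *\<^sub>R divergence T x"
            by (rule eventually_mono) (use True in simp)
          then show ?thesis by (rule tendsto_eventually)
        next
          case False
          then have "radial r (w k) x = 0" for k by (intro rp(4)) simp
          then show ?thesis using False by simp
        qed
      qed
    qed
    then show ?thesis
      by (rule LIMSEQ_le_const2) (use le in auto)
  qed
  then have "perimeter (ball (0::'a) r) \<le> ennreal C"
    by (subst perimeter_le_iff[OF B C0]) auto
  then show ?thesis
    by (simp add: le_less_trans)
qed

text \<open>Supplies finite energy of the minimizers, without which terms could not be cancelled in
  \<open>ennreal\<close>. The bump is radial, its positivity set a ball.\<close>

lemma finite_energy_competitor:
  fixes K :: "'a::euclidean_space set"
  assumes K: "compact K" "K \<noteq> {}" "K \<subseteq> ball 0 R" and p: "p > 0"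
  shows "\<exists>\<eta> G. sob (ball 0 R) \<eta> G \<and> (\<forall>x. x \<notin> ball 0 R \<longrightarrow> \<eta> x = 0) \<and> (\<forall>x. isCont \<eta> x) \<and>
    (\<forall>x\<in>K. \<eta> x = 1) \<and> dirichlet p G < \<infinity> \<and> perimeter {x. \<eta> x > 0} < \<infinity>"
proof -
  obtain y where y: "y \<in> K" "\<forall>x\<in>K. norm x \<le> norm y"
    using continuous_attains_sup[OF K(1,2) continuous_on_norm_id] by auto
  define r0 where "r0 = norm y"
  \<comment> \<open>A radius strictly between the largest norm on \<open>K\<close> and
    \<open>R\<close>; the \<open>w\<close> below makes the plateau of the bump equal to the closed
    ball of radius \<open>r0\<close>, which contains \<open>K\<close>.\<close>
  define r where "r = (r0 + R) / 2"
  have "r0 < R" using y K by (auto simp: r0_def)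
  moreover have r0: "0 \<le> r0" by (simp add: r0_def)
  ultimately have r: "0 < r" "r0 < r" "r < R"
    by (auto simp: r_def)
  define w where "w = (r\<^sup>2 - r0\<^sup>2) / 2"
  have w: "w > 0" unfolding w_def using r r0 by (simp add: power_strict_mono)
  note rp = radial_properties[OF w r(1)]
  define \<eta> :: "'a \<Rightarrow> real" where "\<eta> = radial r w"
  have c: "C1c (ball 0 R) \<eta>"
    unfolding \<eta>_def by (rule C1cI[OF rp(1) compact_cball[of 0 r]]) (use r in \<open>auto simp: rp(4)\<close>)
  have "isCont \<eta> x" for x
    using C1_continuous[OF C1c_C1[OF c], of UNIV] by (simp add: continuous_on_eq_continuous_at)
  moreover have "\<eta> x = 1" if "x \<in> K" for x
  proof -
    have "(norm x)\<^sup>2 \<le> r0\<^sup>2" using y(2) that by (intro power_mono) (auto simp: r0_def)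
    then show ?thesis unfolding \<eta>_def by (intro rp(5)) (simp add: w_def diff_divide_distrib)
  qed
  moreover have "\<eta> x = 0" if "x \<notin> ball 0 R" for x
    unfolding \<eta>_def using that r by (intro rp(4)) auto
  moreover have "perimeter {x. \<eta> x > 0} < \<infinity>"
  proof -
    have "{x. \<eta> x > 0} = ball 0 r" by (auto simp: \<eta>_def rp(3))
    then show ?thesis using perimeter_ball_finite[OF r(1)] by simp
  qed
  moreover have "dirichlet p (grad \<eta>) < \<infinity>"
  proof -
    have "\<exists>B>0. \<forall>x. norm (grad \<eta> x) \<le> B"
      by (rule bounded_compact_support[of _ "supp \<eta>"])
         (use c in \<open>auto simp: C1c_iff grad_zero_outside_supp intro!: C1_grad_continuous\<close>)
    then obtain B where B: "B > 0" "\<forall>x. norm (grad \<eta> x) \<le> B" by blast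
    have S: "supp \<eta> \<in> lmeasurable" using c by (auto simp: C1c_iff intro: lmeasurable_compact)
    have "dirichlet p (grad \<eta>) \<le> (\<integral>\<^sup>+x. ennreal (B powr p) * indicator (supp \<eta>) x \<partial>lebesgue)"
      unfolding dirichlet_def
    proof (rule nn_integral_mono)
      fix x show "ennreal (norm (grad \<eta> x) powr p) \<le> ennreal (B powr p) * indicator (supp \<eta>) x"
        using B p grad_zero_outside_supp[of x \<eta>] by (cases "x \<in> supp \<eta>") (auto intro!: ennreal_leI powr_mono2)
    qed
    also have "\<dots> = ennreal (B powr p) * emeasure lebesgue (supp \<eta>)"
      using S by (subst nn_integral_cmult_indicator) auto
    also have "\<dots> < \<infinity>"
      using S by (auto simp: ennreal_mult_less_top fmeasurable_def)
    finally show ?thesis .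
  qed
  ultimately show ?thesis
    using sob_C1c[OF c] by blast
qed

section \<open>Convexity and scaling of the Dirichlet energy\<close>

text \<open>Mean value theorem for x^p - p x between \<open>x\<close> and 1, where the derivative
  changes sign exactly at 1. The point 0 is treated apart, since the derivative is available only on
  the open half-line.\<close>

lemma powr_gt_tangent:
  fixes p x :: real
  assumes p: "p > 1" and x: "x \<ge> 0" "x \<noteq> 1"
  shows "1 + p * (x - 1) < x powr p"
proof (cases "x = 0")
  case True
  then show ?thesis using p by simp
next
  case False
  have d: "((\<lambda>x. x powr p - p * x) has_real_derivative p * y powr (p - 1) - p) (at y)" if "y > 0" for y
    using that by (auto intro!: derivative_eq_intros)
  show ?thesis
  proof (cases "x < 1")
    case True
    obtain z where z: "x < z" "z < 1" "(1 powr p - p * 1) - (x powr p - p * x) = (1 - x) * (p * z powr (p - 1) - p)"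
      using MVT2[OF True, of "\<lambda>x. x powr p - p * x" "\<lambda>y. p * y powr (p - 1) - p"] d x False by force
    have "z powr (p - 1) < 1"
      using z x p powr_less_mono2[of "p - 1" z 1] by simp
    then have "p * z powr (p - 1) - p < 0"
      using p by simp
    then have "(1 - x) * (p * z powr (p - 1) - p) < 0"
      using True by (intro mult_pos_neg) auto
    then show ?thesis using z(3) by (simp add: algebra_simps)
  next
    case F: False
    then have x1: "1 < x" using x by simp
    obtain z where z: "1 < z" "z < x" "(x powr p - p * x) - (1 powr p - p * 1) = (x - 1) * (p * z powr (p - 1) - p)"
      using MVT2[OF x1, of "\<lambda>x. x powr p - p * x" "\<lambda>y. p * y powr (p - 1) - p"] d by force
    have "1 < z powr (p - 1)"
      using z p powr_less_mono2[of "p - 1" 1 z] by simp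
    then have "p * z powr (p - 1) - p > 0"
      using p by simp
    then have "(x - 1) * (p * z powr (p - 1) - p) > 0"
      using x1 by (intro mult_pos_pos) auto
    then show ?thesis using z(3) by (simp add: algebra_simps)
  qed
qed

text \<open>The strict tangent inequality, rescaled to touch at the midpoint \<open>z\<close>, is
  added for \<open>s\<close> and \<open>r\<close>; the linear terms cancel.\<close>

lemma powr_midpoint:
  fixes p s r :: real
  assumes p: "p > 1" and s: "s \<ge> 0" and r: "r \<ge> 0"
  shows "((s + r) / 2) powr p \<le> (s powr p + r powr p) / 2"
    and "s \<noteq> r \<Longrightarrow> ((s + r) / 2) powr p < (s powr p + r powr p) / 2"
proof -
  show strict: "((s + r) / 2) powr p < (s powr p + r powr p) / 2" if "s \<noteq> r"
  proof -
    define z where "z = (s + r) / 2"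
    have z: "z > 0" using that s r by (auto simp: z_def)
    have t: "z powr p * (1 + p * (a / z - 1)) < a powr p" if "a \<ge> 0" "a \<noteq> z" for a
    proof -
      have "1 + p * (a / z - 1) < (a / z) powr p"
        using that z p by (intro powr_gt_tangent) auto
      then have "z powr p * (1 + p * (a / z - 1)) < z powr p * (a / z) powr p"
        using z by simp
      also have "\<dots> = a powr p"
        using z that by (simp add: powr_divide)
      finally show ?thesis .
    qed
    have "s \<noteq> z" "r \<noteq> z" using that by (auto simp: z_def)
    then have "z powr p * (1 + p * (s / z - 1)) + z powr p * (1 + p * (r / z - 1)) < s powr p + r powr p"
      using t s r by (intro add_strict_mono) auto
    moreover have "z powr p * (1 + p * (s / z - 1)) + z powr p * (1 + p * (r / z - 1)) = 2 * z powr p"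
    proof -
      have "s + r = 2 * z" by (simp add: z_def)
      then have "s / z + r / z = 2" using z by (simp add: add_divide_distrib[symmetric])
      moreover have "c * (1 + p * (a - 1)) + c * (1 + p * (b - 1)) = 2 * c + c * p * (a + b - 2)" for a b c
        by (simp add: algebra_simps)
      ultimately show ?thesis by simp
    qed
    ultimately show ?thesis by (simp add: z_def)
  qed
  show "((s + r) / 2) powr p \<le> (s powr p + r powr p) / 2"
    using strict by (cases "s = r") auto
qed

text \<open>In the case of equality strict convexity of the power forces equal norms. Then the
  triangle inequality is an equality, so the vectors point in the same direction and
  coincide.\<close>

lemma norm_powr_midpoint:
  fixes x y :: "'a::euclidean_space"
  assumes p: "p > 1"
  shows "norm ((1/2) *\<^sub>R x + (1/2) *\<^sub>R y) powr p \<le> (norm x powr p + norm y powr p) / 2"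
    and "(norm x powr p + norm y powr p) / 2 \<le> norm ((1/2) *\<^sub>R x + (1/2) *\<^sub>R y) powr p \<Longrightarrow> x = y"
proof -
  have n: "norm ((1/2) *\<^sub>R x + (1/2) *\<^sub>R y) = norm (x + y) / 2"
    unfolding scaleR_add_right[symmetric] norm_scaleR by simp
  have le: "norm ((1/2) *\<^sub>R x + (1/2) *\<^sub>R y) \<le> (norm x + norm y) / 2"
    unfolding n using norm_triangle_ineq[of x y] by simp
  have 1: "norm ((1/2) *\<^sub>R x + (1/2) *\<^sub>R y) powr p \<le> ((norm x + norm y) / 2) powr p"
    using le p by (intro powr_mono2) auto
  then show "norm ((1/2) *\<^sub>R x + (1/2) *\<^sub>R y) powr p \<le> (norm x powr p + norm y powr p) / 2"
    using powr_midpoint(1)[OF p, of "norm x" "norm y"] by simp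
  assume eq: "(norm x powr p + norm y powr p) / 2 \<le> norm ((1/2) *\<^sub>R x + (1/2) *\<^sub>R y) powr p"
  have xy: "norm x = norm y"
    using powr_midpoint(2)[OF p, of "norm x" "norm y"] 1 eq by force
  have "norm x \<le> norm ((1/2) *\<^sub>R x + (1/2) *\<^sub>R y)"
  proof (rule ccontr)
    assume "\<not> ?thesis"
    then have "norm ((1/2) *\<^sub>R x + (1/2) *\<^sub>R y) powr p < norm x powr p"
      using p by (intro powr_less_mono2) auto
    then show False using eq xy by simp
  qed
  then have "norm (x + y) = norm x + norm y"
    using norm_triangle_ineq[of x y] xy by (simp add: n)
  then have "norm x *\<^sub>R y = norm y *\<^sub>R x"
    by (simp add: norm_triangle_eq)
  then show "x = y"
    using xy by (cases "norm x = 0") auto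
qed

lemma dirichlet_homothety:
  fixes G :: "'a::euclidean_space \<Rightarrow> 'a"
  assumes m: "m > 0" and [measurable]: "G \<in> borel_measurable lebesgue"
  shows "dirichlet p (\<lambda>x. m *\<^sub>R G (a + m *\<^sub>R x)) = ennreal (m powr p / m ^ DIM('a)) * dirichlet p G"
proof -
  have m0: "m \<noteq> 0" using m by simp
  note [measurable] = measurable_homothety[OF m0, of a]
  let ?f = "\<lambda>x. ennreal (norm (G x) powr p)"
  have [measurable]: "(\<lambda>x. ?f (a + m *\<^sub>R x)) \<in> borel_measurable lebesgue"
    by measurable
  have "dirichlet p (\<lambda>x. m *\<^sub>R G (a + m *\<^sub>R x)) = (\<integral>\<^sup>+x. ennreal (m powr p) * ?f (a + m *\<^sub>R x) \<partial>lebesgue)"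
    unfolding dirichlet_def using m by (intro nn_integral_cong) (simp add: powr_mult ennreal_mult)
  also have "\<dots> = ennreal (m powr p) * (\<integral>\<^sup>+x. ?f (a + m *\<^sub>R x) \<partial>lebesgue)"
    by (rule nn_integral_cmult) measurable
  also have "(\<integral>\<^sup>+x. ?f (a + m *\<^sub>R x) \<partial>lebesgue) = ennreal (1 / m ^ DIM('a)) * (\<integral>\<^sup>+x. ?f x \<partial>lebesgue)"
    using m by (subst nn_integral_homothety[OF m0, of ?f a]) (auto simp: mult.assoc[symmetric] ennreal_mult[symmetric])
  finally show ?thesis
    using m by (simp add: dirichlet_def mult.assoc[symmetric] ennreal_mult[symmetric])
qed

section \<open>Comparison of minimizers\<close>

lemma dirichlet_integrable:
  fixes G :: "'a::euclidean_space \<Rightarrow> 'a"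
  assumes [measurable]: "G \<in> borel_measurable lebesgue" and d: "dirichlet p G = ennreal d" "0 \<le> d"
  shows "integrable lebesgue (\<lambda>x. norm (G x) powr p)" "(\<integral>x. norm (G x) powr p \<partial>lebesgue) = d"
proof -
  show i: "integrable lebesgue (\<lambda>x. norm (G x) powr p)"
    using d by (intro integrableI_bounded) (auto simp: dirichlet_def)
  have "ennreal (\<integral>x. norm (G x) powr p \<partial>lebesgue) = ennreal d"
    using d(1) nn_integral_eq_integral[OF i] by (simp add: dirichlet_def)
  then show "(\<integral>x. norm (G x) powr p \<partial>lebesgue) = d"
    using d(2) by (subst (asm) ennreal_inj) auto
qed

text \<open>Turns almost everywhere statements about continuous functions into statements at every
  point.\<close>

lemma AE_open_contradiction:
  fixes S :: "'a::euclidean_space set"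
  assumes "open S" "x \<in> S" "AE y in lebesgue. y \<notin> S"
  shows False
proof -
  have "S \<in> null_sets lebesgue"
    using assms(1,3) by (subst (asm) AE_iff_null) auto
  then have "negligible S"
    by (simp add: negligible_iff_null_sets)
  then show False
    using open_not_negligible[OF assms(1)] assms(2) by blast
qed

text \<open>The contraction by \<open>t < 1\<close> changes the two parts of the energy by different factors. Hence
  \<open>q = min u (w \<circ> S)\<close>, which by submodularity is not worse than \<open>u\<close> for the rescaled energy, must
  have a Dirichlet energy not larger than that of \<open>u\<close>.\<close>

lemma minimizer_le_contraction:
  fixes u w :: "'a::euclidean_space \<Rightarrow> real"
  assumes p: "1 < p"
    and u: "sob (ball 0 R) u A" and w: "sob (ball 0 R) w W"
    and zu: "\<And>x. x \<notin> ball 0 R \<Longrightarrow> u x = 0" and zw: "\<And>x. x \<notin> ball 0 R \<Longrightarrow> w x = 0"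
    and u0: "\<And>x. 0 \<le> u x" and u1: "\<And>x. u x \<le> 1" and w0: "\<And>x. 0 \<le> w x"
    and W0: "\<And>x. w x = 0 \<Longrightarrow> W x = 0"
    and cu: "continuous_on (ball 0 R) u" and cw: "continuous_on (ball 0 R) w"
    and K: "K \<subseteq> K'" "convex K'" "K' \<subseteq> ball 0 R" and wK: "\<And>x. x \<in> K' \<Longrightarrow> w x = 1"
    and capu: "sobolev_capacity p {x \<in> K. \<not> (isCont u x \<and> u x = 1)} = 0"
    and minu: "\<And>v D. sob (ball 0 R) v D \<Longrightarrow> (\<And>x. x \<notin> ball 0 R \<Longrightarrow> v x = 0) \<Longrightarrow>
      sobolev_capacity p {x \<in> K. \<not> (isCont v x \<and> v x = 1)} = 0 \<Longrightarrow>
      dirichlet p A + perimeter {x. u x > 0} \<le> dirichlet p D + perimeter {x. v x > 0}"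
    and minw: "\<And>v D. sob (ball 0 R) v D \<Longrightarrow> (\<And>x. x \<notin> ball 0 R \<Longrightarrow> v x = 0) \<Longrightarrow>
      (\<And>x. x \<in> K' \<Longrightarrow> isCont v x \<and> v x = 1) \<Longrightarrow>
      dirichlet p W + perimeter {x. w x > 0} \<le> dirichlet p D + perimeter {x. v x > 0}"
    and fin: "dirichlet p A < \<infinity>" "perimeter {x. u x > 0} < \<infinity>" "dirichlet p W < \<infinity>" "perimeter {x. w x > 0} < \<infinity>"
    and x0: "x0 \<in> K'" and t: "0 < t" "t < 1" and x: "x \<in> ball 0 R"
  shows "u x \<le> w ((1 - t) *\<^sub>R x0 + t *\<^sub>R x)"
proof -
  let ?B = "ball 0 R :: 'a set"
  let ?n = "DIM('a)"
  define a where "a = (1 - t) *\<^sub>R x0"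
  \<comment> \<open>The inverse of the contraction \<open>S\<close>, which sends \<open>y\<close> to
    \<open>a + t *\<^sub>R y\<close>, is \<open>y\<close> mapped to
    \<open>a' + (1 / t) *\<^sub>R y\<close>.\<close>
  define a' where "a' = - ((1 / t) *\<^sub>R a)"
  have t0: "t \<noteq> 0" and ti: "1 / t > 0" "1 / t \<noteq> 0" using t by auto
  have inv: "a + t *\<^sub>R (a' + (1 / t) *\<^sub>R y) = y" "a' + (1 / t) *\<^sub>R (a + t *\<^sub>R y) = y" for y
    using t by (auto simp: a'_def scaleR_add_right scaleR_right_diff_distrib)
  \<comment> \<open>By convexity \<open>S\<close> maps the ball and \<open>K'\<close> into
    themselves. Hence a function vanishing outside the ball still does so after composition with the
    inverse of \<open>S\<close>.\<close>
  have SB: "a + t *\<^sub>R y \<in> ?B" if "y \<in> ?B" for y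
    using convexD_alt[OF convex_ball, of x0 0 R y t] K(3) x0 that t by (auto simp: a_def)
  have SK: "a + t *\<^sub>R y \<in> K'" if "y \<in> K'" for y
    using convexD_alt[OF K(2), of x0 y t] x0 that t by (auto simp: a_def)
  have SB': "y \<in> ?B" if "a' + (1 / t) *\<^sub>R y \<in> ?B" for y
    using SB[OF that] inv(1)[of y] by simp
  have isu: "isCont u y" if "y \<in> ?B" for y
    using cu that by (simp add: continuous_on_eq_continuous_at)
  have isw: "isCont w y" if "y \<in> ?B" for y
    using cw that by (simp add: continuous_on_eq_continuous_at)
  have wS: "isCont (\<lambda>y. w (a + t *\<^sub>R y)) y" if "y \<in> ?B" for y
    by (rule isCont_o2[where f = "\<lambda>y. a + t *\<^sub>R y" and g = w, OF _ isw[OF SB[OF that]]]) (intro continuous_intros)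

  define q where "q y = min (u y) (w (a + t *\<^sub>R y))" for y
  define D where "D y = (if u y > w (a + t *\<^sub>R y) then t *\<^sub>R W (a + t *\<^sub>R y) else A y)" for y
  have sq: "sob ?B q D"
  proof -
    \<comment> \<open>The function \<open>w \<circ> S\<close> need not vanish outside the ball, so
      it is placed in the closure over the whole space; the support of the minimum is provided by
      \<open>u\<close>.\<close>
    have "sob UNIV (\<lambda>y. w (a + t *\<^sub>R y)) (\<lambda>y. t *\<^sub>R W (a + t *\<^sub>R y))"
      by (rule sob_homothety[OF w t0]) simp
    from sob_min[OF u this]
    have "sob ?B (\<lambda>y. min (u y) (max 0 (w (a + t *\<^sub>R y))))
       (\<lambda>y. (1 - of_bool (u y > max 0 (w (a + t *\<^sub>R y)))) *\<^sub>R A y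
          + of_bool (u y > max 0 (w (a + t *\<^sub>R y)) \<and> w (a + t *\<^sub>R y) > 0) *\<^sub>R (t *\<^sub>R W (a + t *\<^sub>R y)))" .
    moreover have "(\<lambda>y. min (u y) (max 0 (w (a + t *\<^sub>R y)))) = q"
      using w0 by (simp add: fun_eq_iff q_def max_def)
    \<comment> \<open>The general formula drops the gradient of the second function where that
      function is 0; by \<open>W0\<close> it is zero there anyway, so a single case distinction
      describes \<open>D\<close>.\<close>
    moreover have "(1 - of_bool (u y > max 0 (w (a + t *\<^sub>R y)))) *\<^sub>R A y
          + of_bool (u y > max 0 (w (a + t *\<^sub>R y)) \<and> w (a + t *\<^sub>R y) > 0) *\<^sub>R (t *\<^sub>R W (a + t *\<^sub>R y)) = D y" for y
      using w0[of "a + t *\<^sub>R y"] W0[of "a + t *\<^sub>R y"]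
      by (cases "w (a + t *\<^sub>R y) = 0") (auto simp: D_def max_def not_less)
    ultimately show ?thesis by simp
  qed
  have q0: "0 \<le> q y" and qu: "q y \<le> u y" for y
    using u0 w0 by (auto simp: q_def)
  have zq: "q y = 0" if "y \<notin> ?B" for y
    using q0[of y] qu[of y] zu[OF that] by simp

  \<comment> \<open>Everything is now transported by the inverse of \<open>S\<close>, so that the
    lattice operations are between \<open>u \<circ> S\<^sup>-\<^sup>1\<close> and \<open>w\<close>
    itself.\<close>
  define ut where "ut y = u (a' + (1 / t) *\<^sub>R y)" for y
  define At where "At y = (1 / t) *\<^sub>R A (a' + (1 / t) *\<^sub>R y)" for y
  define m where "m y = q (a' + (1 / t) *\<^sub>R y)" for y
  define Dm where "Dm y = (1 / t) *\<^sub>R D (a' + (1 / t) *\<^sub>R y)" for y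
  define M where "M y = max (ut y) (w y)" for y
  define DM where "DM y = (if ut y > w y then At y else W y)" for y
  have sut: "sob ?B ut At"
    unfolding ut_def At_def by (rule sob_homothety[OF u ti(2) SB'])
  have sm: "sob ?B m Dm"
    unfolding m_def Dm_def by (rule sob_homothety[OF sq ti(2) SB'])
  have m_eq: "m y = min (ut y) (w y)" for y
    by (simp add: m_def q_def ut_def inv)
  have Dm_eq: "Dm y = (if ut y > w y then W y else At y)" for y
    using t by (simp add: Dm_def D_def ut_def At_def inv)
  \<comment> \<open>The maximum is the sum minus the minimum, for the functions and for the chosen
    gradients alike, so linearity suffices.\<close>
  have sM: "sob ?B M DM"
  proof -
    have "sob ?B (\<lambda>y. 1 * (1 * ut y + 1 * w y) + (- 1) * m y) (\<lambda>y. 1 *\<^sub>R (1 *\<^sub>R At y + 1 *\<^sub>R W y) + (- 1) *\<^sub>R Dm y)"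
      by (rule sob_lincomb[OF sob_lincomb[OF sut w] sm])
    moreover have "(\<lambda>y. 1 * (1 * ut y + 1 * w y) + (- 1) * m y) = M"
      by (auto simp: fun_eq_iff m_eq M_def max_def min_def)
    moreover have "(\<lambda>y. 1 *\<^sub>R (1 *\<^sub>R At y + 1 *\<^sub>R W y) + (- 1) *\<^sub>R Dm y) = DM"
      by (auto simp: fun_eq_iff Dm_eq DM_def)
    ultimately show ?thesis by simp
  qed
  have zM: "M y = 0" if "y \<notin> ?B" for y
  proof -
    have "a' + (1 / t) *\<^sub>R y \<notin> ?B" using SB'[of y] that by blast
    then show ?thesis using zw[OF that] zu by (simp add: M_def ut_def)
  qed
  have MK: "isCont M y \<and> M y = 1" if y: "y \<in> K'" for y
  proof
    show M1: "M y = 1"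
      using wK[OF y] u1 by (simp add: M_def ut_def max_def antisym)
    have "(\<lambda>z. w z - 1) \<midarrow>y\<rightarrow> 1 - 1"
      using isw[of y] K(3) y wK[OF y] by (intro tendsto_diff tendsto_const) (auto simp: isCont_def)
    then have lim: "(\<lambda>z. \<bar>w z - 1\<bar>) \<midarrow>y\<rightarrow> 0"
      by (simp add: tendsto_rabs_zero_iff)
    \<comment> \<open>The transported \<open>u\<close> may jump where its argument meets the sphere.
      Since it never exceeds 1, taking the maximum with it brings \<open>w\<close> no further from
      1, and continuity of \<open>M\<close> at \<open>y\<close> follows from that of
      \<open>w\<close>.\<close>
    have le: "\<forall>z. norm (M z - 1) \<le> \<bar>w z - 1\<bar>"
      using u1[of "a' + (1 / t) *\<^sub>R z" for z] by (auto simp: M_def ut_def max_def)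
    have "(\<lambda>z. M z - 1) \<midarrow>y\<rightarrow> 0"
      by (rule Lim_null_comparison[OF always_eventually[OF le] lim])
    then show "isCont M y"
      by (simp add: isCont_def M1 LIM_zero_iff)
  qed

  \<comment> \<open>At each point the gradients of maximum and minimum are those of the two
    functions, possibly exchanged, so the Dirichlet energies add up exactly.\<close>
  have dsum: "dirichlet p DM + dirichlet p Dm = dirichlet p At + dirichlet p W"
  proof -
    note [measurable] = sob_measurable(2)[OF sM] sob_measurable(2)[OF sm] sob_measurable(2)[OF sut] sob_measurable(2)[OF w]
    have "dirichlet p DM + dirichlet p Dm = (\<integral>\<^sup>+y. ennreal (norm (DM y) powr p) + ennreal (norm (Dm y) powr p) \<partial>lebesgue)"
      unfolding dirichlet_def by (rule nn_integral_add[symmetric]) measurable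
    also have "\<dots> = (\<integral>\<^sup>+y. ennreal (norm (At y) powr p) + ennreal (norm (W y) powr p) \<partial>lebesgue)"
      by (rule nn_integral_cong) (simp add: DM_def Dm_eq add.commute)
    also have "\<dots> = dirichlet p At + dirichlet p W"
      unfolding dirichlet_def by (rule nn_integral_add) measurable
    finally show ?thesis .
  qed
  have psum: "perimeter {y. M y > 0} + perimeter {y. m y > 0} \<le> perimeter {y. ut y > 0} + perimeter {y. w y > 0}"
  proof -
    have "{y. M y > 0} = {y. ut y > 0} \<union> {y. w y > 0}" "{y. m y > 0} = {y. ut y > 0} \<inter> {y. w y > 0}"
      by (auto simp: M_def m_eq)
    then show ?thesis using perimeter_submodular[of "{y. ut y > 0}" "{y. w y > 0}"] by simp
  qed
  have le_m: "dirichlet p Dm + perimeter {y. m y > 0} \<le> dirichlet p At + perimeter {y. ut y > 0}"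
  proof -
    \<comment> \<open>The finite energy of \<open>w\<close> appears on both sides of the chain below
      and is cancelled at the end.\<close>
    let ?w = "dirichlet p W + perimeter {x. w x > 0}"
    have "?w + (dirichlet p Dm + perimeter {y. m y > 0})
      \<le> (dirichlet p DM + perimeter {y. M y > 0}) + (dirichlet p Dm + perimeter {y. m y > 0})"
      by (intro add_right_mono minw[OF sM zM MK])
    also have "\<dots> = (dirichlet p DM + dirichlet p Dm) + (perimeter {y. M y > 0} + perimeter {y. m y > 0})"
      by (simp add: ac_simps)
    also have "\<dots> \<le> (dirichlet p At + dirichlet p W) + (perimeter {y. ut y > 0} + perimeter {y. w y > 0})"
      unfolding dsum by (intro add_left_mono psum)
    also have "\<dots> = ?w + (dirichlet p At + perimeter {y. ut y > 0})"
      by (simp add: ac_simps)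
    finally show ?thesis
      using fin by (auto simp: ennreal_add_left_cancel_le)
  qed

  \<comment> \<open>The scaling factors of Dirichlet energy and perimeter under the inverse of
    \<open>S\<close>: powers of 1 / t > 1 with exponents p - n and 1 - n, n being the
    dimension.\<close>
  define c1 where "c1 = (1 / t) powr p / (1 / t) ^ ?n"
  define c2 where "c2 = (1 / t) / (1 / t) ^ ?n"
  have c: "0 < c2" "c2 < c1"
  proof -
    have "(1 / t) powr 1 < (1 / t) powr p"
      using t p by (intro powr_less_mono) auto
    then show "c2 < c1"
      unfolding c1_def c2_def using t by (intro divide_strict_right_mono) auto
    show "0 < c2" using t by (simp add: c2_def)
  qed
  define dA where "dA = enn2real (dirichlet p A)"
  define pu where "pu = enn2real (perimeter {x. u x > 0})"
  have dA: "dirichlet p A = ennreal dA" "0 \<le> dA" and pu: "perimeter {x. u x > 0} = ennreal pu" "0 \<le> pu"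
    using fin by (auto simp: dA_def pu_def)
  have dAt: "dirichlet p At = ennreal (c1 * dA)"
    unfolding At_def[abs_def] dirichlet_homothety[OF ti(1) sob_measurable(2)[OF u]] dA(1) c1_def[symmetric]
    using c dA(2) by (simp add: ennreal_mult)
  have put: "perimeter {y. ut y > 0} = ennreal (c2 * pu)"
    using perimeter_homothety[OF ti(1) fin(2), of a'] by (simp add: ut_def c2_def pu_def)
  have dDm: "dirichlet p Dm = ennreal c1 * dirichlet p D"
    unfolding Dm_def[abs_def] dirichlet_homothety[OF ti(1) sob_measurable(2)[OF sq]] c1_def ..
  have fin_m: "dirichlet p Dm + perimeter {y. m y > 0} < \<infinity>"
    using le_m unfolding dAt put by (rule le_less_trans) simp
  then have fm: "perimeter {y. m y > 0} < \<infinity>" "dirichlet p D < \<infinity>"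
    using c unfolding dDm by (auto simp: ennreal_mult_less_top)
  define dq where "dq = enn2real (dirichlet p D)"
  define pm where "pm = enn2real (perimeter {y. m y > 0})"
  have dq: "dirichlet p D = ennreal dq" "0 \<le> dq" and pm: "perimeter {y. m y > 0} = ennreal pm" "0 \<le> pm"
    using fm by (auto simp: dq_def pm_def)
  have pq: "perimeter {y. q y > 0} = ennreal (t / t ^ ?n * pm)"
    using perimeter_homothety[OF t(1) fm(1), of a] by (simp add: m_def inv pm_def)
  have "c1 * dq + pm \<le> c1 * dA + c2 * pu"
  proof -
    have "ennreal (c1 * dq + pm) \<le> ennreal (c1 * dA + c2 * pu)"
      using le_m dq pm dA pu c unfolding dDm dAt put by (simp add: ennreal_mult ennreal_plus)
    then show ?thesis
      using dA pu c by (subst (asm) ennreal_le_iff) auto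
  qed
  \<comment> \<open>The perimeter of the positivity set of \<open>q\<close>; that of its transported
    copy is \<open>c2\<close> times as large.\<close>
  moreover define pq' where "pq' = t / t ^ ?n * pm"
  have pm_eq: "pm = c2 * pq'"
    using t by (simp add: pq'_def c2_def field_simps)
  ultimately have 1: "c1 * dq + c2 * pq' \<le> c1 * dA + c2 * pu" by simp
  have "isCont q y \<and> q y = 1" if y: "y \<in> K" "isCont u y" "u y = 1" for y
  proof
    have yB: "y \<in> ?B" "y \<in> K'" using y K by auto
    show "isCont q y"
      unfolding q_def by (intro continuous_intros y(2) wS[OF yB(1)])
    show "q y = 1"
      using y(3) wK[OF SK[OF yB(2)]] by (simp add: q_def)
  qed
  then have capq: "sobolev_capacity p {x \<in> K. \<not> (isCont q x \<and> q x = 1)} = 0"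
    by (intro sobolev_capacity_zero_mono[OF capu]) blast
  have "dA + pu \<le> dq + pq'"
  proof -
    have "ennreal (dA + pu) \<le> ennreal (dq + pq')"
      using minu[OF sq zq capq] dA pu dq pm t unfolding pq pq'_def[symmetric]
      by (simp add: ennreal_plus pq'_def)
    then show ?thesis
      using dq pm t by (subst (asm) ennreal_le_iff) (auto simp: pq'_def)
  qed
  \<comment> \<open>The rescaled comparison minus \<open>c2\<close> times the minimality of
    \<open>u\<close> tested with \<open>q\<close> leaves (c1 - c2) (dq - dA) \<le> 0.\<close>
  have dq_le: "dq \<le> dA"
  proof (rule ccontr)
    assume "\<not> dq \<le> dA"
    then have e: "dq - dA > 0" by simp
    have "c1 * (dq - dA) \<le> c2 * (pu - pq')"
      using 1 by (simp add: algebra_simps)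
    also have "\<dots> \<le> c2 * (dq - dA)"
      using \<open>dA + pu \<le> dq + pq'\<close> c by (intro mult_left_mono) auto
    also have "\<dots> < c1 * (dq - dA)"
      using c e by (intro mult_strict_right_mono)
    finally show False by simp
  qed

  \<comment> \<open>From 0 \<le> q \<le> u the average has the same positivity set as
    \<open>u\<close>. The perimeters cancel, and minimality becomes an inequality between Dirichlet
    energies alone.\<close>
  define v where "v y = (1/2) * u y + (1/2) * q y" for y
  define Dv where "Dv y = (1/2) *\<^sub>R A y + (1/2) *\<^sub>R D y" for y
  have sv: "sob ?B v Dv"
    unfolding v_def Dv_def by (rule sob_lincomb[OF u sq])
  have zv: "v y = 0" if "y \<notin> ?B" for y
    using zu[OF that] zq[OF that] by (simp add: v_def)
  have "isCont v y \<and> v y = 1" if y: "y \<in> K" "isCont u y" "u y = 1" for y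
  proof
    have yB: "y \<in> ?B" "y \<in> K'" using y K by auto
    show "isCont v y"
      unfolding v_def q_def by (intro continuous_intros y(2) wS[OF yB(1)])
    show "v y = 1"
      using y(3) wK[OF SK[OF yB(2)]] by (simp add: v_def q_def)
  qed
  then have capv: "sobolev_capacity p {x \<in> K. \<not> (isCont v x \<and> v x = 1)} = 0"
    by (intro sobolev_capacity_zero_mono[OF capu]) blast
  have "v y > 0 \<longleftrightarrow> u y > 0" for y
    using q0[of y] qu[of y] by (auto simp: v_def)
  then have vu: "{y. v y > 0} = {y. u y > 0}" by auto
  have dv_ge: "ennreal dA \<le> dirichlet p Dv"
    using minu[OF sv zv capv] fin(2) unfolding vu dA(1)
    by (auto simp: add.commute[of _ "perimeter {y. u y > 0}"] ennreal_add_left_cancel_le)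
  note [measurable] = sob_measurable(2)[OF u] sob_measurable(2)[OF sq] sob_measurable(2)[OF sv]
  note iA = dirichlet_integrable[OF sob_measurable(2)[OF u] dA] and iD = dirichlet_integrable[OF sob_measurable(2)[OF sq] dq]
  \<comment> \<open>The pointwise convexity defect. It is nonnegative, while minimality of
    \<open>u\<close> and \<open>dq \<le> dA\<close> make its integral nonpositive; hence it vanishes
    almost everywhere.\<close>
  let ?h = "\<lambda>y. (norm (A y) powr p + norm (D y) powr p) / 2 - norm (Dv y) powr p"
  have h0: "0 \<le> ?h y" for y
    using norm_powr_midpoint(1)[OF p, of "A y" "D y"] by (simp add: Dv_def)
  have iv: "integrable lebesgue (\<lambda>y. norm (Dv y) powr p)"
  proof (rule Bochner_Integration.integrable_bound)
    show "integrable lebesgue (\<lambda>y. (norm (A y) powr p + norm (D y) powr p) / 2)"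
      using iA iD by simp
    show "AE y in lebesgue. norm (norm (Dv y) powr p) \<le> norm ((norm (A y) powr p + norm (D y) powr p) / 2)"
      using h0 by (intro AE_I2) simp
  qed measurable
  have "ennreal dA \<le> ennreal (\<integral>y. norm (Dv y) powr p \<partial>lebesgue)"
    using dv_ge nn_integral_eq_integral[OF iv] by (simp add: dirichlet_def)
  then have dv: "dA \<le> (\<integral>y. norm (Dv y) powr p \<partial>lebesgue)"
    by (subst (asm) ennreal_le_iff) auto
  have ih: "integrable lebesgue ?h"
    using iA iD iv by simp
  have "(\<integral>y. ?h y \<partial>lebesgue) = (dA + dq) / 2 - (\<integral>y. norm (Dv y) powr p \<partial>lebesgue)"
    using iA iD iv by simp
  then have "(\<integral>y. ?h y \<partial>lebesgue) \<le> 0"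
    using dv dq_le by simp
  moreover have "0 \<le> (\<integral>y. ?h y \<partial>lebesgue)"
    using h0 by (intro integral_nonneg_AE AE_I2)
  ultimately have "(\<integral>y. ?h y \<partial>lebesgue) = 0" by simp
  then have "AE y in lebesgue. ?h y = 0"
    using integral_nonneg_eq_0_iff_AE[OF ih] h0 by auto
  then have AD: "AE y in lebesgue. A y = D y"
  proof (rule eventually_mono)
    fix y assume "?h y = 0"
    then show "A y = D y"
      by (intro norm_powr_midpoint(2)[OF p]) (simp add: Dv_def)
  qed
  \<comment> \<open>Equal gradients almost everywhere, together with the zero boundary values, give
    u = q by the Poincare inequality.\<close>
  have "AE y in lebesgue. 1 * u y + (- 1) * q y = 0"
  proof (rule sob_zero_gradient[OF sob_lincomb[OF u sq]])
    show "AE y in lebesgue. 1 *\<^sub>R A y + (- 1) *\<^sub>R D y = 0"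
      using AD by (rule eventually_mono) simp
  qed
  then have ae: "AE y in lebesgue. u y \<le> w (a + t *\<^sub>R y)"
    by (rule eventually_mono) (simp add: q_def min_def split: if_splits)

  show ?thesis
  proof (rule ccontr)
    assume "\<not> ?thesis"
    then have gt: "w (a + t *\<^sub>R x) < u x" by (simp add: a_def)
    \<comment> \<open>An open set on which the almost everywhere inequality fails; it would contain
      \<open>x\<close>, by continuity of both sides in the ball.\<close>
    define S where "S = {y \<in> ?B. w (a + t *\<^sub>R y) < u y}"
    have "continuous_on ?B (\<lambda>y. w (a + t *\<^sub>R y))"
      using wS by (simp add: continuous_at_imp_continuous_on)
    then have "continuous_on ?B (\<lambda>y. u y - w (a + t *\<^sub>R y))"
      by (intro continuous_on_diff cu)
    then have "open (?B \<inter> (\<lambda>y. u y - w (a + t *\<^sub>R y)) -` {0<..})"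
      by (rule continuous_open_preimage) auto
    also have "?B \<inter> (\<lambda>y. u y - w (a + t *\<^sub>R y)) -` {0<..} = S"
      by (auto simp: S_def)
    finally have "open S" .
    moreover have "x \<in> S" using gt x by (simp add: S_def)
    moreover have "AE y in lebesgue. y \<notin> S"
      using ae by (rule eventually_mono) (simp add: S_def)
    ultimately show False by (rule AE_open_contradiction)
  qed
qed

text \<open>The continuity hypotheses express the convention on representatives. They concern the
  open ball, where \<open>K\<close> and its hull lie; the extension by zero may jump at the
  sphere.\<close>

theorem corollary17:
  fixes K :: "'a::euclidean_space set"
    and p R :: real
    and u w :: "'a \<Rightarrow> real"
  assumes "1 < p"
    and "compact K" and "K \<subseteq> ball 0 R"
    and "interior (convex hull K) \<noteq> {}"
    and "is_arg_min (energy p R) (\<lambda>v. v \<in> admissible p R K) u"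
    and "continuous_on (ball 0 R) u"
    and "is_arg_min (energy p R) (\<lambda>v. v \<in> admissible p R (convex hull K)) w"
    and "continuous_on (ball 0 R) w"
  shows "{x. u x > 0} \<subseteq> {x. w x > 0}"
proof -
  let ?B = "ball 0 R :: 'a set"
  define K' where "K' = convex hull K"
  have p0: "p > 0" using assms(1) by simp
  have K': "convex K'" "compact K'" "K \<subseteq> K'" "K' \<subseteq> ?B" "interior K' \<noteq> {}"
    unfolding K'_def using assms(2,4) hull_minimal[of K ?B convex, OF assms(3) convex_ball]
    by (simp_all add: compact_convex_hull hull_subset)
  then have ne: "K' \<noteq> {}" by auto
  then obtain x0 where x0: "x0 \<in> K'" by blast
  have uad: "u \<in> admissible p R K" and umin: "\<And>v. v \<in> admissible p R K \<Longrightarrow> energy p R u \<le> energy p R v"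
    using assms(5) by (auto simp: is_arg_min_def not_less)
  have wad: "w \<in> admissible p R K'" and wmin: "\<And>v. v \<in> admissible p R K' \<Longrightarrow> energy p R w \<le> energy p R v"
    using assms(7) by (auto simp: is_arg_min_def not_less K'_def)
  note uH = admissibleD[OF uad assms(3,6)] and wH = admissibleD[OF wad K'(4) assms(8)]
  define A0 where "A0 = (\<lambda>x. indicator ?B x *\<^sub>R wgrad ?B u x)"
  define W0 where "W0 = (\<lambda>x. indicator ?B x *\<^sub>R wgrad ?B w x)"
  have su: "sob ?B u A0" and sw: "sob ?B w W0"
    unfolding A0_def W0_def by (rule H10_imp_sob[OF uH(1)], rule H10_imp_sob[OF wH(1)])
  have zu: "u x = 0" and zw: "w x = 0" if "x \<notin> ?B" for x
    using uH(1) wH(1) that by (auto simp: H10_def)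

  \<comment> \<open>The difference of the positive parts of u and u - 1 cuts \<open>u\<close> to
    values between 0 and 1. The form of a linear combination is kept so that the gradient can be
    read off; the factor of \<open>A0\<close> is the indicator of 0 < u \<le> 1.\<close>
  define uc where "uc x = 1 * max 0 (u x - 0) + (- 1) * max 0 (u x - 1)" for x
  define Ac where "Ac x = 1 *\<^sub>R (of_bool (u x > 0) *\<^sub>R A0 x) + (- 1) *\<^sub>R (of_bool (u x > 1) *\<^sub>R A0 x)" for x
  define wc where "wc x = max 0 (w x - 0)" for x
  define Wc where "Wc x = of_bool (w x > 0) *\<^sub>R W0 x" for x
  have suc: "sob ?B uc Ac"
    unfolding uc_def Ac_def by (rule sob_lincomb[OF sob_pos_part[OF su] sob_pos_part[OF su]]) auto
  have swc: "sob ?B wc Wc"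
    unfolding wc_def Wc_def by (rule sob_pos_part[OF sw]) simp
  have uc_pos: "{x. uc x > 0} = {x. u x > 0}" and wc_pos: "{x. wc x > 0} = {x. w x > 0}"
    by (auto simp: uc_def wc_def max_def)
  \<comment> \<open>Truncation multiplies gradients by 0 or 1 and leaves positivity sets unchanged.
    It cannot raise the energy, so the truncated functions inherit the minimality
    inequalities.\<close>
  have dle: "dirichlet p Ac \<le> dirichlet p A0" "dirichlet p Wc \<le> dirichlet p W0"
    unfolding dirichlet_def using p0
    by (auto intro!: nn_integral_mono ennreal_leI powr_mono2 simp: Ac_def Wc_def)
  have Eu: "dirichlet p Ac + perimeter {x. uc x > 0} \<le> energy p R u"
    unfolding energy_eq[OF su p0] uc_pos by (intro add_right_mono dle)
  have Ew: "dirichlet p Wc + perimeter {x. wc x > 0} \<le> energy p R w"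
    unfolding energy_eq[OF sw p0] wc_pos by (intro add_right_mono dle)
  have cuc: "continuous_on ?B uc"
    unfolding uc_def by (intro continuous_intros assms(6))
  have cwc: "continuous_on ?B wc"
    unfolding wc_def by (intro continuous_intros assms(8))

  have minu: "dirichlet p Ac + perimeter {x. uc x > 0} \<le> dirichlet p D + perimeter {x. v x > 0}"
    if "sob ?B v D" "\<And>x. x \<notin> ?B \<Longrightarrow> v x = 0" "sobolev_capacity p {x \<in> K. \<not> (isCont v x \<and> v x = 1)} = 0" for v D
    using order_trans[OF Eu umin[OF admissibleI[OF that]]] unfolding energy_eq[OF that(1) p0] .
  have minw: "dirichlet p Wc + perimeter {x. wc x > 0} \<le> dirichlet p D + perimeter {x. v x > 0}"
    if "sob ?B v D" "\<And>x. x \<notin> ?B \<Longrightarrow> v x = 0" "sobolev_capacity p {x \<in> K'. \<not> (isCont v x \<and> v x = 1)} = 0" for v D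
    using order_trans[OF Ew wmin[OF admissibleI[OF that]]] unfolding energy_eq[OF that(1) p0] .

  have wK: "w x = 1" if "x \<in> K'" for x
  proof -
    have null: "{x \<in> K'. \<not> (isCont w x \<and> w x = 1)} \<in> null_sets lebesgue"
      by (rule sobolev_capacity_zero_imp_null[OF p0 wH(2)])
    have int: "w y = 1" if y: "y \<in> interior K'" for y
    proof (rule ccontr)
      assume ny: "w y \<noteq> 1"
      define S where "S = {z \<in> interior K'. w z \<noteq> 1}"
      have "continuous_on (interior K') w"
        using continuous_on_subset[OF assms(8)] K'(4) interior_subset by blast
      then have "open (interior K' \<inter> w -` (- {1}))"
        by (rule continuous_open_preimage) auto
      also have "interior K' \<inter> w -` (- {1}) = S"
        by (auto simp: S_def)
      finally have "open S" .
      moreover have "y \<in> S" using y ny by (simp add: S_def)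
      moreover have "AE z in lebesgue. z \<notin> S"
        using AE_not_in[OF null] by (rule eventually_mono) (use interior_subset in \<open>auto simp: S_def\<close>)
      ultimately show False by (rule AE_open_contradiction)
    qed
    have cl: "closure (interior K') = K'"
      using convex_closure_interior[OF K'(1,5)] compact_imp_closed[OF K'(2)] by simp
    show ?thesis
      using continuous_constant_on_closure[of "interior K'" w 1 x] int cl that
        continuous_on_subset[OF assms(8) K'(4)] by auto
  qed
  have wcK: "wc x = 1" if "x \<in> K'" for x
    using wK[OF that] by (simp add: wc_def)

  \<comment> \<open>Being 1 on \<open>K'\<close>, which contains \<open>K\<close>, the bump competes
    in both problems and bounds both energies.\<close>
  obtain \<eta> G where \<eta>: "sob ?B \<eta> G" "\<And>x. x \<notin> ?B \<Longrightarrow> \<eta> x = 0" "\<And>x. isCont \<eta> x" "\<And>x. x \<in> K' \<Longrightarrow> \<eta> x = 1"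
    "dirichlet p G < \<infinity>" "perimeter {x. \<eta> x > 0} < \<infinity>"
    using finite_energy_competitor[OF K'(2) ne K'(4) p0] by blast
  have \<eta>K: "{x \<in> K'. \<not> (isCont \<eta> x \<and> \<eta> x = 1)} = {}" "{x \<in> K. \<not> (isCont \<eta> x \<and> \<eta> x = 1)} = {}"
    using \<eta>(3,4) K'(3) by auto
  \<comment> \<open>By monotonicity: the empty set is contained in the exceptional set of
    \<open>w\<close>, which has capacity zero.\<close>
  have empty: "sobolev_capacity p ({} :: 'a set) = 0"
    using sobolev_capacity_zero_mono[OF wH(2)] by simp
  have "dirichlet p Ac + perimeter {x. uc x > 0} \<le> dirichlet p G + perimeter {x. \<eta> x > 0}"
    by (rule minu[OF \<eta>(1)]) (assumption | rule \<eta>(2) | simp only: \<eta>K empty)+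
  moreover have "dirichlet p Wc + perimeter {x. wc x > 0} \<le> dirichlet p G + perimeter {x. \<eta> x > 0}"
    by (rule minw[OF \<eta>(1)]) (assumption | rule \<eta>(2) | simp only: \<eta>K empty)+
  moreover have "dirichlet p G + perimeter {x. \<eta> x > 0} < \<infinity>"
    using \<eta>(5,6) by simp
  ultimately have "dirichlet p Ac + perimeter {x. uc x > 0} < \<infinity>" "dirichlet p Wc + perimeter {x. wc x > 0} < \<infinity>"
    using le_less_trans by blast+
  then have fin: "dirichlet p Ac < \<infinity>" "perimeter {x. uc x > 0} < \<infinity>" "dirichlet p Wc < \<infinity>" "perimeter {x. wc x > 0} < \<infinity>"
    by auto
  have "isCont uc y \<and> uc y = 1" if y: "isCont u y" "u y = 1" for y
  proof
    show "isCont uc y" unfolding uc_def by (intro continuous_intros y(1))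
    show "uc y = 1" using y(2) by (simp add: uc_def)
  qed
  then have capuc: "sobolev_capacity p {x \<in> K. \<not> (isCont uc x \<and> uc x = 1)} = 0"
    by (intro sobolev_capacity_zero_mono[OF uH(2)]) blast

  have contr: "uc x \<le> wc ((1 - t) *\<^sub>R x0 + t *\<^sub>R x)" if x: "x \<in> ?B" and t: "0 < t" "t < 1" for x t
  proof (rule minimizer_le_contraction[OF assms(1) suc swc _ _ _ _ _ _ cuc cwc K'(3,1,4) wcK capuc minu _ fin x0 t x])
    show "uc x = 0" "wc x = 0" if "x \<notin> ?B" for x
      using zu[OF that] zw[OF that] by (auto simp: uc_def wc_def)
    show "0 \<le> uc x" "uc x \<le> 1" "0 \<le> wc x" for x
      by (auto simp: uc_def wc_def max_def)
    show "Wc x = 0" if "wc x = 0" for x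
      using that by (auto simp: wc_def Wc_def max_def split: if_splits)
    show "dirichlet p Wc + perimeter {x. wc x > 0} \<le> dirichlet p D + perimeter {x. v x > 0}"
      if "sob ?B v D" "\<And>x. x \<notin> ?B \<Longrightarrow> v x = 0" "\<And>x. x \<in> K' \<Longrightarrow> isCont v x \<and> v x = 1" for v D
    proof (rule minw[OF that(1,2)])
      have "{x \<in> K'. \<not> (isCont v x \<and> v x = 1)} = {}" using that(3) by blast
      then show "sobolev_capacity p {x \<in> K'. \<not> (isCont v x \<and> v x = 1)} = 0"
        by (simp only: empty)
    qed
  qed
  show ?thesis
  proof
    fix x assume "x \<in> {x. u x > 0}"
    then have ux: "u x > 0" by simp
    then have x: "x \<in> ?B" using zu[of x] by auto
    \<comment> \<open>The index starts at 1 because \<open>width 0 = 1\<close> would give the factor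
      t = 0, which the contraction estimate excludes.\<close>
    have "(\<lambda>k. width (Suc k)) \<longlonglongrightarrow> 0" by (rule LIMSEQ_Suc[OF width_tendsto])
    then have "(\<lambda>k. (1 - (1 - width (Suc k))) *\<^sub>R x0 + (1 - width (Suc k)) *\<^sub>R x) \<longlonglongrightarrow> (1 - (1 - 0)) *\<^sub>R x0 + (1 - 0) *\<^sub>R x"
      by (intro tendsto_intros)
    then have l: "(\<lambda>k. (1 - (1 - width (Suc k))) *\<^sub>R x0 + (1 - width (Suc k)) *\<^sub>R x) \<longlonglongrightarrow> x"
      by simp
    have "isCont wc x"
      using cwc x by (simp add: continuous_on_eq_continuous_at)
    from isCont_tendsto_compose[OF this l]
    have "(\<lambda>k. wc ((1 - (1 - width (Suc k))) *\<^sub>R x0 + (1 - width (Suc k)) *\<^sub>R x)) \<longlonglongrightarrow> wc x" .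
    then have "uc x \<le> wc x"
    proof (rule LIMSEQ_le_const)
      have "0 < 1 - width (Suc k)" "1 - width (Suc k) < 1" for k
        by (auto simp: width_def)
      then show "\<exists>N. \<forall>k\<ge>N. uc x \<le> wc ((1 - (1 - width (Suc k))) *\<^sub>R x0 + (1 - width (Suc k)) *\<^sub>R x)"
        using contr[OF x] by blast
    qed
    moreover have "uc x > 0" using ux uc_pos by blast
    ultimately have "wc x > 0" by simp
    then show "x \<in> {x. w x > 0}" using wc_pos by blast
  qed
qed

end
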